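(* Let $\beta\in\{1,2,4\}$, $N\ge1$ and $\nu_1,\dots,\nu_N>0$. Let $X$ be a random $N\times N$ matrix with real ($\beta=1$), complex ($\beta=2$) or quaternion ($\beta=4$) entries, with independent rows, the $l$-th row having the beta type I density $$\pi^{-\beta N/2}(\beta\nu_l/2)_{\beta N/2}(1-|\mathbf x|^2)^{\beta\nu_l/2-1}$$ on the unit ball of $\mathbb R^{\beta N}$. Let $\mu_1$ be the largest Lyapunov exponent of the product $P_m=X_mX_{m-1}\cdots X_1$ of independent copies $X_i$ of $X$. Then $$\mu_1=\frac12\sum_{n=-\infty}^\infty c_n\int_0^{\beta N}(\log x)\,e^{2\pi inx/\beta N}\,dx,$$ where $$c_n=\frac1{\beta N}\prod_{l=1}^N{}_1F_1\big(\beta/2,\ \beta/2+\alpha_l;\ -2\pi in/\beta N\big),\qquad \alpha_l=\beta(N+\nu_l-1)/2.$$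
   Context: A row $\mathbf x=(x_1,\dots,x_N)$ is identified with a vector in $\mathbb R^{\beta N}$ (each entry has $\beta$ real components), $|x_i|^2$ is the sum of the squares of the real components of $x_i$, $|\mathbf x|^2=\sum_i|x_i|^2$, and densities are with respect to Lebesgue measure. $(c)_s=\Gamma(c+s)/\Gamma(c)$. ${}_1F_1(a,b;z)=\sum_{k\ge0}\frac{(a)_k}{(b)_k}\frac{z^k}{k!}$ is the confluent hypergeometric function. The largest Lyapunov exponent is the almost surely constant quantity $\mu_1=\sup_{y\ne0}\lim_{m\to\infty}\frac1m\log\|P_my\|$, the supremum being over nonzero column vectors $y$ with entries in the corresponding number system and $\|\cdot\|$ the Euclidean norm ($\|y\|^2$ is the sum of the squares of all real components of $y$). Equivalently, by Oseledec's theorem, $e^{\mu_1}$ is the largest eigenvalue of $\lim_{m\to\infty}(P_m^\dagger P_m)^{1/2m}$. *)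

theory Defs
  imports "HOL-Probability.Probability"
begin

section \<open>Quaternions\<close>

datatype quat = Quat (qRe: real) (qIm1: real) (qIm2: real) (qIm3: real)

lemma quat_eq_iff:
  "x = y \<longleftrightarrow> qRe x = qRe y \<and> qIm1 x = qIm1 y \<and> qIm2 x = qIm2 y \<and> qIm3 x = qIm3 y"
  by (cases x; cases y) auto

instantiation quat :: ring_1
begin

definition zero_quat where "0 = Quat 0 0 0 0"
definition one_quat where "1 = Quat 1 0 0 0"
definition plus_quat where
  "x + y = Quat (qRe x + qRe y) (qIm1 x + qIm1 y) (qIm2 x + qIm2 y) (qIm3 x + qIm3 y)"
definition uminus_quat where "- x = Quat (- qRe x) (- qIm1 x) (- qIm2 x) (- qIm3 x)"
definition minus_quat where "x - y = x + - (y::quat)"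
definition times_quat where
  "x * y = Quat
     (qRe x * qRe y - qIm1 x * qIm1 y - qIm2 x * qIm2 y - qIm3 x * qIm3 y)
     (qRe x * qIm1 y + qIm1 x * qRe y + qIm2 x * qIm3 y - qIm3 x * qIm2 y)
     (qRe x * qIm2 y - qIm1 x * qIm3 y + qIm2 x * qRe y + qIm3 x * qIm1 y)
     (qRe x * qIm3 y + qIm1 x * qIm2 y - qIm2 x * qIm1 y + qIm3 x * qRe y)"

instance
  by standard
    (simp_all add: quat_eq_iff zero_quat_def one_quat_def plus_quat_def uminus_quat_def
      minus_quat_def times_quat_def algebra_simps)

end

lemma quat_sel_simps [simp]:
  "qRe 0 = 0" "qIm1 0 = 0" "qIm2 0 = 0" "qIm3 0 = 0"
  "qRe 1 = 1" "qIm1 1 = 0" "qIm2 1 = 0" "qIm3 1 = 0"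
  "qRe (x + y) = qRe x + qRe y" "qIm1 (x + y) = qIm1 x + qIm1 y"
  "qIm2 (x + y) = qIm2 x + qIm2 y" "qIm3 (x + y) = qIm3 x + qIm3 y"
  "qRe (- x) = - qRe x" "qIm1 (- x) = - qIm1 x" "qIm2 (- x) = - qIm2 x" "qIm3 (- x) = - qIm3 x"
  "qRe (x - y) = qRe x - qRe y" "qIm1 (x - y) = qIm1 x - qIm1 y"
  "qIm2 (x - y) = qIm2 x - qIm2 y" "qIm3 (x - y) = qIm3 x - qIm3 y"
  by (simp_all add: zero_quat_def one_quat_def plus_quat_def uminus_quat_def minus_quat_def)

instantiation quat :: real_vector
begin

definition scaleR_quat where "r *\<^sub>R x = Quat (r * qRe x) (r * qIm1 x) (r * qIm2 x) (r * qIm3 x)"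

instance
  by standard (simp_all add: quat_eq_iff scaleR_quat_def algebra_simps)

end

instantiation quat :: real_inner
begin

definition inner_quat where
  "inner x y = qRe x * qRe y + qIm1 x * qIm1 y + qIm2 x * qIm2 y + qIm3 x * qIm3 y"
definition norm_quat where "norm (x::quat) = sqrt (inner x x)"
definition dist_quat where "dist x y = norm (x - y :: quat)"
definition sgn_quat where "sgn x = x /\<^sub>R norm (x::quat)"
definition uniformity_quat where
  "(uniformity :: (quat \<times> quat) filter) = (INF e\<in>{0<..}. principal {(x, y). dist x y < e})"
definition open_quat where
  "open (U :: quat set) \<longleftrightarrow> (\<forall>x\<in>U. eventually (\<lambda>(x', y). x' = x \<longrightarrow> y \<in> U) uniformity)"

lemma inner_quat_eq_0: "inner x x = 0 \<longleftrightarrow> x = (0::quat)"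
proof
  assume "inner x x = 0"
  moreover have "0 \<le> qRe x * qRe x" "0 \<le> qIm1 x * qIm1 x" "0 \<le> qIm2 x * qIm2 x" "0 \<le> qIm3 x * qIm3 x"
    by simp_all
  ultimately have "qRe x * qRe x = 0" "qIm1 x * qIm1 x = 0" "qIm2 x * qIm2 x = 0" "qIm3 x * qIm3 x = 0"
    unfolding inner_quat_def by linarith+
  then show "x = 0"
    by (simp add: quat_eq_iff)
qed (simp add: inner_quat_def)

instance
proof
  fix x y z :: quat and r :: real
  show "inner x y = inner y x" "inner (x + y) z = inner x z + inner y z"
    "inner (r *\<^sub>R x) y = r * inner x y"
    by (simp_all add: inner_quat_def scaleR_quat_def algebra_simps)
  show "0 \<le> inner x x"
    by (simp add: inner_quat_def)
qed (fact dist_quat_def sgn_quat_def uniformity_quat_def open_quat_def norm_quat_def inner_quat_eq_0)+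

end

instantiation quat :: real_normed_div_algebra
begin

definition inverse_quat where
  "inverse x = Quat (qRe x) (- qIm1 x) (- qIm2 x) (- qIm3 x) /\<^sub>R inner x (x::quat)"
definition divide_quat where "x div y = x * inverse (y::quat)"

instance
proof
  fix x y :: quat and r :: real
  show "x div y = x * inverse y" by (rule divide_quat_def)
  show "inverse (0::quat) = 0"
    by (simp add: inverse_quat_def quat_eq_iff scaleR_quat_def)
  show "r *\<^sub>R x * y = r *\<^sub>R (x * y)" "x * r *\<^sub>R y = r *\<^sub>R (x * y)"
    by (simp_all add: quat_eq_iff scaleR_quat_def times_quat_def algebra_simps)
  show "norm (x * y) = norm x * norm y"
    unfolding norm_quat_def real_sqrt_mult [symmetric]
    by (rule arg_cong [where f = sqrt]) (simp add: inner_quat_def times_quat_def algebra_simps)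
  assume "x \<noteq> 0"
  then have nz: "inner x x \<noteq> 0" by (simp add: inner_quat_eq_0)
  have 1: "Quat (qRe x) (- qIm1 x) (- qIm2 x) (- qIm3 x) * x = inner x x *\<^sub>R 1"
    "x * Quat (qRe x) (- qIm1 x) (- qIm2 x) (- qIm3 x) = inner x x *\<^sub>R 1"
    by (simp_all add: quat_eq_iff scaleR_quat_def times_quat_def inner_quat_def algebra_simps)
  have l: "(s *\<^sub>R u) * v = s *\<^sub>R (u * v)" "u * (s *\<^sub>R v) = s *\<^sub>R (u * v)" for s and u v :: quat
    by (simp_all add: quat_eq_iff scaleR_quat_def times_quat_def algebra_simps)
  show "inverse x * x = 1" "x * inverse x = 1"
    using nz by (simp_all add: inverse_quat_def l 1 del: inner_eq_zero_iff)
qed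

end

instantiation quat :: euclidean_space
begin

definition Basis_quat where
  "Basis = {Quat 1 0 0 0, Quat 0 1 0 0, Quat 0 0 1 0, Quat 0 0 0 1}"

instance
proof
  show "(Basis :: quat set) \<noteq> {}" "finite (Basis :: quat set)"
    by (simp_all add: Basis_quat_def)
  show "inner u v = (if u = v then 1 else 0)" if "u \<in> Basis" "v \<in> Basis" for u v :: quat
    using that unfolding Basis_quat_def by (elim insertE emptyE) (simp_all add: inner_quat_def)
  show "(\<forall>u\<in>Basis. inner x u = 0) \<longleftrightarrow> x = 0" for x :: quat
    by (simp add: Basis_quat_def inner_quat_def quat_eq_iff [of x 0])
qed

end

lemma DIM_quat: "DIM(quat) = 4"
  by (simp add: Basis_quat_def)

section \<open>Special functions\<close>

text \<open>The generalised rising factorial with a real increment; for natural \<open>s\<close> and \<open>c > 0\<close> it is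
  \<^const>\<open>pochhammer\<close>.\<close>

definition rising :: "real \<Rightarrow> real \<Rightarrow> real" where
  "rising c s = Gamma (c + s) / Gamma c"

definition hyp1F1 :: "real \<Rightarrow> real \<Rightarrow> complex \<Rightarrow> complex" where
  "hyp1F1 a b z = (\<Sum>k. of_real (rising a (real k) / rising b (real k)) * (z ^ k / fact k))"

section \<open>Random matrices with beta type I rows\<close>

text \<open>Below, \<open>'k\<close> is a real normed division algebra whose norm comes from an inner product,
  of real dimension \<open>DIM('k)\<close>. The instances \<^typ>\<open>real\<close>, \<^typ>\<open>complex\<close> and \<^typ>\<open>quat\<close>
  are, up to isometric isomorphism, the only ones (Frobenius). A row of type \<open>'k^'n\<close> is an element
  of a Euclidean space of dimension \<open>DIM('k) * CARD('n)\<close>; its norm is the Euclidean one and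
  \<^const>\<open>lborel\<close> is the Lebesgue measure there.\<close>

definition beta_I_density ::
  "nat \<Rightarrow> real \<Rightarrow> ('k::{real_normed_div_algebra,euclidean_space})^'n \<Rightarrow> real" where
  "beta_I_density \<beta> \<nu> x =
     pi powr - (real \<beta> * real CARD('n) / 2)
       * rising (real \<beta> * \<nu> / 2) (real \<beta> * real CARD('n) / 2)
       * (1 - (norm x)\<^sup>2) powr (real \<beta> * \<nu> / 2 - 1) * indicator (ball 0 1) x"

definition beta_I_rows ::
  "'w measure \<Rightarrow> nat \<Rightarrow> ('n \<Rightarrow> real)
    \<Rightarrow> ('w \<Rightarrow> ('k::{real_normed_div_algebra,euclidean_space})^'n^'n) \<Rightarrow> bool" where
  "beta_I_rows M \<beta> \<nu> X \<longleftrightarrow>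
     prob_space.indep_vars M (\<lambda>_. borel) (\<lambda>l \<omega>. X \<omega> $ l) UNIV \<and>
     (\<forall>l. distributed M lborel (\<lambda>\<omega>. X \<omega> $ l) (\<lambda>x. ennreal (beta_I_density \<beta> (\<nu> l) x)))"

section \<open>Largest Lyapunov exponent\<close>

fun matrix_product :: "(nat \<Rightarrow> ('k::semiring_1)^'n^'n) \<Rightarrow> nat \<Rightarrow> 'k^'n^'n" where
  "matrix_product A 0 = mat 1"
| "matrix_product A (Suc m) = A (Suc m) ** matrix_product A m"

text \<open>The library has \<open>ln 0 = 0\<close>; a vector annihilated by the product must have exponent
  \<open>-\<infinity>\<close> instead.\<close>

definition eln :: "real \<Rightarrow> ereal" where
  "eln r = (if r = 0 then - \<infinity> else ereal (ln r))"

definition growth_rate ::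
  "(nat \<Rightarrow> ('k::{real_normed_div_algebra,euclidean_space})^'n^'n) \<Rightarrow> 'k^'n \<Rightarrow> nat \<Rightarrow> ereal" where
  "growth_rate A y m = ereal (1 / real m) * eln (norm (matrix_product A m *v y))"

text \<open>The first clause takes the supremum over all limits along nonzero vectors. Almost surely the
  limit exists for every nonzero vector (Oseledec), but this is not built into the first clause;
  the second clause ensures that a vector without a limit could not grow faster either.\<close>

definition is_largest_lyapunov_exponent ::
  "'w measure \<Rightarrow> (nat \<Rightarrow> 'w \<Rightarrow> ('k::{real_normed_div_algebra,euclidean_space})^'n^'n)
    \<Rightarrow> real \<Rightarrow> bool" where
  "is_largest_lyapunov_exponent M X \<mu> \<longleftrightarrow>
     (AE \<omega> in M.
        Sup {L. \<exists>y. y \<noteq> 0 \<and> growth_rate (\<lambda>i. X i \<omega>) y \<longlonglongrightarrow> L} = ereal \<mu> \<and>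
        (SUP y\<in>{y. y \<noteq> 0}. limsup (growth_rate (\<lambda>i. X i \<omega>) y)) = ereal \<mu>)"

section \<open>The Fourier coefficients\<close>

definition alpha :: "nat \<Rightarrow> ('n::finite \<Rightarrow> real) \<Rightarrow> 'n \<Rightarrow> real" where
  "alpha \<beta> \<nu> l = real \<beta> * (real CARD('n) + \<nu> l - 1) / 2"

definition fourier_coeff :: "nat \<Rightarrow> ('n::finite \<Rightarrow> real) \<Rightarrow> int \<Rightarrow> complex" where
  "fourier_coeff \<beta> \<nu> n =
     of_real (1 / (real \<beta> * real CARD('n))) *
     (\<Prod>l\<in>UNIV. hyp1F1 (real \<beta> / 2) (real \<beta> / 2 + alpha \<beta> \<nu> l)
        (- (2 * of_real pi * \<i> * of_int n / (of_nat \<beta> * of_nat CARD('n)))))"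

definition log_fourier_integral :: "real \<Rightarrow> int \<Rightarrow> complex" where
  "log_fourier_integral b n =
     (LINT x:{0..b}|lborel. of_real (ln x) * exp (2 * of_real pi * \<i> * of_int n * of_real x / of_real b))"

end

theory Submission
  imports Defs
begin

text \<open>
  For a unit vector \<open>u\<close>, the entries of \<open>X u\<close> are independent, and by rotation invariance each
  \<open>\<bar>(X u)\<^sub>l\<bar>\<^sup>2\<close> is beta distributed with parameters \<open>\<beta>/2, \<alpha>\<^sub>l\<close>, whatever \<open>u\<close> is. Hence \<open>\<parallel>P\<^sub>m y\<parallel>\<^sup>2\<close> is a
  product of independent copies of \<open>S = \<parallel>X u\<parallel>\<^sup>2\<close>, and exponential moment bounds with the Borel--Cantelli lemma
  give \<open>\<mu>\<^sub>1 = E (log S) / 2\<close>.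

  As \<open>{}\<^sub>1F\<^sub>1\<close> is the moment generating function of the beta law, \<open>c\<^sub>n\<close> is the Fourier coefficient on \<open>[0, b]\<close>,
  \<open>b = \<beta>N\<close>, of the law of \<open>S\<close>. The law need not have a square integrable density and the logarithm is
  unbounded, so Parseval's identity is not available. Instead
  \<open>E (log S) = log b - \<integral> P (S \<le> t) / t dt\<close> over \<open>[0, b]\<close>, where the distribution function is expanded in its
  Fourier series; termwise integration is justified by \<open>c\<^sub>n = O(n\<^sup>-\<^sup>\<epsilon>)\<close>, and an integration by parts turns the
  integrals into the Fourier integrals of the logarithm.
\<close>


text \<open>The weight 1/t is the obstacle. Decay n^-\<epsilon> of c_n makes the coefficients of the
  distribution function O(n^(-1-\<epsilon>)) uniformly in t, but such a bound is not integrable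
  against 1/t at 0. Each coefficient function vanishes at t = 0, however, and interpolation between
  |e^(ix) - 1| <= |x| and |e^(ix) - 1| <= 2 gives 2 |x|^\<eta>. With \<eta> = \<epsilon>/2, half of
  the decay buys the integrable singularity t^(\<epsilon>/2-1), and the summable n^(-1-\<epsilon>/2)
  remains.

  The interval [0, b] only has to contain the values of S, and S < N <= \<beta>N almost surely.

  The null set outside which ln |P_m y| / m converges depends on y, and there are uncountably many
  y. Convergence is therefore established for the standard basis vectors alone; every other vector
  is controlled from above by the columns of P_m, which suffices for a supremum and replaces
  Oseledec's theorem.

  All three number systems are treated at once: only the multiplicativity of the norm and its inner
  product enter.\<close>

section \<open>Fourier series of a distribution function\<close>

text \<open>The Abel means of the sawtooth series; they are bounded by \<open>\<pi> / 2\<close> because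
  \<open>1 - r e\<^sup>i\<^sup>\<theta>\<close> lies in the right half plane, which permits dominated convergence as \<open>r\<close> tends to \<open>1\<close>.\<close>

definition abel_saw :: "real \<Rightarrow> real \<Rightarrow> real" where
  "abel_saw r \<theta> = - Im (Ln (1 - of_real r * cis \<theta>))"

text \<open>Imaginary part of the power series of \<open>- Ln (1 - z)\<close> at z = r
  e^(i\<theta>). The term of index 0 is 0 / 0 = 0, so starting there is harmless.\<close>

lemma abel_saw_sums:
  assumes "0 \<le> r" "r < 1"
  shows "(\<lambda>n. r ^ n * sin (real n * \<theta>) / real n) sums abel_saw r \<theta>"
proof -
  have "cmod (- (of_real r * cis \<theta>)) < 1" using assms by (simp add: norm_mult)
  from sums_Im[OF sums_minus[OF Ln_series'[OF this]]]
  have "(\<lambda>n. Im ((of_real r * cis \<theta>) ^ n / of_nat n)) sums abel_saw r \<theta>"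
    by (simp add: abel_saw_def)
  moreover have "Im ((of_real r * cis \<theta>) ^ n / of_nat n) = r ^ n * sin (real n * \<theta>) / real n" for n
  proof -
    have eq: "(of_real r * cis \<theta>) ^ n / of_nat n = of_real (r ^ n / real n) * cis (real n * \<theta>)"
      by (simp add: power_mult_distrib Complex.DeMoivre)
    show ?thesis unfolding eq by simp
  qed
  ultimately show ?thesis by (simp only:)
qed

lemma Re_one_minus_cis_pos:
  assumes "0 \<le> r" "r < 1"
  shows "Re (1 - of_real r * cis \<theta>) > 0"
proof -
  have "r * cos \<theta> \<le> r * 1" using assms by (intro mult_left_mono) auto
  then show ?thesis using assms by simp
qed

lemma abs_abel_saw_le:
  assumes "0 \<le> r" "r < 1"
  shows "\<bar>abel_saw r \<theta>\<bar> \<le> pi / 2"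
proof -
  let ?z = "1 - of_real r * cis \<theta>"
  have "Re ?z > 0" by (rule Re_one_minus_cis_pos[OF assms])
  moreover then have "?z \<noteq> 0" by (metis zero_complex.sel(1) less_irrefl)
  ultimately have "\<bar>Im (Ln ?z)\<bar> < pi / 2" using Re_Ln_pos_lt by blast
  then show ?thesis by (simp add: abel_saw_def)
qed

lemma abel_saw_minus:
  assumes "0 \<le> r" "r < 1"
  shows "abel_saw r (- \<theta>) = - abel_saw r \<theta>"
proof -
  have "(\<lambda>n. - (r ^ n * sin (real n * \<theta>) / real n)) sums - abel_saw r \<theta>"
    by (intro sums_minus abel_saw_sums assms)
  moreover have "(\<lambda>n. r ^ n * sin (real n * - \<theta>) / real n) = (\<lambda>n. - (r ^ n * sin (real n * \<theta>) / real n))"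
    by simp
  ultimately show ?thesis using abel_saw_sums[OF assms, of "- \<theta>"] sums_unique2 by metis
qed

lemma abel_saw_tendsto:
  fixes r :: "nat \<Rightarrow> real"
  assumes \<theta>: "0 < \<theta>" "\<theta> < 2 * pi" and r: "r \<longlonglongrightarrow> 1"
  shows "(\<lambda>k. abel_saw (r k) \<theta>) \<longlonglongrightarrow> (pi - \<theta>) / 2"
proof -
  \<comment> \<open>Polar form: 1 - e^(i\<theta>) = 2 sin(\<theta>/2) e^(i(\<theta>-\<pi>)/2). For 0
    < \<theta> < 2\<pi> the modulus is positive and the angle lies in the principal range.\<close>
  let ?w = "Complex (ln (2 * sin (\<theta> / 2))) ((\<theta> - pi) / 2)"
  have s: "sin (\<theta> / 2) > 0" using \<theta> by (intro sin_gt_zero) auto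
  have c: "cos \<theta> = 1 - 2 * (sin (\<theta>/2))\<^sup>2" "sin \<theta> = 2 * sin (\<theta>/2) * cos (\<theta>/2)"
    using cos_double_sin[of "\<theta>/2"] sin_double[of "\<theta>/2"] by auto
  have "exp ?w = 1 - cis \<theta>"
    using s by (simp add: exp_eq_polar complex_eq_iff c diff_divide_distrib cos_diff sin_diff power2_eq_square)
  then have "Ln (1 - cis \<theta>) = ?w"
    using \<theta> by (intro Ln_unique) auto
  moreover have "Re (1 - cis \<theta>) > 0" using s by (simp add: c)
  then have "1 - cis \<theta> \<notin> \<real>\<^sub>\<le>\<^sub>0" by (auto simp: complex_nonpos_Reals_iff)
  then have "(\<lambda>k. Ln (1 - of_real (r k) * cis \<theta>)) \<longlonglongrightarrow> Ln (1 - of_real 1 * cis \<theta>)"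
    by (intro tendsto_intros r) auto
  ultimately have lim: "(\<lambda>k. - Im (Ln (1 - of_real (r k) * cis \<theta>))) \<longlonglongrightarrow> - Im ?w"
    by (intro tendsto_intros) auto
  have "- Im ?w = (pi - \<theta>) / 2" by (simp add: field_simps)
  then show ?thesis using lim by (simp only: abel_saw_def)
qed

lemma measurable_abel_saw:
  assumes "0 \<le> r" "r < 1"
  shows "abel_saw r \<in> borel_measurable borel"
proof -
  have "1 - of_real r * cis \<theta> \<notin> \<real>\<^sub>\<le>\<^sub>0" for \<theta>
    using Re_one_minus_cis_pos[OF assms, of \<theta>] by (auto simp: complex_nonpos_Reals_iff)
  then have "continuous_on UNIV (abel_saw r)"
    unfolding abel_saw_def[abs_def] by (intro continuous_intros) auto
  then show ?thesis by (rule borel_measurable_continuous_onI)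
qed

text \<open>Interpolates between the Lipschitz bound near 0 and the trivial bound 2; the free
  exponent later divides the decay between n and t.\<close>

lemma norm_cis_minus_1_le:
  assumes "0 < \<eta>" "\<eta> \<le> 1"
  shows "norm (cis \<theta> - 1) \<le> 2 * \<bar>\<theta>\<bar> powr \<eta>"
proof (cases "\<bar>\<theta>\<bar> \<le> 1")
  case True
  have *: "norm (cis \<theta> - 1) = 2 * \<bar>sin (\<theta> / 2)\<bar>"
    using dist_exp_i_1[of \<theta>] by (simp add: cis_conv_exp)
  also have "\<dots> \<le> \<bar>\<theta>\<bar>" using abs_sin_x_le_abs_x[of "\<theta>/2"] by simp
  also have "\<dots> \<le> \<bar>\<theta>\<bar> powr \<eta>"
    using True assms powr_mono'[of \<eta> 1 "\<bar>\<theta>\<bar>"] by simp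
  also have "\<dots> \<le> 2 * \<bar>\<theta>\<bar> powr \<eta>" by simp
  finally show ?thesis .
next
  case False
  have "norm (cis \<theta> - 1) \<le> norm (cis \<theta>) + norm (1::complex)" by (rule norm_triangle_ineq4)
  moreover have "\<bar>\<theta>\<bar> powr \<eta> \<ge> 1" using False assms by (intro ge_one_powr_ge_zero) auto
  ultimately show ?thesis by simp
qed

text \<open>Let \<psi>(x) = (\<pi> - x)/2 on (0, 2\<pi>), extended as an odd periodic function, and
  w = 2\<pi>/b. Then (\<psi>(w(t-s)) + \<psi>(ws)) / \<pi> is 1 - t/b for s < t and -t/b for s > t;
  averaging over \<open>Q\<close> gives the limit. At its jump the sawtooth series takes the
  midpoint value, hence the exclusion of an atom at \<open>t\<close>.\<close>

lemma cdf_Fourier_sums: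
  fixes Q :: "real measure" and b t :: real
  defines "a \<equiv> (\<lambda>n::nat. (\<integral>s. sin (real n * (2 * pi / b * (t - s))) + sin (real n * (2 * pi / b * s)) \<partial>Q) / (pi * real n))"
  assumes Q: "prob_space Q" and [measurable_cong]: "sets Q = sets borel" and b: "b > 0"
    and AE: "AE s in Q. 0 < s \<and> s < b" and t: "0 < t" "t < b" "AE s in Q. s \<noteq> t"
    and summ: "summable (\<lambda>n. \<bar>a n\<bar>)"
  shows "a sums (measure Q {..t} - t / b)"
proof -
  interpret Q: prob_space Q by fact
  define w where "w = 2 * pi / b"
  define r where "r = (\<lambda>k. 1 - 1 / (real k + 2))"
  have r: "0 \<le> r k" "r k < 1" for k by (auto simp: r_def field_simps)
  have rlim: "r \<longlonglongrightarrow> 1"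
    unfolding r_def by real_asymp
  have [measurable]: "abel_saw (r k) \<in> borel_measurable borel" for k
    by (rule measurable_abel_saw[OF r])
  let ?g = "\<lambda>n s. (sin (real n * (w * (t - s))) + sin (real n * (w * s)))"
  have a_def': "a n = (\<integral>s. ?g n s \<partial>Q) / (pi * real n)" for n by (simp add: a_def w_def)
  have int_g [simp]: "integrable Q (?g n)" for n
  proof (rule Q.integrable_const_bound[where B = 2], rule AE_I2)
    fix s
    have "\<bar>sin (real n * (w * (t - s)))\<bar> \<le> 1" "\<bar>sin (real n * (w * s))\<bar> \<le> 1" by auto
    then show "norm (?g n s) \<le> 2" unfolding real_norm_def by linarith
  qed auto
  have bound: "norm (\<integral>s. ?g n s \<partial>Q) \<le> 2" for n
  proof -
    have "norm (?g n s) \<le> 2" for s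
    proof -
      have "\<bar>sin (real n * (w * (t - s)))\<bar> \<le> 1" "\<bar>sin (real n * (w * s))\<bar> \<le> 1" by auto
      then show "norm (?g n s) \<le> 2" unfolding real_norm_def by linarith
    qed
    then have "(\<integral>s. norm (?g n s) \<partial>Q) \<le> 2"
      by (intro Q.integral_le_const) (auto intro!: integrable_norm)
    then show ?thesis using integral_norm_bound[of Q "?g n"] by linarith
  qed
  \<comment> \<open>For fixed r < 1 the geometric factor dominates the series uniformly in s, so sum
    and integral can be exchanged.\<close>
  have step: "(\<lambda>n. r k ^ n * a n) sums (\<integral>s. (abel_saw (r k) (w * (t - s)) + abel_saw (r k) (w * s)) / pi \<partial>Q)" for k
  proof -
    let ?f = "\<lambda>n s. r k ^ n * ?g n s / (pi * real n)"
    have sf: "(\<lambda>n. ?f n s) sums ((abel_saw (r k) (w * (t - s)) + abel_saw (r k) (w * s)) / pi)" for s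
      using sums_divide[OF sums_add[OF abel_saw_sums[OF r, of k "w * (t - s)"] abel_saw_sums[OF r, of k "w * s"]], of pi]
      by (simp add: distrib_left add_divide_distrib mult.commute[of pi])
    have geo: "summable (\<lambda>n. 2 * r k ^ n)" using r by (intro summable_mult summable_geometric) auto
    have nb: "norm (?f n s) \<le> 2 * r k ^ n" for n s
    proof (cases "n = 0")
      case False
      have "\<bar>sin (real n * (w * (t - s)))\<bar> \<le> 1" "\<bar>sin (real n * (w * s))\<bar> \<le> 1" by auto
      then have "\<bar>?g n s\<bar> \<le> 2" by linarith
      then have "r k ^ n * \<bar>?g n s\<bar> / (pi * real n) \<le> r k ^ n * 2 / 1"
        using False r pi_ge_two by (intro frac_le mult_left_mono mult_nonneg_nonneg zero_le_power) (auto intro!: mult_ge1_I)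
      then show ?thesis using r[of k] by (simp add: abs_mult abs_divide mult.commute)
    qed (use r in auto)
    have "(\<lambda>n. \<integral>s. ?f n s \<partial>Q) sums (\<integral>s. (\<Sum>n. ?f n s) \<partial>Q)"
    proof (rule sums_integral)
      show "integrable Q (?f n)" for n using int_g[of n] by simp
      show "AE s in Q. summable (\<lambda>n. norm (?f n s))"
        by (intro AE_I2 summable_comparison_test'[OF geo, of 0]) (use nb in auto)
      have "\<bar>\<integral>s. norm (?f n s) \<partial>Q\<bar> \<le> 2 * r k ^ n" for n
      proof -
        have "(\<integral>s. norm (?f n s) \<partial>Q) \<le> 2 * r k ^ n"
          using nb int_g[of n] by (intro Q.integral_le_const) (auto intro!: integrable_norm simp del: real_norm_def)
        moreover have "(\<integral>s. norm (?f n s) \<partial>Q) \<ge> 0" by (intro Bochner_Integration.integral_nonneg) auto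
        ultimately show ?thesis by linarith
      qed
      then show "summable (\<lambda>n. \<integral>s. norm (?f n s) \<partial>Q)"
        by (intro summable_comparison_test'[OF geo, of 0]) (auto simp del: real_norm_def simp: real_norm_def[of "integral\<^sup>L _ _"])
    qed
    moreover have "(\<integral>s. ?f n s \<partial>Q) = r k ^ n * a n" for n by (simp add: a_def')
    ultimately show ?thesis using sf by (simp add: sums_iff)
  qed
  \<comment> \<open>Abel's theorem in its easy case: absolute summability of \<open>a\<close>
    supplies the dominating series as r tends to 1.\<close>
  have "(\<lambda>k. \<Sum>n. r k ^ n * a n) \<longlonglongrightarrow> (\<Sum>n. a n)"
  proof -
    have "(\<forall>\<^sub>F n in sequentially. summable (\<lambda>k. norm (r n ^ k * a k))) \<and>
     summable (\<lambda>n. norm (a n)) \<and> ((\<lambda>n. \<Sum>k. r n ^ k * a k) \<longlonglongrightarrow> suminf a)"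
    proof (rule tannerys_theorem)
      show "(\<lambda>n. r n ^ k * a k) \<longlonglongrightarrow> a k" for k
        using tendsto_mult[OF tendsto_power[OF rlim, of k] tendsto_const[of "a k"]] by simp
      have "norm (r n ^ k * a k) \<le> \<bar>a k\<bar>" for n k
        using r[of n] by (auto simp: abs_mult power_le_one intro!: mult_left_le_one_le)
      then show "\<forall>\<^sub>F (k, n) in sequentially \<times>\<^sub>F sequentially. norm (r n ^ k * a k) \<le> \<bar>a k\<bar>"
        by (simp add: case_prod_unfold)
    qed (use summ in auto)
    then show ?thesis by auto
  qed
  moreover have "(\<lambda>k. \<integral>s. (abel_saw (r k) (w * (t - s)) + abel_saw (r k) (w * s)) / pi \<partial>Q)
      \<longlonglongrightarrow> (\<integral>s. indicator {..t} s - t / b \<partial>Q)"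
  proof (rule integral_dominated_convergence[where w = "\<lambda>_. 1"])
    have wb: "w * b = 2 * pi" "w > 0" using b by (auto simp: w_def)
    show "AE s in Q. (\<lambda>k. (abel_saw (r k) (w * (t - s)) + abel_saw (r k) (w * s)) / pi)
        \<longlonglongrightarrow> indicator {..t} s - t / b"
      using AE t(3)
    proof eventually_elim
      case (elim s)
      have lt: "w * s < 2 * pi" unfolding wb(1)[symmetric] using elim wb(2) by simp
      then have s: "0 < w * s" "w * s < 2 * pi" using elim wb(2) by auto
      have l2: "(\<lambda>k. abel_saw (r k) (w * s)) \<longlonglongrightarrow> (pi - w * s) / 2"
        by (rule abel_saw_tendsto[OF s rlim])
      show ?case
      proof (cases "s < t")
        case True
        have lt: "w * (t - s) < 2 * pi" unfolding wb(1)[symmetric] using elim wb(2) t by simp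
        then have "0 < w * (t - s)" "w * (t - s) < 2 * pi" using True wb by auto
        note l1 = abel_saw_tendsto[OF this rlim]
        have "((pi - w * (t - s)) / 2 + (pi - w * s) / 2) / pi = indicator {..t} s - t / b"
          using True b by (simp add: w_def field_simps)
        then show ?thesis using tendsto_divide[OF tendsto_add[OF l1 l2] tendsto_const[of pi] pi_neq_zero] by simp
      next
        case False
        have lt: "w * (s - t) < 2 * pi" unfolding wb(1)[symmetric] using elim wb(2) t by simp
        then have "0 < w * (s - t)" "w * (s - t) < 2 * pi" using False wb elim by auto
        have st: "\<not> s \<le> t" using False elim by auto
        from \<open>0 < w * (s - t)\<close> \<open>w * (s - t) < 2 * pi\<close>
        have "(\<lambda>k. abel_saw (r k) (w * (s - t))) \<longlonglongrightarrow> (pi - w * (s - t)) / 2" using rlim by (rule abel_saw_tendsto)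
        then have "(\<lambda>k. - abel_saw (r k) (w * (s - t))) \<longlonglongrightarrow> - ((pi - w * (s - t)) / 2)" by (rule tendsto_minus)
        moreover have "- abel_saw (r k) (w * (s - t)) = abel_saw (r k) (w * (t - s))" for k
          using abel_saw_minus[OF r, of k "w * (s - t)"] by (simp add: algebra_simps)
        ultimately have "(\<lambda>k. abel_saw (r k) (w * (t - s))) \<longlonglongrightarrow> - ((pi - w * (s - t)) / 2)" by simp
        note l1 = this
        have "(- ((pi - w * (s - t)) / 2) + (pi - w * s) / 2) / pi = indicator {..t} s - t / b"
          using st b by (simp add: w_def field_simps)
        then show ?thesis using tendsto_divide[OF tendsto_add[OF l1 l2] tendsto_const[of pi] pi_neq_zero] by simp
      qed
    qed
    show "AE s in Q. norm ((abel_saw (r k) (w * (t - s)) + abel_saw (r k) (w * s)) / pi) \<le> 1" for k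
    proof (rule AE_I2)
      fix s
      have "\<bar>abel_saw (r k) (w * (t - s))\<bar> \<le> pi / 2" "\<bar>abel_saw (r k) (w * s)\<bar> \<le> pi / 2"
        by (intro abs_abel_saw_le r)+
      then show "norm ((abel_saw (r k) (w * (t - s)) + abel_saw (r k) (w * s)) / pi) \<le> 1" by simp
    qed
  qed auto
  moreover have "(\<integral>s. indicator {..t} s - t / b \<partial>Q) = measure Q {..t} - t / b"
  proof -
    have "integrable Q (indicator {..t} :: real \<Rightarrow> real)"
      by (intro Q.integrable_const_bound[where B = 1]) (auto split: split_indicator)
    then have "(\<integral>s. indicator {..t} s - t / b \<partial>Q) = (\<integral>s. indicator {..t} s \<partial>Q) - (\<integral>s. t / b \<partial>Q)"
      by (intro Bochner_Integration.integral_diff) auto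
    moreover have "space Q = UNIV" using sets_eq_imp_space_eq[of Q borel] assms by simp
    ultimately show ?thesis using Q.prob_space by simp
  qed
  moreover have "\<And>k. (\<Sum>n. r k ^ n * a n) = (\<integral>s. (abel_saw (r k) (w * (t - s)) + abel_saw (r k) (w * s)) / pi \<partial>Q)"
    by (rule sums_unique[OF step, symmetric])
  ultimately have "(\<Sum>n. a n) = measure Q {..t} - t / b"
    using LIMSEQ_unique by (simp only:)
  moreover have "summable a" using summ by (rule summable_rabs_cancel)
  ultimately show ?thesis by (simp add: sums_iff)
qed

section \<open>Powers, the logarithm and its Fourier integrals on [0, b]\<close>

text \<open>One power dominates for large x, the other near 0, so moments of both signs control the
  logarithm.\<close>

lemma abs_ln_le_powr:
  fixes x a :: real
  assumes "0 < x" "0 < a"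
  shows "\<bar>ln x\<bar> \<le> x powr a / a + x powr - a / a"
proof (cases "1 \<le> x")
  case True
  have "x powr - a / a \<ge> 0" using assms by simp
  moreover have "ln x \<le> x powr a / a" "\<bar>ln x\<bar> = ln x" using ln_powr_bound[of x a] True assms by auto
  ultimately show ?thesis by linarith
next
  case False
  then have "ln (1 / x) \<le> (1 / x) powr a / a" using assms by (intro ln_powr_bound) auto
  also have "(1 / x) powr a = x powr - a" using assms by (simp add: powr_divide powr_minus_divide)
  finally have "- ln x \<le> x powr - a / a" using assms by (simp add: ln_div)
  moreover have "x powr a / a \<ge> 0" "\<bar>ln x\<bar> = - ln x" using assms False by auto
  ultimately show ?thesis by linarith
qed

lemma set_integrable_powr_Icc_0:
  fixes a b :: real
  assumes "a > -1"
  shows "set_integrable lborel {0..b} (\<lambda>x. x powr a)"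
proof (cases "b \<ge> 0")
  case True
  have "(\<lambda>x. x powr a) absolutely_integrable_on {0..b}"
    by (intro nonnegative_absolutely_integrable_1 integrable_on_powr_from_0 assms True) auto
  then show ?thesis
    unfolding set_integrable_def by (subst (asm) integrable_completion) auto
qed (simp add: set_integrable_def)

lemma set_integrable_ln_Icc_0: "set_integrable lborel {0..b::real} ln"
proof (rule set_integrable_bound)
  show "set_integrable lborel {0..b} (\<lambda>x::real. x powr (1/2) / (1/2) + x powr - (1/2) / (1/2))"
    by (intro set_integral_add set_integrable_divide set_integrable_powr_Icc_0) auto
  show "AE x in lborel. x \<in> {0..b} \<longrightarrow> norm (ln x) \<le> norm (x powr (1/2) / (1/2) + x powr - (1/2) / (1/2))"
  proof (rule AE_I2, rule impI)
    fix x assume "x \<in> {0..b}"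
    then show "norm (ln x) \<le> norm (x powr (1/2) / (1/2) + x powr - (1/2) / (1/2))"
      using abs_ln_le_powr[of x "1/2"] by (cases "x = 0") auto
  qed
qed (simp add: set_borel_measurable_def)

lemma set_integral_powr_Icc_0:
  fixes a b :: real
  assumes "a > -1" "b \<ge> 0"
  shows "(LINT x:{0..b}|lborel. x powr a) = b powr (a + 1) / (a + 1)"
  using set_borel_integral_eq_integral(2)[OF set_integrable_powr_Icc_0[OF assms(1), of b]]
    integral_unique[OF has_integral_powr_from_0[OF assms]] by simp

lemma set_integral_ln_Icc_0:
  fixes b :: real
  assumes "b > 0"
  shows "(LINT x:{0..b}|lborel. ln x) = b * ln b - b"
proof -
  have "(ln has_integral (b * ln b - b) - (0 * ln 0 - 0)) {0..b}"
  proof (rule fundamental_theorem_of_calculus_interior)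
    show "continuous_on {0..b} (\<lambda>x. x * ln x - x)"
    proof (intro continuous_on_diff continuous_on_id)
      show "continuous_on {0..b} (\<lambda>x. x * ln x)"
        unfolding continuous_on
      proof
        fix x assume x: "x \<in> {0..b}"
        show "((\<lambda>x. x * ln x) \<longlongrightarrow> x * ln x) (at x within {0..b})"
        proof (cases "x = 0")
          case True
          have "((\<lambda>x::real. x * ln x) \<longlongrightarrow> 0) (at_right 0)" by real_asymp
          then show ?thesis unfolding True
            using assms by (simp add: at_within_Icc_at_right)
        qed (use x in \<open>auto intro!: tendsto_intros\<close>)
      qed
    qed
    fix x assume "x \<in> {0<..<b}"
    then show "((\<lambda>x. x * ln x - x) has_vector_derivative ln x) (at x)"
      unfolding has_real_derivative_iff_has_vector_derivative[symmetric]
      by (auto intro!: derivative_eq_intros)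
  qed (use assms in auto)
  from integral_unique[OF this] show ?thesis
    by (simp add: set_borel_integral_eq_integral(2)[OF set_integrable_ln_Icc_0])
qed

lemma log_fourier_integral_cis:
  "log_fourier_integral b n = (LINT x:{0..b}|lborel. of_real (ln x) * cis (2 * pi / b * real_of_int n * x))"
proof -
  have "exp (2 * of_real pi * \<i> * of_int n * of_real x / of_real b) = cis (2 * pi / b * real_of_int n * x)" for x
    by (simp add: cis_conv_exp mult_ac)
  then show ?thesis by (simp add: log_fourier_integral_def)
qed

lemma log_fourier_integral_uminus: "log_fourier_integral b (- n) = cnj (log_fourier_integral b n)"
proof -
  have "log_fourier_integral b (- n) =
      (\<integral>x. cnj (indicator {0..b} x *\<^sub>R (of_real (ln x) * cis (2 * pi / b * real_of_int n * x))) \<partial>lborel)"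
    unfolding log_fourier_integral_cis set_lebesgue_integral_def
    by (intro Bochner_Integration.integral_cong) (simp_all add: cis_cnj)
  also have "\<dots> = cnj (log_fourier_integral b n)"
    unfolding log_fourier_integral_cis set_lebesgue_integral_def by (rule Bochner_Integration.integral_cnj)
  finally show ?thesis .
qed

lemma log_fourier_integral_0:
  assumes "b > 0"
  shows "log_fourier_integral b 0 = of_real (b * ln b - b)"
proof -
  have "log_fourier_integral b 0 = (LINT x:{0..b}|lborel. complex_of_real (ln x))"
    by (simp add: log_fourier_integral_cis)
  also have "\<dots> = of_real (LINT x:{0..b}|lborel. ln x)"
    by (rule set_integral_complex_of_real)
  finally show ?thesis using set_integral_ln_Icc_0[OF assms] by simp
qed

lemma norm_cis_minus_1_over_le:
  assumes "0 < \<eta>" "\<eta> \<le> 1" "0 \<le> k" "0 \<le> t"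
  shows "norm ((cis (k * t) - 1) / of_real t) \<le> 2 * k powr \<eta> * t powr (\<eta> - 1)"
proof (cases "t = 0")
  case False
  have "norm ((cis (k * t) - 1) / of_real t) \<le> 2 * \<bar>k * t\<bar> powr \<eta> / t"
    using norm_cis_minus_1_le[OF assms(1,2), of "k * t"] assms False
    by (simp add: norm_divide divide_right_mono)
  also have "\<dots> = 2 * k powr \<eta> * t powr (\<eta> - 1)"
    using assms False by (simp add: powr_mult powr_diff)
  finally show ?thesis .
qed auto

lemma set_integrable_cis_minus_1_over:
  assumes "0 \<le> k"
  shows "set_integrable lborel {0..b} (\<lambda>t. (cis (k * t) - 1) / of_real t)"
proof (rule set_integrable_bound)
  show "set_integrable lborel {0..b} (\<lambda>t. 2 * k powr (1/2) * t powr (1/2 - 1))"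
    by (intro set_integrable_mult_right set_integrable_powr_Icc_0) auto
  show "AE x in lborel. x \<in> {0..b} \<longrightarrow>
       norm ((cis (k * x) - 1) / complex_of_real x) \<le> norm (2 * k powr (1 / 2) * x powr (1 / 2 - 1))"
    using norm_cis_minus_1_over_le[of "1/2" k] assms by (intro AE_I2) auto
  have "(\<lambda>t. cis (k * t)) \<in> borel_measurable borel"
    by (intro borel_measurable_continuous_onI continuous_intros)
  then show "set_borel_measurable lborel {0..b} (\<lambda>t. (cis (k * t) - 1) / of_real t)"
    unfolding set_borel_measurable_def by measurable
qed

text \<open>The primitive of e^(ikx) is normalised to (e^(ikx) - 1)/(ik). Its zero at 0 beats the
  logarithmic singularity, and it vanishes at b because kb is a multiple of 2\<pi>, so no boundary
  term survives.\<close>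

lemma log_fourier_integral_by_parts:
  fixes n :: nat
  assumes "b > 0" "n > 0"
  defines "k \<equiv> 2 * pi / b * real n"
  shows "log_fourier_integral b (int n) = - (1 / (\<i> * of_real k)) * (LINT t:{0..b}|lborel. (cis (k * t) - 1) / of_real t)"
proof -
  have k: "k > 0" using assms by simp
  let ?F = "\<lambda>x. of_real (ln x) * (cis (k * x) - 1) / (\<i> * of_real k)"
  let ?f = "\<lambda>x. (cis (k * x) - 1) / of_real x / (\<i> * of_real k) + of_real (ln x) * cis (k * x)"
  have cb: "cis (k * b) = 1" using assms cis_multiple_2pi[of "real n"] by (simp add: k_def)
  have "(?f has_integral ?F b - ?F 0) {0..b}"
  proof (rule fundamental_theorem_of_calculus_interior)
    show "continuous_on {0..b} ?F"
      unfolding continuous_on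
    proof
      fix x assume x: "x \<in> {0..b}"
      show "(?F \<longlongrightarrow> ?F x) (at x within {0..b})"
      proof (cases "x = 0")
        case True
        have "(?F \<longlongrightarrow> 0) (at_right 0)"
        proof (rule Lim_null_comparison)
          show "\<forall>\<^sub>F x in at_right 0. norm (?F x) \<le> 2 * \<bar>ln x\<bar> * x"
          proof (rule eventually_at_rightI)
            fix x :: real assume x: "x \<in> {0<..<1}"
            have "norm (?F x) = \<bar>ln x\<bar> * norm (cis (k * x) - 1) / k"
              using k by (simp add: norm_mult norm_divide)
            also have "\<dots> \<le> \<bar>ln x\<bar> * (2 * (k * x)) / k"
              using x k norm_cis_minus_1_le[of 1 "k * x"] by (intro divide_right_mono mult_left_mono) auto
            finally show "norm (?F x) \<le> 2 * \<bar>ln x\<bar> * x" using k by simp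
          qed simp
          show "((\<lambda>x::real. 2 * \<bar>ln x\<bar> * x) \<longlongrightarrow> 0) (at_right 0)" by real_asymp
        qed
        then show ?thesis unfolding True using assms by (simp add: at_within_Icc_at_right)
      qed (use x k in \<open>auto intro!: tendsto_intros\<close>)
    qed
    fix x assume x: "x \<in> {0<..<b}"
    have "((\<lambda>x. cis (k * x)) has_vector_derivative (of_real k * (\<i> * cis (k * x)))) (at x)"
    proof -
      have "((\<lambda>z. exp (\<i> * of_real k * z)) has_field_derivative \<i> * of_real k * exp (\<i> * of_real k * of_real x)) (at (of_real x))"
        by (auto intro!: derivative_eq_intros)
      from has_vector_derivative_real_field[OF this] show ?thesis
        by (simp add: cis_conv_exp mult_ac)
    qed
    moreover have "((\<lambda>x. complex_of_real (ln x)) has_vector_derivative of_real (1/x)) (at x)"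
      using x by (intro has_vector_derivative_of_real) (auto intro!: derivative_eq_intros simp: has_real_derivative_iff_has_vector_derivative[symmetric])
    ultimately have "((\<lambda>x. of_real (ln x) * (cis (k * x) - 1)) has_vector_derivative
        (of_real (ln x) * (of_real k * (\<i> * cis (k * x)) - 0) + of_real (1/x) * (cis (k * x) - 1))) (at x)"
      by (intro has_vector_derivative_mult has_vector_derivative_diff has_vector_derivative_const)
    from has_vector_derivative_divide[OF this, of "\<i> * of_real k"]
    show "(?F has_vector_derivative ?f x) (at x)"
      by (rule has_vector_derivative_eq_rhs) (use k x in \<open>simp add: field_simps\<close>)
  qed (use assms in auto)
  then have "integral {0..b} ?f = 0" using cb by (simp add: integral_unique)
  moreover have i1: "set_integrable lborel {0..b} (\<lambda>x. (cis (k * x) - 1) / of_real x / (\<i> * of_real k))"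
    using k by (intro set_integrable_divide set_integrable_cis_minus_1_over) auto
  have [measurable]: "(\<lambda>t. cis (k * t)) \<in> borel_measurable borel"
    by (intro borel_measurable_continuous_onI continuous_intros)
  have i2: "set_integrable lborel {0..b} (\<lambda>x. of_real (ln x) * cis (k * x))"
    by (rule set_integrable_bound[OF set_integrable_ln_Icc_0]) (auto simp: norm_mult set_borel_measurable_def)
  ultimately have "(LINT x:{0..b}|lborel. ?f x) = 0"
    using set_borel_integral_eq_integral(2)[OF set_integral_add(1)[OF i1 i2]] by simp
  then have "(LINT x:{0..b}|lborel. (cis (k * x) - 1) / of_real x / (\<i> * of_real k))
      + (LINT x:{0..b}|lborel. of_real (ln x) * cis (k * x)) = 0"
    using set_integral_add(2)[OF i1 i2] by simp
  moreover have "log_fourier_integral b (int n) = (LINT x:{0..b}|lborel. of_real (ln x) * cis (k * x))"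
    by (simp add: log_fourier_integral_cis k_def)
  moreover have "(LINT x:{0..b}|lborel. (cis (k * x) - 1) / of_real x / (\<i> * of_real k))
      = (1 / (\<i> * of_real k)) * (LINT t:{0..b}|lborel. (cis (k * t) - 1) / of_real t)"
    by (subst set_integral_divide_zero) simp
  ultimately show ?thesis by (simp add: add_eq_0_iff)
qed

text \<open>Tonelli's theorem applied to ln b - ln s, written as the integral of 1/t over
  [s, b].\<close>

lemma has_bochner_integral_cdf_over:
  fixes Q :: "real measure" and b :: real
  assumes Q: "prob_space Q" and [measurable_cong]: "sets Q = sets borel" and b: "b > 0"
    and AE: "AE s in Q. 0 < s \<and> s < b" and int: "integrable Q ln"
  shows "has_bochner_integral lborel (\<lambda>t. indicator {0..b} t * (measure Q {..t} / t)) (ln b - (\<integral>s. ln s \<partial>Q))"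
proof -
  interpret Q: prob_space Q by fact
  interpret pair_sigma_finite lborel Q ..
  have "mono (\<lambda>t. measure Q {..t})" by (intro monoI Q.finite_measure_mono) auto
  then have [measurable]: "(\<lambda>t. measure Q {..t}) \<in> borel_measurable borel" by (rule borel_measurable_mono)
  let ?h = "\<lambda>t s. ennreal (1 / t) * indicator {0..b} t * (if s \<le> t then 1 else 0) :: ennreal"
  have "(\<integral>\<^sup>+s. ennreal (ln b - ln s) \<partial>Q) = (\<integral>\<^sup>+s. (\<integral>\<^sup>+t. ?h t s \<partial>lborel) \<partial>Q)"
  proof (intro nn_integral_cong_AE, use AE in eventually_elim)
    case (elim s)
    have "(\<integral>\<^sup>+t. ?h t s \<partial>lborel) = (\<integral>\<^sup>+t. ennreal (1 / t) * indicator {s..b} t \<partial>lborel)"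
      using elim by (intro nn_integral_cong) (auto split: split_indicator)
    also have "\<dots> = ln b - ln s"
      using elim by (intro nn_integral_FTC_Icc) (auto intro!: derivative_eq_intros)
    finally show ?case by simp
  qed
  also have "\<dots> = (\<integral>\<^sup>+t. (\<integral>\<^sup>+s. ?h t s \<partial>Q) \<partial>lborel)"
    by (rule Fubini') measurable
  also have "\<dots> = (\<integral>\<^sup>+t. ennreal (indicator {0..b} t * (measure Q {..t} / t)) \<partial>lborel)"
  proof (intro nn_integral_cong)
    fix t
    have "(\<integral>\<^sup>+s. ?h t s \<partial>Q) = ennreal (1 / t) * indicator {0..b} t * emeasure Q {..t}"
    proof -
      have "(\<integral>\<^sup>+s. ?h t s \<partial>Q) = (\<integral>\<^sup>+s. ennreal (1 / t) * indicator {0..b} t * indicator {..t} s \<partial>Q)"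
        by (intro nn_integral_cong) (auto split: split_indicator)
      then show ?thesis by (subst (asm) nn_integral_cmult) auto
    qed
    also have "\<dots> = ennreal (indicator {0..b} t * (measure Q {..t} / t))"
      by (auto simp: Q.emeasure_eq_measure ennreal_mult[symmetric] split: split_indicator)
    finally show "(\<integral>\<^sup>+s. ?h t s \<partial>Q) = ennreal (indicator {0..b} t * (measure Q {..t} / t))" .
  qed
  finally have eq: "(\<integral>\<^sup>+t. ennreal (indicator {0..b} t * (measure Q {..t} / t)) \<partial>lborel) = (\<integral>\<^sup>+s. ennreal (ln b - ln s) \<partial>Q)" ..
  have nonneg: "AE s in Q. 0 \<le> ln b - ln s"
    using AE by eventually_elim (use b in auto)
  have "(\<integral>\<^sup>+s. ennreal (ln b - ln s) \<partial>Q) = ennreal (\<integral>s. ln b - ln s \<partial>Q)"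
    using int nonneg by (intro nn_integral_eq_integral) auto
  also have "(\<integral>s. ln b - ln s \<partial>Q) = ln b - (\<integral>s. ln s \<partial>Q)"
    using int by (simp add: Q.prob_space)
  finally have "(\<integral>\<^sup>+s. ennreal (ln b - ln s) \<partial>Q) = ennreal (ln b - (\<integral>s. ln s \<partial>Q))" .
  moreover have "ln b - (\<integral>s. ln s \<partial>Q) \<ge> 0"
    using integral_nonneg_AE[OF nonneg] int by (simp add: Q.prob_space)
  ultimately show ?thesis
    using eq b by (intro has_bochner_integral_nn_integral) (auto split: split_indicator)
qed

text \<open>At \<eta> = \<epsilon>/2 the rate n^(\<eta>-1) combines with the decay n^-\<epsilon> of
  the coefficients to a summable bound.\<close>

lemma norm_log_fourier_integral_le:
  fixes n :: nat
  assumes "b > 0" "n > 0" "0 < \<eta>" "\<eta> \<le> 1"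
  shows "norm (log_fourier_integral b (int n)) \<le> 2 * (2 * pi / b) powr (\<eta> - 1) * b powr \<eta> / \<eta> * real n powr (\<eta> - 1)"
proof -
  define k where "k = 2 * pi / b * real n"
  have k: "k > 0" using assms by (simp add: k_def)
  have "norm (LINT t:{0..b}|lborel. (cis (k * t) - 1) / of_real t) \<le> (LINT t:{0..b}|lborel. norm ((cis (k * t) - 1) / of_real t))"
    using k by (intro set_integral_norm_bound set_integrable_cis_minus_1_over) auto
  also have "\<dots> \<le> (LINT t:{0..b}|lborel. 2 * k powr \<eta> * t powr (\<eta> - 1))"
  proof (rule set_integral_mono)
    show "set_integrable lborel {0..b} (\<lambda>t. norm ((cis (k * t) - 1) / of_real t))"
      using k by (intro set_integrable_norm set_integrable_cis_minus_1_over) auto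
    show "set_integrable lborel {0..b} (\<lambda>t. 2 * k powr \<eta> * t powr (\<eta> - 1))"
      using assms by (intro set_integrable_mult_right set_integrable_powr_Icc_0) auto
    show "norm ((cis (k * t) - 1) / of_real t) \<le> 2 * k powr \<eta> * t powr (\<eta> - 1)" if "t \<in> {0..b}" for t
      using that k assms by (intro norm_cis_minus_1_over_le) auto
  qed
  also have "\<dots> = 2 * k powr \<eta> * (b powr \<eta> / \<eta>)"
    using assms set_integral_powr_Icc_0[of "\<eta> - 1" b] by simp
  finally have I: "norm (LINT t:{0..b}|lborel. (cis (k * t) - 1) / of_real t) \<le> 2 * k powr \<eta> * (b powr \<eta> / \<eta>)" .
  have "norm (log_fourier_integral b (int n)) = norm (LINT t:{0..b}|lborel. (cis (k * t) - 1) / of_real t) / k"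
    unfolding log_fourier_integral_by_parts[OF assms(1,2)] k_def[symmetric] using k by (simp add: norm_mult norm_divide)
  also have "\<dots> \<le> (2 * k powr \<eta> * (b powr \<eta> / \<eta>)) / k"
    using k by (intro divide_right_mono I) auto
  also have "\<dots> = 2 * (k powr \<eta> / k powr 1) * (b powr \<eta> / \<eta>)" using k by simp
  also have "k powr \<eta> / k powr 1 = (2 * pi / b) powr (\<eta> - 1) * real n powr (\<eta> - 1)"
    unfolding k_def powr_diff[symmetric] by (rule powr_mult)
  finally show ?thesis by (simp add: mult_ac)
qed

section \<open>Expectation of the logarithm from the Fourier coefficients of a law on (0, b)\<close>

context
  fixes Q :: "real measure" and b C \<epsilon> :: real and c :: "int \<Rightarrow> complex"
  assumes Q: "prob_space Q" and sets_Q [measurable_cong]: "sets Q = sets borel" and b: "b > 0"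
    and AE_Q: "AE s in Q. 0 < s \<and> s < b" and integrable_ln: "integrable Q ln"
    and c: "\<And>n. c n = of_real (1 / b) * (\<integral>s. cis (- (2 * pi / b * real_of_int n * s)) \<partial>Q)"
    and decay: "\<And>n::nat. n > 0 \<Longrightarrow> norm (c (int n)) \<le> C * real n powr (- \<epsilon>)" and \<epsilon>: "0 < \<epsilon>" "\<epsilon> \<le> 1"
begin

interpretation Q: prob_space Q by (rule Q)

lemma coeff_uminus: "c (- n) = cnj (c n)"
  unfolding c by (simp add: cis_cnj flip: Bochner_Integration.integral_cnj)

lemma coeff_0: "c 0 = of_real (1 / b)"
  unfolding c by (simp add: Q.prob_space)

definition cdf_coeff :: "nat \<Rightarrow> real \<Rightarrow> real" where
  "cdf_coeff n t = (\<integral>s. sin (real n * (2 * pi / b * (t - s))) + sin (real n * (2 * pi / b * s)) \<partial>Q) / (pi * real n)"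

text \<open>The right side is the integral from 0 to t of the conjugate pair of modes n and -n in
  the formal Fourier series of the law; the constant mode accounts for t/b. For n = 0 both sides are
  0 through division by zero.\<close>

lemma cdf_coeff_eq:
  "cdf_coeff n t = 2 * Re (c (int n) * (cis (2 * pi / b * real n * t) - 1) / (\<i> * of_real (2 * pi / b * real n)))"
proof (cases "n = 0")
  case False
  define k where "k = 2 * pi / b * real n"
  have k: "k > 0" using False b by (simp add: k_def)
  have [measurable]: "(\<lambda>s. cis (x * s)) \<in> borel_measurable borel" "(\<lambda>s. cis (y - x * s)) \<in> borel_measurable borel" for x y
    by (intro borel_measurable_continuous_onI continuous_intros)+
  have i: "integrable Q (\<lambda>s. cis (y - k * s))" for y
    by (intro Q.integrable_const_bound[where B = 1]) auto
  have "c (int n) * (cis (k * t) - 1) = of_real (1 / b) * ((\<integral>s. cis (0 - k * s) \<partial>Q) * (cis (k * t) - 1))"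
    by (simp add: c k_def mult.assoc)
  also have "(\<integral>s. cis (0 - k * s) \<partial>Q) * (cis (k * t) - 1) = (\<integral>s. cis (0 - k * s) * cis (k * t) \<partial>Q) - (\<integral>s. cis (0 - k * s) \<partial>Q)"
    by (simp add: algebra_simps)
  also have "\<dots> = (\<integral>s. cis (k * t - k * s) \<partial>Q) - (\<integral>s. cis (0 - k * s) \<partial>Q)"
    by (simp add: cis_mult)
  also have "\<dots> = (\<integral>s. cis (k * t - k * s) - cis (0 - k * s) \<partial>Q)"
    using i by (intro Bochner_Integration.integral_diff[symmetric])
  finally have "Im (c (int n) * (cis (k * t) - 1)) = 1 / b * Im (\<integral>s. cis (k * t - k * s) - cis (0 - k * s) \<partial>Q)"
    by simp
  also have "\<dots> = 1 / b * (\<integral>s. sin (k * t - k * s) + sin (k * s) \<partial>Q)"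
    using i[of 0] i[of "k * t"] by (subst integral_Im[symmetric]) auto
  finally have "Im (c (int n) * (cis (k * t) - 1)) / k = 1 / b * (\<integral>s. sin (k * t - k * s) + sin (k * s) \<partial>Q) / k"
    by simp
  moreover have "Re (z / (\<i> * of_real k)) = Im z / k" for z
    using k by (simp add: complex_eq_iff Re_divide power2_eq_square)
  moreover have "(\<lambda>s. sin (real n * (2 * pi / b * (t - s))) + sin (real n * (2 * pi / b * s))) = (\<lambda>s. sin (k * t - k * s) + sin (k * s))"
    by (simp add: k_def fun_eq_iff algebra_simps diff_divide_distrib)
  ultimately have eqs: "Re (c (int n) * (cis (k * t) - 1) / (\<i> * of_real k)) = 1 / b * (\<integral>s. sin (k * t - k * s) + sin (k * s) \<partial>Q) / k"
    "cdf_coeff n t = (\<integral>s. sin (k * t - k * s) + sin (k * s) \<partial>Q) / (pi * real n)"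
    unfolding cdf_coeff_def by (simp_all only:)
  show ?thesis
    unfolding k_def[symmetric] eqs using b False by (simp add: k_def)
qed (simp add: cdf_coeff_def)

definition bound_const :: real where
  "bound_const = 4 * C * (2 * pi / b) powr (\<epsilon> / 2 - 1)"

text \<open>The bound splits into a summable sequence in n and a function of t integrable at 0, as
  termwise integration requires. The exponent is -\<epsilon> + (\<epsilon>/2 - 1), from the decay of
  c_n and from k^(\<epsilon>/2) / k.\<close>

lemma cdf_coeff_over_le:
  assumes "t \<ge> 0"
  shows "\<bar>cdf_coeff n t / t\<bar> \<le> bound_const * real n powr (- 1 - \<epsilon> / 2) * t powr (\<epsilon> / 2 - 1)"
proof (cases "n = 0")
  case False
  define k where "k = 2 * pi / b * real n"
  have k: "k > 0" using False b by (simp add: k_def)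
  let ?z = "c (int n) * (cis (k * t) - 1) / (\<i> * of_real k)"
  have "\<bar>cdf_coeff n t / t\<bar> = 2 * (\<bar>Re ?z\<bar> / t)"
    using assms by (simp add: cdf_coeff_eq k_def abs_mult)
  also have "\<bar>Re ?z\<bar> / t \<le> norm ?z / t"
    using assms by (intro divide_right_mono abs_Re_le_cmod)
  also have "norm ?z / t = norm (c (int n)) / k * norm ((cis (k * t) - 1) / of_real t)"
    using k assms by (simp add: norm_mult norm_divide)
  also have "\<dots> \<le> (C * real n powr (- \<epsilon>)) / k * (2 * k powr (\<epsilon>/2) * t powr (\<epsilon>/2 - 1))"
    using k assms \<epsilon> decay[of n] False
    by (intro mult_mono divide_right_mono norm_cis_minus_1_over_le divide_nonneg_pos) (auto intro: order_trans[OF norm_ge_zero decay[of n]])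
  also have "\<dots> = 2 * C * (real n powr (- \<epsilon>) * (k powr (\<epsilon>/2) / k powr 1) * t powr (\<epsilon>/2 - 1))" using k by simp
  also have "k powr (\<epsilon>/2) / k powr 1 = (2 * pi / b) powr (\<epsilon>/2 - 1) * real n powr (\<epsilon>/2 - 1)"
    unfolding k_def powr_diff[symmetric] by (rule powr_mult)
  also have "real n powr (- \<epsilon>) * ((2 * pi / b) powr (\<epsilon>/2 - 1) * real n powr (\<epsilon>/2 - 1))
      = (2 * pi / b) powr (\<epsilon>/2 - 1) * real n powr (- \<epsilon> + (\<epsilon>/2 - 1))"
    by (simp only: powr_add mult_ac)
  also have "- \<epsilon> + (\<epsilon>/2 - 1) = - 1 - \<epsilon>/2" by simp
  finally show ?thesis by (simp add: bound_const_def mult_ac)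
qed (simp add: cdf_coeff_def)

lemma summable_bound: "summable (\<lambda>n. K * real n powr (- 1 - \<epsilon> / 2))"
  using \<epsilon> by (intro summable_mult) (simp add: summable_real_powr_iff)

text \<open>Atoms of \<open>Q\<close> have to be avoided. For each s almost every t differs from s,
  and Fubini on the diagonal turns this into: for almost every t, \<open>Q\<close> has no atom at
  t.\<close>

lemma cdf_coeff_sums:
  "AE t in lborel. (\<lambda>n. indicator {0..b} t * (cdf_coeff n t / t)) sums (indicator {0..b} t * (measure Q {..t} / t) - indicator {0..b} t / b)"
proof -
  interpret pair_sigma_finite lborel Q ..
  have "AE s in Q. AE t in lborel. s \<noteq> t"
    by (intro AE_I2 eventually_mono[OF AE_lborel_singleton]) auto
  moreover have "{x \<in> space (lborel \<Otimes>\<^sub>M Q). snd x \<noteq> fst x} \<in> sets (lborel \<Otimes>\<^sub>M Q)"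
    by measurable
  ultimately have "AE t in lborel. AE s in Q. s \<noteq> t"
    using AE_commute[of "\<lambda>t s. s \<noteq> t"] by blast
  then show ?thesis
    using AE_lborel_singleton[of 0] AE_lborel_singleton[of b]
  proof eventually_elim
    case (elim t)
    show ?case
    proof (cases "t \<in> {0..b}")
      case True
      then have t: "0 < t" "t < b" using elim by auto
      have "summable (\<lambda>n. \<bar>cdf_coeff n t\<bar>)"
      proof (rule summable_comparison_test'[of _ 0])
        show "summable (\<lambda>n. (bound_const * t powr (\<epsilon> / 2 - 1) * t) * real n powr (- 1 - \<epsilon> / 2))"
          by (rule summable_bound)
        fix n
        show "norm \<bar>cdf_coeff n t\<bar> \<le> (bound_const * t powr (\<epsilon> / 2 - 1) * t) * real n powr (- 1 - \<epsilon> / 2)"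
          using mult_right_mono[OF cdf_coeff_over_le[of t n], of t] t by (simp add: mult_ac)
      qed
      then have "(\<lambda>n. cdf_coeff n t) sums (measure Q {..t} - t / b)"
        unfolding cdf_coeff_def[abs_def]
        by (intro cdf_Fourier_sums Q sets_Q b AE_Q t elim) 
      from sums_divide[OF this, of t] show ?thesis using True t by (simp add: diff_divide_distrib)
    qed auto
  qed
qed

text \<open>The factor ik from \<open>log_fourier_integral_by_parts\<close> cancels the 1/(ik) that
  integrating the n-th mode introduced, which leaves the Fourier integral of the logarithm.\<close>

lemma cdf_coeff_integral:
  assumes "n > 0"
  shows "(\<integral>t. indicator {0..b} t * (cdf_coeff n t / t) \<partial>lborel) = - 2 * Re (c (int n) * log_fourier_integral b (int n))"
    and "integrable lborel (\<lambda>t. indicator {0..b} t * (cdf_coeff n t / t))"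
proof -
  define k where "k = 2 * pi / b * real n"
  have k: "k > 0" using assms b by (simp add: k_def)
  let ?z = "2 * c (int n) / (\<i> * of_real k)"
  have eq: "indicator {0..b} t * (cdf_coeff n t / t) = Re (?z * (indicator {0..b} t *\<^sub>R ((cis (k * t) - 1) / of_real t)))" for t
  proof -
    have "(?z * (cis (k * t) - 1)) / of_real t = of_real (2 / t) * (c (int n) * (cis (k * t) - 1) / (\<i> * of_real k))"
      using k by (cases "t = 0") (simp_all add: field_simps)
    then have "cdf_coeff n t / t = Re ((?z * (cis (k * t) - 1)) / of_real t)"
      unfolding cdf_coeff_eq k_def[symmetric] by (simp only: Re_complex_of_real Im_complex_of_real times_complex.sel) simp
    then show ?thesis by (simp split: split_indicator)
  qed
  have i: "integrable lborel (\<lambda>t. ?z * (indicator {0..b} t *\<^sub>R ((cis (k * t) - 1) / of_real t)))"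
    using set_integrable_cis_minus_1_over[of k b] k unfolding set_integrable_def by (intro integrable_mult_right) auto
  then show "integrable lborel (\<lambda>t. indicator {0..b} t * (cdf_coeff n t / t))"
    unfolding eq by (rule integrable_Re)
  have "(\<integral>t. indicator {0..b} t * (cdf_coeff n t / t) \<partial>lborel) = Re (?z * (LINT t:{0..b}|lborel. (cis (k * t) - 1) / of_real t))"
    unfolding eq integral_Re[OF i] set_lebesgue_integral_def by (subst integral_mult_right_zero) simp
  also have "(LINT t:{0..b}|lborel. (cis (k * t) - 1) / of_real t) = - (\<i> * of_real k) * log_fourier_integral b (int n)"
    unfolding log_fourier_integral_by_parts[OF b assms] k_def[symmetric] using k by simp
  also have "?z * (- (\<i> * of_real k) * log_fourier_integral b (int n)) = of_real (- 2) * (c (int n) * log_fourier_integral b (int n))"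
    using k by simp
  finally show "(\<integral>t. indicator {0..b} t * (cdf_coeff n t / t) \<partial>lborel) = - 2 * Re (c (int n) * log_fourier_integral b (int n))"
    by simp
qed

text \<open>The series represents F(t)/t - 1/b, with F the distribution function; its integral over
  [0, b] is (ln b - E ln s) - 1, and negation gives the stated value.\<close>

lemma expectation_ln_sums:
  "(\<lambda>n. 2 * Re (c (int (Suc n)) * log_fourier_integral b (int (Suc n)))) sums ((\<integral>s. ln s \<partial>Q) - (ln b - 1))"
proof -
  let ?f = "\<lambda>n t. indicator {0..b} t * (cdf_coeff n t / t)"
  have int: "integrable lborel (?f n)" for n
    by (cases "n = 0") (use cdf_coeff_integral(2) in \<open>auto simp: cdf_coeff_def\<close>)
  have nb: "norm (?f n t) \<le> bound_const * real n powr (- 1 - \<epsilon> / 2) * (indicator {0..b} t * t powr (\<epsilon> / 2 - 1))" for n t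
    using cdf_coeff_over_le[of t n] by (auto split: split_indicator)
  have pint: "integrable lborel (\<lambda>t. indicator {0..b} t * t powr (\<epsilon> / 2 - 1))"
    using set_integrable_powr_Icc_0[of "\<epsilon>/2 - 1" b] \<epsilon> by (simp add: set_integrable_def)
  have "(\<lambda>n. \<integral>t. ?f n t \<partial>lborel) sums (\<integral>t. (\<Sum>n. ?f n t) \<partial>lborel)"
  proof (rule sums_integral[OF int])
    show "AE t in lborel. summable (\<lambda>n. norm (?f n t))"
    proof (rule AE_I2)
      fix t
      show "summable (\<lambda>n. norm (?f n t))"
        by (rule summable_comparison_test'[OF summable_bound[of "bound_const * (indicator {0..b} t * t powr (\<epsilon> / 2 - 1))"], of 0])
           (use nb[of t] in \<open>simp add: mult_ac\<close>)
    qed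
    show "summable (\<lambda>n. \<integral>t. norm (?f n t) \<partial>lborel)"
    proof (rule summable_comparison_test'[OF summable_bound[of "bound_const * (\<integral>t. indicator {0..b} t * t powr (\<epsilon> / 2 - 1) \<partial>lborel)"], of 0])
      fix n
      have "(\<integral>t. norm (?f n t) \<partial>lborel) \<le> (\<integral>t. bound_const * real n powr (- 1 - \<epsilon> / 2) * (indicator {0..b} t * t powr (\<epsilon> / 2 - 1)) \<partial>lborel)"
        using pint int[of n] nb[of _ n] by (intro integral_mono integrable_norm integrable_mult_right) auto
      also have "\<dots> = bound_const * real n powr (- 1 - \<epsilon> / 2) * (\<integral>t. indicator {0..b} t * t powr (\<epsilon> / 2 - 1) \<partial>lborel)"
        by (rule integral_mult_right_zero)
      finally show "norm (\<integral>t. norm (?f n t) \<partial>lborel) \<le> bound_const * (\<integral>t. indicator {0..b} t * t powr (\<epsilon> / 2 - 1) \<partial>lborel) * real n powr (- 1 - \<epsilon> / 2)"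
        by (simp add: mult_ac)
    qed
  qed
  also have "(\<integral>t. (\<Sum>n. ?f n t) \<partial>lborel) = (\<integral>t. indicator {0..b} t * (measure Q {..t} / t) - indicator {0..b} t / b \<partial>lborel)"
  proof (rule integral_cong_AE)
    show "(\<lambda>t. \<Sum>n. ?f n t) \<in> borel_measurable lborel"
      using int by (intro borel_measurable_suminf) auto
    show "(\<lambda>t. indicator {0..b} t * (measure Q {..t} / t) - indicator {0..b} t / b) \<in> borel_measurable lborel"
      using has_bochner_integral_cdf_over[OF Q sets_Q b AE_Q integrable_ln]
      by (intro borel_measurable_diff) (auto dest: borel_measurable_has_bochner_integral)
    show "AE t in lborel. (\<Sum>n. ?f n t) = indicator {0..b} t * (measure Q {..t} / t) - indicator {0..b} t / b"
      using cdf_coeff_sums by eventually_elim (simp add: sums_iff)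
  qed
  also have "\<dots> = (ln b - (\<integral>s. ln s \<partial>Q)) - 1"
  proof -
    have "integrable lborel (\<lambda>t. indicator {0..b} t / b)" "(\<integral>t. indicator {0..b} t / b \<partial>lborel) = 1"
      using b by auto
    then show ?thesis
      using has_bochner_integral_cdf_over[OF Q sets_Q b AE_Q integrable_ln]
      by (subst Bochner_Integration.integral_diff) (auto simp: has_bochner_integral_iff)
  qed
  \<comment> \<open>The term of index 0 is identically 0, so the shift loses nothing.\<close>
  finally have "(\<lambda>n. \<integral>t. ?f (Suc n) t \<partial>lborel) sums ((ln b - (\<integral>s. ln s \<partial>Q)) - 1)"
    by (subst sums_Suc_iff) (simp add: cdf_coeff_def)
  moreover have "- (ln b - (\<integral>s. ln s \<partial>Q) - 1) = (\<integral>s. ln s \<partial>Q) - (ln b - 1)" by simp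
  ultimately show ?thesis using sums_minus
    by (fastforce simp only: cdf_coeff_integral(1)[OF zero_less_Suc] mult_minus_left minus_minus)
qed

text \<open>Positive indices add up to S and negative ones to its conjugate, so together they give 2
  Re S, known from \<open>expectation_ln_sums\<close>. Index 0 contributes (b ln b - b)/b = ln b -
  1, exactly the constant subtracted there. Absolute summability permits assembling the pieces into
  an unordered sum.\<close>

lemma expectation_ln_has_sum:
  "((\<lambda>n. c n * log_fourier_integral b n) has_sum of_real (\<integral>s. ln s \<partial>Q)) UNIV"
proof -
  let ?g = "\<lambda>n. c n * log_fourier_integral b n"
  let ?p = "\<lambda>n. int (Suc n)" and ?m = "\<lambda>n. - int (Suc n)"
  \<comment> \<open>\<open>C\<close> times the constant of
    \<open>norm_log_fourier_integral_le\<close> at \<eta> = \<epsilon>/2.\<close>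
  define K where "K = C * (2 * (2 * pi / b) powr (\<epsilon>/2 - 1) * b powr (\<epsilon>/2) / (\<epsilon>/2))"
  have nb: "norm (?g (int n)) \<le> K * real n powr (- 1 - \<epsilon> / 2)" if n: "n > 0" for n
  proof -
    have "norm (?g (int n)) \<le> (C * real n powr (- \<epsilon>)) * (2 * (2 * pi / b) powr (\<epsilon>/2 - 1) * b powr (\<epsilon>/2) / (\<epsilon>/2) * real n powr (\<epsilon>/2 - 1))"
      unfolding norm_mult using decay[OF n] \<epsilon>
      by (intro mult_mono norm_log_fourier_integral_le b n) (auto intro: order_trans[OF norm_ge_zero decay[OF n]])
    also have "\<dots> = K * (real n powr (- \<epsilon>) * real n powr (\<epsilon>/2 - 1))" by (simp add: K_def)
    also have "real n powr (- \<epsilon>) * real n powr (\<epsilon>/2 - 1) = real n powr (- \<epsilon> + (\<epsilon>/2 - 1))" by (rule powr_add[symmetric])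
    also have "- \<epsilon> + (\<epsilon>/2 - 1) = - 1 - \<epsilon>/2" by simp
    finally show ?thesis .
  qed
  have "summable (\<lambda>n. K * real (Suc n) powr (- 1 - \<epsilon> / 2))"
    using summable_bound[of K] by (subst summable_Suc_iff)
  then have sn: "summable (\<lambda>n. norm (?g (?p n)))"
    by (rule summable_comparison_test'[of _ 0]) (use nb[of "Suc _"] in auto)
  define S where "S = (\<Sum>n. ?g (?p n))"
  have S: "(\<lambda>n. ?g (?p n)) sums S" unfolding S_def
    using summable_norm_cancel[OF sn] by (rule summable_sums)
  have "((\<lambda>n. ?g (?p n)) has_sum S) UNIV"
    by (rule norm_summable_imp_has_sum[OF sn S])
  then have 1: "(?g has_sum S) (range ?p)"
    by (subst has_sum_reindex) (auto simp: inj_def o_def)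
  have m: "?g (?m n) = cnj (?g (?p n))" for n
    by (simp only: coeff_uminus log_fourier_integral_uminus complex_cnj_mult)
  have "((\<lambda>n. cnj (?g (?p n))) has_sum cnj S) UNIV"
  proof (rule norm_summable_imp_has_sum)
    show "summable (\<lambda>n. norm (cnj (?g (?p n))))" using sn by (simp only: complex_mod_cnj)
    show "(\<lambda>n. cnj (?g (?p n))) sums cnj S" using S by (simp only: sums_cnj)
  qed
  then have 2: "(?g has_sum cnj S) (range ?m)"
    unfolding m[symmetric] by (subst has_sum_reindex) (auto simp: inj_def o_def)
  have "(?g has_sum (?g 0 + (S + cnj S))) (insert 0 (range ?p \<union> range ?m))"
    by (intro has_sum_insert has_sum_Un_disjoint 1 2) auto
  moreover have "insert 0 (range ?p \<union> range ?m) = UNIV"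
  proof (intro equalityI subsetI, simp)
    fix x :: int
    show "x \<in> insert 0 (range ?p \<union> range ?m)"
      by (cases x rule: int_cases3) (auto simp: image_iff intro: exI[of _ "nat \<bar>x\<bar> - 1"])
  qed
  moreover have "S + cnj S = of_real ((\<integral>s. ln s \<partial>Q) - (ln b - 1))"
  proof -
    have "(\<lambda>n. 2 * Re (?g (?p n))) sums (2 * Re S)" by (intro sums_mult sums_Re S)
    then have "2 * Re S = (\<integral>s. ln s \<partial>Q) - (ln b - 1)"
      using expectation_ln_sums sums_unique2 by blast
    then show ?thesis by (simp add: complex_add_cnj)
  qed
  moreover have "?g 0 = of_real (ln b - 1)"
    using b by (simp add: coeff_0 log_fourier_integral_0 field_simps)
  ultimately show ?thesis by simp
qed

end

section \<open>The beta law\<close>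

text \<open>Left unnormalised, because the projection argument yields this weight only up to a
  constant, which total mass fixes afterwards.\<close>

definition beta_weight :: "real \<Rightarrow> real \<Rightarrow> real \<Rightarrow> real" where
  "beta_weight a c x = indicator {0..1} x * (x powr (a - 1) * (1 - x) powr (c - 1))"

definition beta_law :: "real \<Rightarrow> real \<Rightarrow> real measure" where
  "beta_law a c = density lborel (\<lambda>x. ennreal (beta_weight a c x / Beta a c))"

lemma sets_beta_law [simp, measurable_cong]: "sets (beta_law a c) = sets borel"
  and space_beta_law [simp]: "space (beta_law a c) = UNIV"
  by (simp_all add: beta_law_def)

lemma measurable_beta_weight [measurable]: "beta_weight a c \<in> borel_measurable borel"
  unfolding beta_weight_def by measurable

lemma beta_weight_nonneg [simp]: "beta_weight a c x \<ge> 0"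
  by (simp add: beta_weight_def)

lemma Beta_real_pos:
  fixes a c :: real
  assumes "a > 0" "c > 0"
  shows "Beta a c > 0"
  using assms by (simp add: Beta_def Gamma_real_pos)

lemma nn_integral_beta_weight:
  assumes "a > 0" "c > 0"
  shows "(\<integral>\<^sup>+x. ennreal (beta_weight a c x) \<partial>lborel) = ennreal (Beta a c)"
proof (rule nn_integral_has_integral_lborel)
  have "((\<lambda>x. if x \<in> {0..1} then x powr (a - 1) * (1 - x) powr (c - 1) else 0) has_integral Beta a c) UNIV"
    using has_integral_Beta_real[OF assms] by (simp only: has_integral_restrict_UNIV)
  moreover have "(\<lambda>x. if x \<in> {0..1} then x powr (a - 1) * (1 - x) powr (c - 1) else 0) = beta_weight a c"
    by (simp add: beta_weight_def fun_eq_iff)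
  ultimately show "(beta_weight a c has_integral Beta a c) UNIV" by simp
qed auto

lemma nn_integral_beta_law:
  assumes [measurable]: "f \<in> borel_measurable borel"
  shows "(\<integral>\<^sup>+x. f x \<partial>beta_law a c) = (\<integral>\<^sup>+x. ennreal (beta_weight a c x / Beta a c) * f x \<partial>lborel)"
  unfolding beta_law_def by (rule nn_integral_density) auto

lemma prob_space_beta_law:
  assumes "a > 0" "c > 0"
  shows "prob_space (beta_law a c)"
proof
  have "emeasure (beta_law a c) (space (beta_law a c)) = (\<integral>\<^sup>+x. 1 \<partial>beta_law a c)" by simp
  also have "\<dots> = (\<integral>\<^sup>+x. ennreal (inverse (Beta a c)) * ennreal (beta_weight a c x) \<partial>lborel)"
    using Beta_real_pos[OF assms]
    by (subst nn_integral_beta_law) (auto simp flip: ennreal_mult simp: field_simps)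
  also have "\<dots> = ennreal (inverse (Beta a c)) * ennreal (Beta a c)"
    by (subst nn_integral_cmult) (auto simp: nn_integral_beta_weight[OF assms])
  also have "\<dots> = 1" using Beta_real_pos[OF assms] by (simp flip: ennreal_mult)
  finally show "emeasure (beta_law a c) (space (beta_law a c)) = 1" .
qed

lemma AE_beta_law: "AE x in beta_law a c. 0 < x \<and> x < 1"
proof -
  have "AE x in lborel. 0 < ennreal (beta_weight a c x / Beta a c) \<longrightarrow> 0 < x \<and> x < 1"
    using AE_lborel_singleton[of 0] AE_lborel_singleton[of 1]
    by eventually_elim (auto simp: beta_weight_def split: split_indicator)
  then show ?thesis
    unfolding beta_law_def by (subst AE_density) auto
qed

text \<open>The extra powers merely shift the two parameters. Negative exponents give the inverse
  moments behind the tail estimate and the integrability of the logarithm.\<close>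

lemma nn_integral_beta_law_powr:
  assumes "a > 0" "c > 0" "a + s > 0" "c + t > 0"
  shows "(\<integral>\<^sup>+x. ennreal (x powr s * (1 - x) powr t) \<partial>beta_law a c) = ennreal (Beta (a + s) (c + t) / Beta a c)"
proof -
  note B = Beta_real_pos[OF assms(1,2)]
  have "(\<integral>\<^sup>+x. ennreal (x powr s * (1 - x) powr t) \<partial>beta_law a c)
      = (\<integral>\<^sup>+x. ennreal (inverse (Beta a c)) * ennreal (beta_weight (a + s) (c + t) x) \<partial>lborel)"
  proof (subst nn_integral_beta_law)
    have "beta_weight a c x / Beta a c * (x powr s * (1 - x) powr t) = inverse (Beta a c) * beta_weight (a + s) (c + t) x" for x
    proof -
      have "x powr (a + s - 1) = x powr (a - 1) * x powr s" by (simp add: algebra_simps flip: powr_add)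
      moreover have "(1 - x) powr (c + t - 1) = (1 - x) powr (c - 1) * (1 - x) powr t" by (simp add: algebra_simps flip: powr_add)
      ultimately show ?thesis by (simp add: beta_weight_def field_simps)
    qed
    then show "(\<integral>\<^sup>+x. ennreal (beta_weight a c x / Beta a c) * ennreal (x powr s * (1 - x) powr t) \<partial>lborel)
        = (\<integral>\<^sup>+x. ennreal (inverse (Beta a c)) * ennreal (beta_weight (a + s) (c + t) x) \<partial>lborel)"
      using B by (simp flip: ennreal_mult)
  qed simp
  also have "\<dots> = ennreal (inverse (Beta a c)) * ennreal (Beta (a + s) (c + t))"
    by (subst nn_integral_cmult) (auto simp: nn_integral_beta_weight[OF assms(3,4)])
  also have "\<dots> = ennreal (Beta (a + s) (c + t) / Beta a c)"
    using B Beta_real_pos[OF assms(3,4)] by (simp flip: ennreal_mult add: field_simps)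
  finally show ?thesis .
qed

lemma has_bochner_integral_beta_law_powr:
  assumes "a > 0" "c > 0" "a + s > 0" "c + t > 0"
  shows "has_bochner_integral (beta_law a c) (\<lambda>x. x powr s * (1 - x) powr t) (Beta (a + s) (c + t) / Beta a c)"
  using nn_integral_beta_law_powr[OF assms] Beta_real_pos[OF assms(1,2)] Beta_real_pos[OF assms(3,4)]
  by (intro has_bochner_integral_nn_integral) auto

lemma beta_law_moment:
  assumes "a > 0" "c > 0"
  shows "(\<integral>x. x ^ k \<partial>beta_law a c) = rising a (real k) / rising (a + c) (real k)"
proof -
  have "(\<integral>x. x ^ k \<partial>beta_law a c) = (\<integral>x. x powr real k * (1 - x) powr 0 \<partial>beta_law a c)"
  proof (rule integral_cong_AE)
    show "AE x in beta_law a c. x ^ k = x powr real k * (1 - x) powr 0"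
      using AE_beta_law by eventually_elim (simp add: powr_realpow)
  qed auto
  also have "\<dots> = Beta (a + real k) c / Beta a c"
    using has_bochner_integral_beta_law_powr[of a c "real k" 0] assms by (simp add: has_bochner_integral_iff)
  also have "\<dots> = rising a (real k) / rising (a + c) (real k)"
  proof -
    have "Gamma a > 0" "Gamma c > 0" "Gamma (a + c) > 0" "Gamma (a + real k) > 0" "Gamma (a + c + real k) > 0"
      using assms by (auto intro!: Gamma_real_pos)
    then show ?thesis by (simp add: Beta_def rising_def field_simps)
  qed
  finally show ?thesis .
qed

text \<open>The moments are the ratios of rising factorials in the hypergeometric series; the
  exponential series is integrated termwise, dominated by |z|^k / k! because 0 < x < 1.\<close>

lemma beta_law_exp:
  assumes "a > 0" "c > 0"
  shows "(\<integral>x. exp (z * of_real x) \<partial>beta_law a c) = hyp1F1 a (a + c) z"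
proof -
  interpret prob_space "beta_law a c" by (rule prob_space_beta_law[OF assms])
  let ?f = "\<lambda>k x. z ^ k / fact k * of_real (x ^ k)"
  have nb: "AE x in beta_law a c. norm (?f k x) \<le> norm z ^ k / fact k" for k
    using AE_beta_law
    by eventually_elim (auto simp: norm_mult norm_divide norm_power intro!: divide_right_mono mult_left_le power_le_one)
  have nb': "AE x in beta_law a c. \<forall>k. norm (?f k x) \<le> norm z ^ k / fact k"
    using nb by (simp add: AE_all_countable)
  have i: "integrable (beta_law a c) (?f k)" for k
    using nb by (intro integrable_const_bound) auto
  have s: "summable (\<lambda>k. norm z ^ k / fact k)"
    using summable_exp[of "norm z"] by (simp add: field_simps)
  have "(\<lambda>k. \<integral>x. ?f k x \<partial>beta_law a c) sums (\<integral>x. (\<Sum>k. ?f k x) \<partial>beta_law a c)"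
  proof (rule sums_integral[OF i])
    show "AE x in beta_law a c. summable (\<lambda>k. norm (?f k x))"
      using nb' by eventually_elim (auto intro!: summable_comparison_test'[OF s, of 0])
    show "summable (\<lambda>k. \<integral>x. norm (?f k x) \<partial>beta_law a c)"
    proof (rule summable_comparison_test'[OF s, of 0])
      fix k
      have "(\<integral>x. norm (?f k x) \<partial>beta_law a c) \<le> norm z ^ k / fact k"
        using nb[of k] i[of k] by (intro integral_le_const integrable_norm) 
      then show "norm (\<integral>x. norm (?f k x) \<partial>beta_law a c) \<le> norm z ^ k / fact k"
        by simp
    qed
  qed
  moreover have "(\<Sum>k. ?f k x) = exp (z * of_real x)" for x
    by (simp add: exp_def scaleR_conv_of_real field_simps power_mult_distrib)
  moreover have "(\<integral>x. ?f k x \<partial>beta_law a c) = of_real (rising a (real k) / rising (a + c) (real k)) * (z ^ k / fact k)" for k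
  proof -
    have "(\<integral>x. ?f k x \<partial>beta_law a c) = z ^ k / fact k * (\<integral>x. of_real (x ^ k) \<partial>beta_law a c)"
      by (rule integral_mult_right_zero)
    also have "(\<integral>x. of_real (x ^ k) \<partial>beta_law a c) = (of_real (\<integral>x. x ^ k \<partial>beta_law a c) :: complex)"
      by (rule integral_complex_of_real)
    finally show ?thesis by (simp add: beta_law_moment[OF assms] mult_ac)
  qed
  ultimately show ?thesis by (simp add: hyp1F1_def sums_iff)
qed

section \<open>Decay of the characteristic function of the beta law\<close>

text \<open>Markov's inequality with the inverse moments x^(-a/2) and (1-x)^(-c/2): half of each
  parameter keeps the moment finite, the other half becomes the rate in \<delta>.\<close>

lemma beta_law_tail_le:
  assumes "a > 0" "c > 0" "0 < \<delta>" "\<delta> < 1/2"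
  shows "(\<integral>x. indicator (- {\<delta>..1 - \<delta>}) x \<partial>beta_law a c) \<le>
    \<delta> powr (a / 2) * (Beta (a / 2) c / Beta a c) + \<delta> powr (c / 2) * (Beta a (c / 2) / Beta a c)"
proof -
  interpret prob_space "beta_law a c" by (rule prob_space_beta_law[OF assms(1,2)])
  have 1: "has_bochner_integral (beta_law a c) (\<lambda>x. x powr (- a / 2) * (1 - x) powr 0) (Beta (a / 2) c / Beta a c)"
    using has_bochner_integral_beta_law_powr[of a c "- a / 2" 0] assms by simp
  have 2: "has_bochner_integral (beta_law a c) (\<lambda>x. x powr 0 * (1 - x) powr (- c / 2)) (Beta a (c / 2) / Beta a c)"
    using has_bochner_integral_beta_law_powr[of a c 0 "- c / 2"] assms by simp
  have 3: "has_bochner_integral (beta_law a c)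
      (\<lambda>x. \<delta> powr (a / 2) * (x powr (- a / 2) * (1 - x) powr 0) + \<delta> powr (c / 2) * (x powr 0 * (1 - x) powr (- c / 2)))
      (\<delta> powr (a / 2) * (Beta (a / 2) c / Beta a c) + \<delta> powr (c / 2) * (Beta a (c / 2) / Beta a c))"
    by (intro has_bochner_integral_add has_bochner_integral_mult_right 1 2)
  have p: "1 \<le> \<delta> powr s * y powr - s" if "0 < y" "y \<le> \<delta>" "s > 0" for y s
  proof -
    have "y powr s \<le> \<delta> powr s" using that by (intro powr_mono2) auto
    then show ?thesis using that by (simp add: powr_minus field_simps)
  qed
  have "(\<integral>x. indicator (- {\<delta>..1 - \<delta>}) x \<partial>beta_law a c) \<le> (\<integral>x. \<delta> powr (a / 2) * (x powr (- a / 2) * (1 - x) powr 0) + \<delta> powr (c / 2) * (x powr 0 * (1 - x) powr (- c / 2)) \<partial>beta_law a c)"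
  proof (rule integral_mono_AE)
    show "integrable (beta_law a c) (indicator (- {\<delta>..1 - \<delta>}) :: real \<Rightarrow> real)"
      by (intro integrable_const_bound[where B = 1]) (auto split: split_indicator)
    show "AE x in beta_law a c. indicator (- {\<delta>..1 - \<delta>}) x \<le> \<delta> powr (a / 2) * (x powr (- a / 2) * (1 - x) powr 0) + \<delta> powr (c / 2) * (x powr 0 * (1 - x) powr (- c / 2))"
      using AE_beta_law
    proof eventually_elim
      case (elim x)
      have "1 \<le> \<delta> powr (a / 2) * x powr (- (a / 2))" if "x < \<delta>" using p[of x "a/2"] elim assms that by simp
      moreover have "1 \<le> \<delta> powr (c / 2) * (1 - x) powr (- (c / 2))" if "1 - \<delta> < x" using p[of "1 - x" "c/2"] elim assms that by simp
      moreover have "0 \<le> \<delta> powr (a / 2) * x powr (- (a / 2))" "0 \<le> \<delta> powr (c / 2) * (1 - x) powr (- (c / 2))" by auto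
      ultimately show ?case using elim by (auto split: split_indicator intro: add_increasing add_increasing2)
    qed
  qed (use 3 in \<open>simp add: has_bochner_integral_iff\<close>)
  also have "\<dots> = \<delta> powr (a / 2) * (Beta (a / 2) c / Beta a c) + \<delta> powr (c / 2) * (Beta a (c / 2) / Beta a c)"
    using 3 by (simp add: has_bochner_integral_iff)
  finally show ?thesis .
qed

text \<open>One integration by parts with crude estimates: for x in [\<delta>, 1] and s > 0, x^(s-1)
  is at most 1/\<delta> and x^(s-2) at most 1/\<delta>^2. The derivative of the weight is thus of
  order \<delta>^-3, and the boundary terms are relaxed to the same power.\<close>

lemma beta_integrand_cis_bound:
  assumes "a > 0" "c > 0" "0 < \<delta>" "\<delta> < 1/2" "\<omega> > 0"
  shows "norm (integral {\<delta>..1 - \<delta>} (\<lambda>x. of_real (x powr (a - 1) * (1 - x) powr (c - 1)) * cis (- (\<omega> * x))))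
    \<le> (2 + \<bar>a - 1\<bar> + \<bar>c - 1\<bar>) * inverse \<delta> ^ 3 / \<omega>"
proof -
  let ?I = "{\<delta>..1 - \<delta>}"
  define g where "g = (\<lambda>x. x powr (a - 1) * (1 - x) powr (c - 1))"
  define g' where "g' = (\<lambda>x. (a - 1) * x powr (a - 2) * (1 - x) powr (c - 1) - (c - 1) * x powr (a - 1) * (1 - x) powr (c - 2))"
  define \<iota> where "\<iota> = - (\<i> * of_real \<omega>)"
  have \<iota>: "\<iota> \<noteq> 0" "norm \<iota> = \<omega>" using assms by (auto simp: \<iota>_def norm_mult)
  have cisder: "((\<lambda>x. cis (- (\<omega> * x))) has_vector_derivative (\<iota> * cis (- (\<omega> * x)))) (at x within ?I)" for x
  proof -
    have "((\<lambda>z. exp (\<iota> * z)) has_field_derivative \<iota> * exp (\<iota> * of_real x)) (at (of_real x))"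
      by (auto intro!: derivative_eq_intros)
    from has_vector_derivative_real_field[OF this] show ?thesis
      by (simp add: cis_conv_exp \<iota>_def mult_ac)
  qed
  have gder: "(g has_real_derivative g' x) (at x within ?I)" if "x \<in> ?I" for x
  proof -
    have "x > 0" "1 - x > 0" using that assms by auto
    then show ?thesis unfolding g_def g'_def
      by (auto intro!: derivative_eq_intros simp: field_simps)
  qed
  have "((\<lambda>x. of_real (g x) * (\<iota> * cis (- (\<omega> * x))) + of_real (g' x) * cis (- (\<omega> * x))) has_integral
      (of_real (g (1 - \<delta>)) * cis (- (\<omega> * (1 - \<delta>))) - of_real (g \<delta>) * cis (- (\<omega> * \<delta>)))) ?I"
    using assms
    by (intro fundamental_theorem_of_calculus has_vector_derivative_mult cisder
       has_vector_derivative_of_real gder) auto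
  moreover have cont: "continuous_on ?I g'" "continuous_on ?I g"
    using assms unfolding g'_def g_def by (auto intro!: continuous_intros)
  then have i': "(\<lambda>x. of_real (g' x) * cis (- (\<omega> * x))) integrable_on ?I" "(\<lambda>x. of_real (g x) * cis (- (\<omega> * x))) integrable_on ?I"
    by (intro integrable_continuous_real continuous_intros; simp)+
  ultimately have "integral ?I (\<lambda>x. \<iota> * (of_real (g x) * cis (- (\<omega> * x)))) + integral ?I (\<lambda>x. of_real (g' x) * cis (- (\<omega> * x)))
      = of_real (g (1 - \<delta>)) * cis (- (\<omega> * (1 - \<delta>))) - of_real (g \<delta>) * cis (- (\<omega> * \<delta>))"
    by (subst Henstock_Kurzweil_Integration.integral_add[symmetric])
       (auto intro!: integral_unique integrable_on_mult_right simp: mult_ac)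
  then have eq: "\<iota> * integral ?I (\<lambda>x. of_real (g x) * cis (- (\<omega> * x)))
      = of_real (g (1 - \<delta>)) * cis (- (\<omega> * (1 - \<delta>))) - of_real (g \<delta>) * cis (- (\<omega> * \<delta>)) - integral ?I (\<lambda>x. of_real (g' x) * cis (- (\<omega> * x)))"
    by (simp add: algebra_simps)
  have pw: "x powr (s - 1) \<le> inverse \<delta>" "x powr (s - 2) \<le> inverse \<delta> ^ 2" if "\<delta> \<le> x" "x \<le> 1" "s > 0" for x s
  proof -
    have x: "x > 0" using that assms by simp
    have xs: "x powr s \<le> 1" using that x by (intro powr_le1) auto
    have le: "inverse x \<le> inverse \<delta>" using that assms by (intro le_imp_inverse_le) auto
    have "x powr (s - 1) = x powr s * inverse x" using x by (simp add: powr_diff field_simps)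
    also have "\<dots> \<le> 1 * inverse \<delta>" using xs le x by (intro mult_mono) auto
    finally show "x powr (s - 1) \<le> inverse \<delta>" by simp
    have "x powr (s - 2) = x powr s * inverse x ^ 2" using x by (simp add: powr_diff field_simps)
    also have "\<dots> \<le> 1 * inverse \<delta> ^ 2" using xs le x by (intro mult_mono power_mono) auto
    finally show "x powr (s - 2) \<le> inverse \<delta> ^ 2" by simp
  qed
  have d1: "1 \<le> inverse \<delta>" using assms by (simp add: one_le_inverse)
  have gb: "\<bar>g x\<bar> \<le> inverse \<delta> ^ 3" if "x \<in> ?I" for x
  proof -
    have "\<bar>g x\<bar> \<le> inverse \<delta> * inverse \<delta>"
      unfolding g_def using that assms pw(1)[of x a] pw(1)[of "1 - x" c] by (auto simp: abs_mult intro!: mult_mono)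
    also have "\<dots> \<le> inverse \<delta> ^ 3" using d1 power_increasing[of 2 3 "inverse \<delta>"] by (simp add: power2_eq_square)
    finally show ?thesis .
  qed
  have g'b: "\<bar>g' x\<bar> \<le> (\<bar>a - 1\<bar> + \<bar>c - 1\<bar>) * inverse \<delta> ^ 3" if "x \<in> ?I" for x
  proof -
    have "\<bar>g' x\<bar> \<le> \<bar>a - 1\<bar> * (x powr (a - 2) * (1 - x) powr (c - 1)) + \<bar>c - 1\<bar> * (x powr (a - 1) * (1 - x) powr (c - 2))"
      unfolding g'_def by (rule order_trans[OF abs_triangle_ineq4]) (simp add: abs_mult mult.assoc)
    also have "\<dots> \<le> \<bar>a - 1\<bar> * (inverse \<delta> ^ 2 * inverse \<delta>) + \<bar>c - 1\<bar> * (inverse \<delta> * inverse \<delta> ^ 2)"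
      using that assms pw(1)[of x a] pw(1)[of "1 - x" c] pw(2)[of x a] pw(2)[of "1 - x" c]
      by (intro add_mono mult_left_mono mult_mono) auto
    also have "\<dots> = (\<bar>a - 1\<bar> + \<bar>c - 1\<bar>) * inverse \<delta> ^ 3"
      by (simp add: power3_eq_cube power2_eq_square algebra_simps)
    finally show ?thesis .
  qed
  have "norm (integral ?I (\<lambda>x. of_real (g' x) * cis (- (\<omega> * x)))) \<le> (\<bar>a - 1\<bar> + \<bar>c - 1\<bar>) * inverse \<delta> ^ 3 * measure lborel ?I"
    using assms g'b by (intro has_integral_bound_real[OF _ _ integrable_integral] i') (auto simp: norm_mult)
  also have "\<dots> \<le> (\<bar>a - 1\<bar> + \<bar>c - 1\<bar>) * inverse \<delta> ^ 3 * 1"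
    using assms by (intro mult_left_mono) auto
  finally have 1: "norm (integral ?I (\<lambda>x. of_real (g' x) * cis (- (\<omega> * x)))) \<le> (\<bar>a - 1\<bar> + \<bar>c - 1\<bar>) * inverse \<delta> ^ 3"
    by simp
  have 2: "norm (of_real (g (1 - \<delta>)) * cis (- (\<omega> * (1 - \<delta>)))) \<le> inverse \<delta> ^ 3" "norm (of_real (g \<delta>) * cis (- (\<omega> * \<delta>))) \<le> inverse \<delta> ^ 3"
    using gb[of \<delta>] gb[of "1 - \<delta>"] assms by (auto simp: norm_mult)
  have "\<omega> * norm (integral ?I (\<lambda>x. of_real (g x) * cis (- (\<omega> * x)))) = norm (\<iota> * integral ?I (\<lambda>x. of_real (g x) * cis (- (\<omega> * x))))"
    by (simp add: norm_mult \<iota>)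
  also have "\<dots> \<le> inverse \<delta> ^ 3 + inverse \<delta> ^ 3 + (\<bar>a - 1\<bar> + \<bar>c - 1\<bar>) * inverse \<delta> ^ 3"
    unfolding eq using 1 2 by (intro order_trans[OF norm_triangle_ineq4] add_mono) auto
  also have "\<dots> = (2 + \<bar>a - 1\<bar> + \<bar>c - 1\<bar>) * inverse \<delta> ^ 3" by (simp add: algebra_simps)
  finally show ?thesis using assms unfolding g_def by (simp add: field_simps)
qed

text \<open>The density may blow up at both end points; cut off \<open>\<delta> = \<omega>\<^sup>-\<^sup>1\<^sup>/\<^sup>4 / 3\<close> there and integrate by parts
  in between.\<close>

lemma beta_law_cis_decay:
  assumes "a > 0" "c > 0"
  obtains C \<epsilon> where "0 < \<epsilon>" "\<epsilon> \<le> 1" "C \<ge> 0"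
    "\<And>\<omega>. \<omega> > 0 \<Longrightarrow> norm (\<integral>x. cis (- (\<omega> * x)) \<partial>beta_law a c) \<le> C * \<omega> powr (- \<epsilon>)"
proof -
  interpret prob_space "beta_law a c" by (rule prob_space_beta_law[OF assms])
  \<comment> \<open>The middle part is of order \<delta>^-3/\<omega>, that is \<omega>^(-1/4); the
    tails \<delta>^(a/2) and \<delta>^(c/2) are at most \<omega>^(-a/8) and \<omega>^(-c/8). The
    slowest of the three rates is kept.\<close>
  define \<epsilon> where "\<epsilon> = min (1/4) (min (a / 8) (c / 8))"
  define K1 where "K1 = Beta (a / 2) c / Beta a c"
  define K2 where "K2 = Beta a (c / 2) / Beta a c"
  define K where "K = 27 * (2 + \<bar>a - 1\<bar> + \<bar>c - 1\<bar>) / Beta a c"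
  note B = Beta_real_pos[OF assms]
  have K: "K1 \<ge> 0" "K2 \<ge> 0" "K \<ge> 0"
    unfolding K1_def K2_def K_def using assms B Beta_real_pos[of "a/2" c] Beta_real_pos[of a "c/2"] by auto
  have [measurable]: "(\<lambda>x. cis (- (\<omega> * x))) \<in> borel_measurable borel" for \<omega>
    by (intro borel_measurable_continuous_onI continuous_intros)
  have i: "integrable (beta_law a c) (\<lambda>x. cis (- (\<omega> * x)))" for \<omega>
    by (intro integrable_const_bound[where B = 1]) auto
  \<comment> \<open>The summand 1 of the constant serves \<omega> < 1, where only the trivial bound
    1 is used and \<omega>^-\<epsilon> is at least 1.\<close>
  have le: "norm (\<integral>x. cis (- (\<omega> * x)) \<partial>beta_law a c) \<le> (1 + K1 + K2 + K) * \<omega> powr (- \<epsilon>)" if \<omega>: "\<omega> > 0" for \<omega>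
  proof (cases "\<omega> \<ge> 1")
    case False
    have "norm (\<integral>x. cis (- (\<omega> * x)) \<partial>beta_law a c) \<le> (\<integral>x. norm (cis (- (\<omega> * x))) \<partial>beta_law a c)"
      by (rule integral_norm_bound)
    also have "\<dots> = 1" using prob_space by simp
    also have "1 \<le> (1 + K1 + K2 + K) * \<omega> powr (- \<epsilon>)"
    proof -
      have "1 \<le> \<omega> powr (- \<epsilon>)"
        using False \<omega> assms powr_mono_both'[of \<epsilon> 0 \<omega> 1] powr_mono'[of "- \<epsilon>" 0 \<omega>] by (auto simp: \<epsilon>_def)
      then have "1 * 1 \<le> (1 + K1 + K2 + K) * \<omega> powr (- \<epsilon>)" using K by (intro mult_mono) auto
      then show ?thesis by simp
    qed
    finally show ?thesis .
  next
    case True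
    define \<delta> where "\<delta> = \<omega> powr (- 1/4) / 3"
    have w1: "\<omega> powr (- 1/4) \<le> 1" using True powr_mono[of "-1/4" 0 \<omega>] by auto
    have \<delta>: "0 < \<delta>" "\<delta> < 1/2" using \<omega> w1 by (auto simp: \<delta>_def)
    let ?I = "{\<delta>..1 - \<delta>}"
    have dp: "\<delta> powr (s / 2) \<le> \<omega> powr (- \<epsilon>)" if "s > 0" "\<epsilon> \<le> s / 8" for s
    proof -
      have "\<delta> powr (s / 2) \<le> (\<omega> powr (- 1/4)) powr (s / 2)" using that \<delta> by (intro powr_mono2) (auto simp: \<delta>_def)
      also have "\<dots> = \<omega> powr (- (s / 8))" by (simp add: powr_powr)
      also have "\<dots> \<le> \<omega> powr (- \<epsilon>)" using that True by (intro powr_mono) auto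
      finally show ?thesis .
    qed
    have i1: "integrable (beta_law a c) (\<lambda>x. indicator ?I x *\<^sub>R cis (- (\<omega> * x)))"
      by (intro integrable_const_bound[where B = 1]) (auto split: split_indicator)
    have i2: "integrable (beta_law a c) (\<lambda>x. indicator (- ?I) x *\<^sub>R cis (- (\<omega> * x)))"
      by (intro integrable_const_bound[where B = 1]) (auto split: split_indicator)
    have "(\<integral>x. cis (- (\<omega> * x)) \<partial>beta_law a c) = (\<integral>x. indicator ?I x *\<^sub>R cis (- (\<omega> * x)) + indicator (- ?I) x *\<^sub>R cis (- (\<omega> * x)) \<partial>beta_law a c)"
      by (intro Bochner_Integration.integral_cong) (auto split: split_indicator)
    also have "\<dots> = (\<integral>x. indicator ?I x *\<^sub>R cis (- (\<omega> * x)) \<partial>beta_law a c) + (\<integral>x. indicator (- ?I) x *\<^sub>R cis (- (\<omega> * x)) \<partial>beta_law a c)"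
      by (rule Bochner_Integration.integral_add[OF i1 i2])
    finally have "norm (\<integral>x. cis (- (\<omega> * x)) \<partial>beta_law a c) \<le> norm (\<integral>x. indicator ?I x *\<^sub>R cis (- (\<omega> * x)) \<partial>beta_law a c) + norm (\<integral>x. indicator (- ?I) x *\<^sub>R cis (- (\<omega> * x)) \<partial>beta_law a c)"
      by (metis norm_triangle_ineq)
    also have "norm (\<integral>x. indicator (- ?I) x *\<^sub>R cis (- (\<omega> * x)) \<partial>beta_law a c) \<le> (K1 + K2) * \<omega> powr (- \<epsilon>)"
    proof -
      have "norm (\<integral>x. indicator (- ?I) x *\<^sub>R cis (- (\<omega> * x)) \<partial>beta_law a c) \<le> (\<integral>x. norm (indicator (- ?I) x *\<^sub>R cis (- (\<omega> * x))) \<partial>beta_law a c)"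
        by (rule integral_norm_bound)
      also have "\<dots> = (\<integral>x. indicator (- ?I) x \<partial>beta_law a c)" by simp
      also have "\<dots> \<le> \<delta> powr (a / 2) * K1 + \<delta> powr (c / 2) * K2"
        unfolding K1_def K2_def by (rule beta_law_tail_le[OF assms \<delta>])
      also have "\<dots> \<le> \<omega> powr (- \<epsilon>) * K1 + \<omega> powr (- \<epsilon>) * K2"
        using K dp[of a] dp[of c] assms by (intro add_mono mult_right_mono) (auto simp: \<epsilon>_def)
      finally show ?thesis by (simp add: algebra_simps)
    qed
    also have "norm (\<integral>x. indicator ?I x *\<^sub>R cis (- (\<omega> * x)) \<partial>beta_law a c) \<le> K * \<omega> powr (- \<epsilon>)"
    proof -
      let ?h = "\<lambda>x. of_real (x powr (a - 1) * (1 - x) powr (c - 1)) * cis (- (\<omega> * x))"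
      have "(\<integral>x. indicator ?I x *\<^sub>R cis (- (\<omega> * x)) \<partial>beta_law a c) = (\<integral>x. (beta_weight a c x / Beta a c) *\<^sub>R (indicator ?I x *\<^sub>R cis (- (\<omega> * x))) \<partial>lborel)"
        unfolding beta_law_def using B by (intro integral_density) auto
      also have "\<dots> = (\<integral>x. of_real (1 / Beta a c) * (indicator ?I x *\<^sub>R ?h x) \<partial>lborel)"
        using \<delta> by (intro Bochner_Integration.integral_cong) (auto simp: beta_weight_def scaleR_conv_of_real split: split_indicator)
      also have "\<dots> = of_real (1 / Beta a c) * (LINT x:?I|lborel. ?h x)"
        unfolding set_lebesgue_integral_def by (rule integral_mult_right_zero)
      also have "(LINT x:?I|lborel. ?h x) = integral ?I ?h"
      proof (rule set_borel_integral_eq_integral(2))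
        have "continuous_on ?I ?h" using \<delta> by (auto intro!: continuous_intros)
        then show "set_integrable lborel ?I ?h" by (rule borel_integrable_compact[OF compact_Icc, unfolded set_integrable_def[symmetric]])
      qed
      finally have "norm (\<integral>x. indicator ?I x *\<^sub>R cis (- (\<omega> * x)) \<partial>beta_law a c) = norm (integral ?I ?h) / Beta a c"
        using B by (simp add: norm_mult norm_divide)
      also have "\<dots> \<le> ((2 + \<bar>a - 1\<bar> + \<bar>c - 1\<bar>) * inverse \<delta> ^ 3 / \<omega>) / Beta a c"
        using B by (intro divide_right_mono beta_integrand_cis_bound assms \<delta> \<omega>) auto
      also have "inverse \<delta> ^ 3 = 27 * \<omega> powr (3/4)"
      proof -
        have "inverse \<delta> = 3 * \<omega> powr (1/4)" using \<omega> by (simp add: \<delta>_def powr_minus field_simps)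
        moreover have "(\<omega> powr (1/4)) ^ 3 = \<omega> powr (3/4)" using \<omega> by (simp add: powr_powr flip: powr_realpow)
        ultimately show ?thesis by (simp add: power_mult_distrib)
      qed
      also have "((2 + \<bar>a - 1\<bar> + \<bar>c - 1\<bar>) * (27 * \<omega> powr (3/4)) / \<omega>) / Beta a c = K * (\<omega> powr (3/4) / \<omega> powr 1)"
        using \<omega> by (simp add: K_def field_simps)
      also have "\<omega> powr (3/4) / \<omega> powr 1 = \<omega> powr (3/4 - 1)" by (rule powr_diff[symmetric])
      also have "\<dots> \<le> \<omega> powr (- \<epsilon>)" using True by (intro powr_mono) (auto simp: \<epsilon>_def)
      finally show ?thesis using K by (simp add: mult_left_mono)
    qed
    also have "K * \<omega> powr (- \<epsilon>) + (K1 + K2) * \<omega> powr (- \<epsilon>) \<le> (1 + K1 + K2 + K) * \<omega> powr (- \<epsilon>)"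
      by (simp add: algebra_simps)
    finally show ?thesis by simp
  qed
  show ?thesis
  proof (rule that[of \<epsilon> "1 + K1 + K2 + K"])
    show "0 < \<epsilon>" "\<epsilon> \<le> 1" using assms by (auto simp: \<epsilon>_def)
    show "1 + K1 + K2 + K \<ge> 0" using K by simp
  qed (rule le)
qed

section \<open>Projections of rotation invariant laws\<close>

lemma nn_integral_lborel_translate:
  fixes f :: "'a::euclidean_space \<Rightarrow> ennreal"
  assumes [measurable]: "f \<in> borel_measurable borel"
  shows "(\<integral>\<^sup>+x. f (c + x) \<partial>lborel) = (\<integral>\<^sup>+x. f x \<partial>lborel)"
proof -
  have "(\<integral>\<^sup>+x. f x \<partial>lborel) = (\<integral>\<^sup>+x. f x \<partial>distr lborel borel ((+) c))"
    by (simp only: lborel_distr_plus)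
  also have "\<dots> = (\<integral>\<^sup>+x. f (c + x) \<partial>lborel)"
    by (subst nn_integral_distr) auto
  finally show ?thesis by simp
qed

text \<open>The image measure is translation invariant; comparing both measures of \<open>A\<close> with the measure of the
  unit ball through Fubini's theorem shows that it is Lebesgue measure.\<close>

lemma lborel_distr_linear_isometry:
  fixes f :: "'a::euclidean_space \<Rightarrow> 'a"
  assumes f: "linear f" and norm: "\<And>x. norm (f x) = norm x"
  shows "distr lborel borel f = lborel"
proof (rule measure_eqI)
  have [measurable]: "f \<in> borel_measurable borel"
    by (intro borel_measurable_continuous_onI linear_continuous_on linear_conv_bounded_linear[THEN iffD1] f)
  have "x = 0" if "f x = 0" for x using norm[of x] that by simp
  then have "inj f" using linear_injective_0[OF f] by blast
  then have "surj f" by (intro linear_injective_imp_surjective[OF f]) auto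
  then have g: "f (inv f y) = y" for y by (rule surj_f_inv_f)
  fix A :: "'a set" assume "A \<in> sets (distr lborel borel f)"
  then have [measurable]: "A \<in> sets borel" by simp
  let ?B = "ball 0 1 :: 'a set"
  have [measurable]: "?B \<in> sets borel" by simp
  have fm: "emeasure (distr lborel borel f) A = (\<integral>\<^sup>+x. indicator A (f x) \<partial>lborel)"
  proof -
    have "emeasure (distr lborel borel f) A = (\<integral>\<^sup>+x. indicator A x \<partial>distr lborel borel f)"
      by (simp add: nn_integral_indicator)
    also have "\<dots> = (\<integral>\<^sup>+x. indicator A (f x) \<partial>lborel)" by (rule nn_integral_distr) auto
    finally show ?thesis .
  qed
  have "emeasure lborel ?B * emeasure (distr lborel borel f) A
      = (\<integral>\<^sup>+y. indicator ?B y * emeasure (distr lborel borel f) A \<partial>lborel)"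
    by (subst nn_integral_multc) auto
  also have "\<dots> = (\<integral>\<^sup>+y. (\<integral>\<^sup>+x. indicator ?B y * indicator A (f x + y) \<partial>lborel) \<partial>lborel)"
  proof (rule nn_integral_cong)
    fix y
    have "(\<integral>\<^sup>+x. indicator A (f x) \<partial>lborel) = (\<integral>\<^sup>+x. indicator A (f (inv f y + x)) \<partial>lborel)"
      by (rule nn_integral_lborel_translate[symmetric]) measurable
    also have "\<dots> = (\<integral>\<^sup>+x. indicator A (f x + y) \<partial>lborel)"
      by (simp add: linear_add[OF f] g add.commute)
    finally show "indicator ?B y * emeasure (distr lborel borel f) A = (\<integral>\<^sup>+x. indicator ?B y * indicator A (f x + y) \<partial>lborel)"
      by (subst nn_integral_cmult) (auto simp: fm)
  qed
  also have "\<dots> = (\<integral>\<^sup>+x. (\<integral>\<^sup>+y. indicator ?B y * indicator A (f x + y) \<partial>lborel) \<partial>lborel)"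
    by (rule lborel_pair.Fubini') measurable
  also have "\<dots> = (\<integral>\<^sup>+x. (\<integral>\<^sup>+y. indicator ?B (y - f x) * indicator A y \<partial>lborel) \<partial>lborel)"
  proof (rule nn_integral_cong)
    fix x
    show "(\<integral>\<^sup>+y. indicator ?B y * indicator A (f x + y) \<partial>lborel) = (\<integral>\<^sup>+y. indicator ?B (y - f x) * indicator A y \<partial>lborel)"
      using nn_integral_lborel_translate[of "\<lambda>y. indicator ?B (y - f x) * indicator A y" "f x"] by simp
  qed
  also have "\<dots> = (\<integral>\<^sup>+y. (\<integral>\<^sup>+x. indicator ?B (y - f x) * indicator A y \<partial>lborel) \<partial>lborel)"
    by (rule lborel_pair.Fubini') measurable
  also have "\<dots> = (\<integral>\<^sup>+y. emeasure lborel ?B * indicator A y \<partial>lborel)"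
  proof (rule nn_integral_cong)
    fix y
    have "indicator ?B (y - f (inv f y + x)) = (indicator ?B x :: ennreal)" for x
      by (simp add: linear_add[OF f] g indicator_def norm)
    then have "(\<integral>\<^sup>+x. indicator ?B (y - f x) \<partial>lborel) = (\<integral>\<^sup>+x. indicator ?B x \<partial>(lborel :: 'a measure))"
      by (subst nn_integral_lborel_translate[of _ "inv f y", symmetric]) auto
    then show "(\<integral>\<^sup>+x. indicator ?B (y - f x) * indicator A y \<partial>lborel) = emeasure lborel ?B * indicator A y"
      by (subst nn_integral_multc) auto
  qed
  also have "\<dots> = emeasure lborel ?B * emeasure lborel A"
    by (subst nn_integral_cmult) auto
  finally have "emeasure lborel ?B * emeasure (distr lborel borel f) A = emeasure lborel ?B * emeasure lborel A" .
  moreover have "emeasure lborel ?B \<noteq> 0" "emeasure lborel ?B \<noteq> \<infinity>"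
  proof -
    have "unit_ball_vol (real DIM('a)) > 0" by simp
    then have "unit_ball_vol (real DIM('a)) \<noteq> 0" by (rule less_imp_neq[symmetric])
    then show "emeasure lborel ?B \<noteq> 0" by (simp add: emeasure_ball)
    show "emeasure lborel ?B \<noteq> \<infinity>" by (simp add: emeasure_ball)
  qed
  ultimately show "emeasure (distr lborel borel f) A = emeasure lborel A"
    by (simp add: ennreal_mult_cancel_left)
qed auto

text \<open>\<open>E\<close> is completed to an orthonormal basis \<open>F\<close>, and a bijection
  \<open>h\<close> from \<open>Basis\<close> to \<open>F\<close> takes a subset \<open>B\<close>
  onto \<open>E\<close>. The standard coordinates of \<open>f x\<close> are the coordinates of
  \<open>x\<close> with respect to \<open>F\<close>.\<close>

lemma orthonormal_extension_isometry:
  fixes E :: "'a::euclidean_space set"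
  assumes E: "pairwise orthogonal E" "\<And>e. e \<in> E \<Longrightarrow> norm e = 1"
  obtains B f where "B \<subseteq> Basis" "card B = card E" "linear f" "\<forall>x::'a. norm (f x :: 'a) = norm x"
    "\<forall>x. (\<Sum>e\<in>E. (x \<bullet> e)\<^sup>2) = (\<Sum>b\<in>B. (f x \<bullet> b)\<^sup>2)"
proof -
  obtain U where U: "U \<inter> insert 0 E = {}" "pairwise orthogonal (E \<union> U)" "span (E \<union> U) = span (E \<union> UNIV)"
    using orthogonal_extension_strong[OF E(1)] by blast
  define F where "F = E \<union> sgn ` U"
  have U0: "u \<noteq> 0" if "u \<in> U" for u using U(1) that by auto
  have F1: "norm e = 1" if "e \<in> F" for e
    using that E(2) U0 by (auto simp: F_def norm_sgn)
  have orth: "orthogonal (sgn x) (sgn y)" if "orthogonal x y" for x y :: 'a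
    using that by (simp add: orthogonal_def sgn_div_norm)
  have sgnE: "sgn e = e" if "e \<in> E" for e using E(2)[OF that] by (simp add: sgn_div_norm)
  have "sgn ` E = id ` E" using sgnE by (intro image_cong) auto
  then have F_alt: "F = sgn ` (E \<union> U)" by (simp add: F_def image_Un)
  have F2: "pairwise orthogonal F"
    unfolding F_alt by (intro pairwise_imageI orth) (use U(2) in \<open>auto dest: pairwiseD\<close>)
  have F3: "span F = UNIV"
  proof -
    have "E \<union> U \<subseteq> span F"
    proof
      fix x assume x: "x \<in> E \<union> U"
      then have "sgn x \<in> F" by (auto simp: F_alt)
      then have "norm x *\<^sub>R sgn x \<in> span F" by (intro span_mul span_base)
      moreover have "norm x *\<^sub>R sgn x = x" by (cases "x = 0") (auto simp: sgn_div_norm)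
      ultimately show "x \<in> span F" by simp
    qed
    then have "span (E \<union> U) \<subseteq> span F" by (metis span_mono span_span)
    then show ?thesis using U(3) by auto
  qed
  have "0 \<notin> F" using F1 by force
  then have "independent F" using F2 pairwise_orthogonal_independent by blast
  then have F4: "finite F" "card F = DIM('a)"
    using F3 independent_imp_finite basis_card_eq_dim[of F UNIV] by auto
  have EF: "E \<subseteq> F" "finite E" using F4 by (auto simp: F_def)
  obtain B where B: "B \<subseteq> (Basis :: 'a set)" "card B = card E"
    using obtain_subset_with_card_n[of "card E" "Basis :: 'a set"] F4 EF by (metis card_mono)
  obtain h1 where h1: "bij_betw h1 B E"
    using finite_same_card_bij[of B E] B EF finite_subset[OF B(1) finite_Basis] by auto
  have "card (Basis - B) = card (F - E)"
    using B EF F4 by (simp add: card_Diff_subset finite_subset[OF B(1) finite_Basis])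
  then obtain h2 where h2: "bij_betw h2 (Basis - B) (F - E)"
    using finite_same_card_bij[of "Basis - B" "F - E"] F4 by auto
  define h where "h = (\<lambda>b. if b \<in> B then h1 b else h2 b)"
  have hB: "bij_betw h B E" using h1 by (rule bij_betw_cong[THEN iffD1, rotated]) (simp add: h_def)
  have hB': "bij_betw h (Basis - B) (F - E)" using h2 by (rule bij_betw_cong[THEN iffD1, rotated]) (simp add: h_def)
  have "bij_betw h (B \<union> (Basis - B)) (E \<union> (F - E))"
    by (rule bij_betw_combine[OF hB hB']) auto
  then have hF: "bij_betw h Basis F" using B EF by (simp add: Un_absorb1)
  define f where "f = (\<lambda>x. \<Sum>b\<in>Basis. (x \<bullet> h b) *\<^sub>R b)"
  have fb: "f x \<bullet> b = x \<bullet> h b" if "b \<in> Basis" for x b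
    using that by (simp add: f_def inner_sum_left inner_Basis if_distrib sum.delta cong: if_cong)
  show ?thesis
  proof (rule that[OF B])
    show "linear f" unfolding f_def
      by (intro linearI) (simp_all add: inner_add_left scaleR_add_left sum.distrib scaleR_sum_right)
    show "\<forall>x. norm (f x) = norm x"
    proof
      fix x
      have "f x \<bullet> f x = (\<Sum>b\<in>Basis. (x \<bullet> h b)\<^sup>2)"
        by (subst euclidean_inner) (simp add: fb power2_eq_square)
      also have "\<dots> = (\<Sum>e\<in>F. (x \<bullet> e)\<^sup>2)"
        by (rule sum.reindex_bij_betw[OF hF])
      also have "\<dots> = (\<Sum>e\<in>F. (x \<bullet> e) *\<^sub>R e) \<bullet> x"
        by (simp add: inner_sum_left power2_eq_square inner_commute[of x])
      also have "(\<Sum>e\<in>F. (x \<bullet> e) *\<^sub>R e) = x"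
        using F1 F2 F3 F4 by (intro orthonormal_basis_expand) auto
      finally show "norm (f x) = norm x" by (simp add: norm_eq_sqrt_inner)
    qed
    show "\<forall>x. (\<Sum>e\<in>E. (x \<bullet> e)\<^sup>2) = (\<Sum>b\<in>B. (f x \<bullet> b)\<^sup>2)"
    proof
      fix x
      have "(\<Sum>b\<in>B. (f x \<bullet> b)\<^sup>2) = (\<Sum>b\<in>B. (x \<bullet> h b)\<^sup>2)"
        using B by (intro sum.cong) (auto simp: fb)
      then show "(\<Sum>e\<in>E. (x \<bullet> e)\<^sup>2) = (\<Sum>b\<in>B. (f x \<bullet> b)\<^sup>2)" using sum.reindex_bij_betw[OF hB, of "\<lambda>e. (x \<bullet> e)\<^sup>2"] by simp
    qed
  qed
qed

section \<open>Integrals of functions of sums of squared coordinates\<close>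

text \<open>The truncation absorbs the indicator of the unit ball in the density, and p = 0 gives
  the indicator of r > 0, so that volumes of balls are a special case.\<close>

definition pos_powr :: "real \<Rightarrow> real \<Rightarrow> real" where
  "pos_powr p r = (if r > 0 then r powr p else 0)"

lemma measurable_pos_powr [measurable]: "pos_powr p \<in> borel_measurable borel"
  unfolding pos_powr_def by measurable

lemma pos_powr_nonneg [simp]: "pos_powr p r \<ge> 0" by (simp add: pos_powr_def)

text \<open>Homogeneity: substituting sqrt(s) x for x takes s^p out of the integrand and sqrt(s) out
  of dx. The integral at s = 1 remains as an unevaluated, possibly infinite factor.\<close>

lemma nn_integral_pos_powr_minus_square:
  "(\<integral>\<^sup>+x. ennreal (pos_powr p (s - x\<^sup>2)) \<partial>lborel)
    = (\<integral>\<^sup>+x. ennreal (pos_powr p (1 - x\<^sup>2)) \<partial>lborel) * ennreal (pos_powr (p + 1/2) s)"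
proof (cases "s > 0")
  case True
  have "(\<integral>\<^sup>+x. ennreal (pos_powr p (s - x\<^sup>2)) \<partial>lborel)
      = sqrt s * (\<integral>\<^sup>+x. ennreal (pos_powr p (s - (0 + sqrt s * x)\<^sup>2)) \<partial>lborel)"
    using True by (subst nn_integral_real_affine[where t = 0 and c = "sqrt s"]) auto
  also have "(\<lambda>x. ennreal (pos_powr p (s - (0 + sqrt s * x)\<^sup>2))) = (\<lambda>x. ennreal (s powr p) * ennreal (pos_powr p (1 - x\<^sup>2)))"
  proof
    fix x
    have "s - (0 + sqrt s * x)\<^sup>2 = s * (1 - x\<^sup>2)" using True by (simp add: power_mult_distrib algebra_simps)
    moreover have "pos_powr p (s * (1 - x\<^sup>2)) = s powr p * pos_powr p (1 - x\<^sup>2)"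
      using True by (simp add: pos_powr_def zero_less_mult_iff powr_mult)
    ultimately show "ennreal (pos_powr p (s - (0 + sqrt s * x)\<^sup>2)) = ennreal (s powr p) * ennreal (pos_powr p (1 - x\<^sup>2))"
      by (simp add: ennreal_mult)
  qed
  also have "(\<integral>\<^sup>+x. ennreal (s powr p) * ennreal (pos_powr p (1 - x\<^sup>2)) \<partial>lborel) = ennreal (s powr p) * (\<integral>\<^sup>+x. ennreal (pos_powr p (1 - x\<^sup>2)) \<partial>lborel)"
    by (rule nn_integral_cmult) measurable
  also have "ennreal (sqrt s) * (ennreal (s powr p) * (\<integral>\<^sup>+x. ennreal (pos_powr p (1 - x\<^sup>2)) \<partial>lborel))
      = (\<integral>\<^sup>+x. ennreal (pos_powr p (1 - x\<^sup>2)) \<partial>lborel) * (ennreal (s powr p) * ennreal (sqrt s))"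
    by (simp add: mult_ac)
  also have "ennreal (s powr p) * ennreal (sqrt s) = ennreal (pos_powr (p + 1/2) s)"
    using True by (simp add: pos_powr_def powr_add powr_half_sqrt flip: ennreal_mult)
  finally show ?thesis .
next
  case False
  have "\<not> s - x\<^sup>2 > 0" for x using False zero_le_power2[of x] by linarith
  then show ?thesis using False by (simp add: pos_powr_def)
qed

interpretation lborel_product: product_sigma_finite "\<lambda>_. lborel :: real measure" ..

text \<open>Integrating out one coordinate raises the exponent by \<open>1/2\<close>. The constant is never computed:
  a probability density is determined by its shape.\<close>

lemma nn_integral_PiM_pos_powr:
  assumes "finite J"
  shows "\<exists>C. (p \<ge> 0 \<longrightarrow> C < \<infinity>) \<and>
    (\<forall>s. (\<integral>\<^sup>+x. ennreal (pos_powr p (s - (\<Sum>i\<in>J. (x i)\<^sup>2))) \<partial>(\<Pi>\<^sub>M i\<in>J. lborel)) = C * ennreal (pos_powr (p + real (card J) / 2) s))"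
  using assms
proof (induction J arbitrary: p)
  case empty
  show ?case by (intro exI[of _ 1]) (simp add: PiM_empty)
next
  case (insert j J)
  define c where "c = (\<integral>\<^sup>+x. ennreal (pos_powr p (1 - x\<^sup>2)) \<partial>lborel)"
  \<comment> \<open>For p >= 0 the integrand lies below the indicator of [-1, 1]. Finiteness matters
    at p = 0, where it gives the half-lines finite measure in
    \<open>distr_PiM_sum_squares\<close>.\<close>
  have c: "c < \<infinity>" if "p \<ge> 0"
  proof -
    have "c \<le> (\<integral>\<^sup>+x. indicator {-1..1::real} x \<partial>lborel)"
      unfolding c_def
    proof (rule nn_integral_mono)
      fix x :: real
      show "ennreal (pos_powr p (1 - x\<^sup>2)) \<le> indicator {-1..1} x"
      proof (cases "1 - x\<^sup>2 > 0")
        case True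
        then have "x \<in> {-1..1}" using abs_square_less_1[of x] by auto
        moreover have "(1 - x\<^sup>2) powr p \<le> 1" using True that by (intro powr_le1) auto
        ultimately show ?thesis using True by (simp add: pos_powr_def)
      qed (simp add: pos_powr_def)
    qed
    also have "\<dots> < \<infinity>" by (simp add: nn_integral_indicator)
    finally show ?thesis .
  qed
  obtain C where C: "p + 1/2 \<ge> 0 \<longrightarrow> C < \<infinity>"
    "\<And>s. (\<integral>\<^sup>+x. ennreal (pos_powr (p + 1/2) (s - (\<Sum>i\<in>J. (x i)\<^sup>2))) \<partial>(\<Pi>\<^sub>M i\<in>J. lborel)) = C * ennreal (pos_powr (p + 1/2 + real (card J) / 2) s)"
    using insert.IH[of "p + 1/2"] by metis
  have "(\<integral>\<^sup>+x. ennreal (pos_powr p (s - (\<Sum>i\<in>insert j J. (x i)\<^sup>2))) \<partial>(\<Pi>\<^sub>M i\<in>insert j J. lborel)) = (c * C) * ennreal (pos_powr (p + real (card (insert j J)) / 2) s)" for s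
  proof -
    have "(\<integral>\<^sup>+x. ennreal (pos_powr p (s - (\<Sum>i\<in>insert j J. (x i)\<^sup>2))) \<partial>(\<Pi>\<^sub>M i\<in>insert j J. lborel))
        = (\<integral>\<^sup>+x. (\<integral>\<^sup>+y. ennreal (pos_powr p (s - (\<Sum>i\<in>insert j J. ((x(j := y)) i)\<^sup>2))) \<partial>lborel) \<partial>(\<Pi>\<^sub>M i\<in>J. lborel))"
      using insert.hyps by (intro lborel_product.product_nn_integral_insert) auto
    also have "\<dots> = (\<integral>\<^sup>+x. c * ennreal (pos_powr (p + 1/2) (s - (\<Sum>i\<in>J. (x i)\<^sup>2))) \<partial>(\<Pi>\<^sub>M i\<in>J. lborel))"
    proof (rule nn_integral_cong)
      fix x :: "'a \<Rightarrow> real"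
      have "(\<Sum>i\<in>J. ((x(j := y)) i)\<^sup>2) = (\<Sum>i\<in>J. (x i)\<^sup>2)" for y
        using insert.hyps by (intro sum.cong) auto
      then have "s - (\<Sum>i\<in>insert j J. ((x(j := y)) i)\<^sup>2) = (s - (\<Sum>i\<in>J. (x i)\<^sup>2)) - y\<^sup>2" for y
        using insert.hyps by simp
      note eq = this
      show "(\<integral>\<^sup>+y. ennreal (pos_powr p (s - (\<Sum>i\<in>insert j J. ((x(j := y)) i)\<^sup>2))) \<partial>lborel) = c * ennreal (pos_powr (p + 1/2) (s - (\<Sum>i\<in>J. (x i)\<^sup>2)))"
        unfolding c_def eq by (rule nn_integral_pos_powr_minus_square)
    qed
    also have "\<dots> = c * (C * ennreal (pos_powr (p + 1/2 + real (card J) / 2) s))"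
      by (subst nn_integral_cmult) (auto simp: C(2))
    also have "p + 1/2 + real (card J) / 2 = p + real (card (insert j J)) / 2"
      using insert.hyps by (simp add: field_simps)
    finally show ?thesis by (simp add: mult.assoc)
  qed
  moreover have "p \<ge> 0 \<longrightarrow> c * C < \<infinity>" using c C(1) by (auto simp: ennreal_mult_less_top)
  ultimately show ?case by (intro exI[of _ "c * C"]) simp
qed

lemma nn_integral_pos_powr_lessThan:
  assumes "d > 0"
  shows "(\<integral>\<^sup>+u. ennreal (d * pos_powr (d - 1) u) * indicator {..<s} u \<partial>lborel) = ennreal (pos_powr d s)"
proof (cases "s > 0")
  case True
  have "((\<lambda>u. u powr (d - 1)) has_integral (s powr d / d)) {0..s}"
    using has_integral_powr_from_0[of "d - 1" s] assms True by simp
  from has_integral_mult_right[OF this, of d]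
  have "((\<lambda>u. if u \<in> {0..s} then d * u powr (d - 1) else 0) has_integral s powr d) UNIV"
    using assms by (subst has_integral_restrict_UNIV) simp
  then have "(\<integral>\<^sup>+u. ennreal (if u \<in> {0..s} then d * u powr (d - 1) else 0) \<partial>lborel) = ennreal (s powr d)"
    using assms by (intro nn_integral_has_integral_lborel) auto
  also have "(\<integral>\<^sup>+u. ennreal (if u \<in> {0..s} then d * u powr (d - 1) else 0) \<partial>lborel)
      = (\<integral>\<^sup>+u. ennreal (d * pos_powr (d - 1) u) * indicator {..<s} u \<partial>lborel)"
    by (intro nn_integral_cong_AE, use AE_lborel_singleton[of s] in eventually_elim) (auto simp: pos_powr_def split: split_indicator)
  finally show ?thesis using True by (simp add: pos_powr_def)
next
  case False
  have z: "ennreal (d * pos_powr (d - 1) u) * indicator {..<s} u = 0" for u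
    using False by (auto simp: pos_powr_def split: split_indicator)
  show ?thesis unfolding z using False by (simp add: pos_powr_def)
qed

text \<open>The case p = 0 of \<open>nn_integral_PiM_pos_powr\<close> is the volume of a ball:
  \<open>{..<s}\<close> gets measure proportional to s^(card J / 2) for s > 0. Half-lines are an
  intersection-stable generator of finite measure, so this determines the image measure.\<close>

lemma distr_PiM_sum_squares:
  assumes J: "finite J" "J \<noteq> {}"
  shows "\<exists>C. distr (\<Pi>\<^sub>M i\<in>J. lborel) borel (\<lambda>x. \<Sum>i\<in>J. (x i)\<^sup>2)
    = density lborel (\<lambda>u. C * ennreal (real (card J) / 2 * pos_powr (real (card J) / 2 - 1) u))"
proof -
  let ?d = "real (card J) / 2"
  let ?P = "\<Pi>\<^sub>M i\<in>J. (lborel :: real measure)"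
  have d: "?d > 0" using J by (simp add: card_gt_0_iff)
  obtain C where C: "C < \<infinity>" "\<And>s. (\<integral>\<^sup>+x. ennreal (pos_powr 0 (s - (\<Sum>i\<in>J. (x i)\<^sup>2))) \<partial>?P) = C * ennreal (pos_powr ?d s)"
    using nn_integral_PiM_pos_powr[OF J(1), of 0] by auto
  let ?M = "distr ?P borel (\<lambda>x. \<Sum>i\<in>J. (x i)\<^sup>2)"
  let ?N = "density lborel (\<lambda>u. C * ennreal (?d * pos_powr (?d - 1) u))"
  have M: "emeasure ?M {..<s} = C * ennreal (pos_powr ?d s)" for s
  proof -
    have "emeasure ?M {..<s} = (\<integral>\<^sup>+u. indicator {..<s} u \<partial>?M)" by (simp add: nn_integral_indicator)
    also have "\<dots> = (\<integral>\<^sup>+x. indicator {..<s} (\<Sum>i\<in>J. (x i)\<^sup>2) \<partial>?P)"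
      by (rule nn_integral_distr) auto
    also have "\<dots> = (\<integral>\<^sup>+x. ennreal (pos_powr 0 (s - (\<Sum>i\<in>J. (x i)\<^sup>2))) \<partial>?P)"
      by (intro nn_integral_cong) (auto simp: pos_powr_def split: split_indicator)
    finally show ?thesis by (simp add: C)
  qed
  have N: "emeasure ?N {..<s} = C * ennreal (pos_powr ?d s)" for s
  proof -
    have "emeasure ?N {..<s} = (\<integral>\<^sup>+u. C * (ennreal (?d * pos_powr (?d - 1) u) * indicator {..<s} u) \<partial>lborel)"
      by (subst emeasure_density) (auto simp: mult.assoc)
    also have "\<dots> = C * ennreal (pos_powr ?d s)"
      by (subst nn_integral_cmult, measurable) (simp only: nn_integral_pos_powr_lessThan[OF d])
    finally show ?thesis .
  qed
  have "?M = ?N"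
  proof (rule measure_eqI_generator_eq[where E = "range lessThan" and \<Omega> = UNIV and A = "\<lambda>n. {..<real n}"])
    show "Int_stable (range (lessThan :: real \<Rightarrow> real set))"
    proof (rule Int_stableI_image)
      show "\<exists>c\<in>UNIV. {..<a} \<inter> {..<b} = {..<c}" for a b :: real
        by (rule bexI[of _ "min a b"]) auto
    qed
    show "sets ?M = sigma_sets UNIV (range lessThan)" "sets ?N = sigma_sets UNIV (range lessThan)"
      by (simp_all add: borel_Iio)
    show "(\<Union>n. {..<real n}) = UNIV" using reals_Archimedean2 by auto
    show "emeasure ?M {..<real n} \<noteq> \<infinity>" for n using C by (simp add: M ennreal_mult_eq_top_iff)
    show "emeasure ?M X = emeasure ?N X" if "X \<in> range lessThan" for X
    proof -
      from that obtain s where "X = {..<s}" by blast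
      then show ?thesis by (simp only: M N)
    qed
  qed auto
  then show ?thesis by blast
qed

text \<open>Fubini integrates out the coordinates outside \<open>B\<close>, which raises the
  exponent \<kappa> - 1 by half their number; those in \<open>B\<close> enter only through their sum
  of squares, with density proportional to u^(card B / 2 - 1). \<open>C\<close> may be any extended
  constant here; total mass determines it in the application.\<close>

lemma nn_integral_radial_projection:
  fixes B :: "'a::euclidean_space set"
  assumes B: "B \<subseteq> Basis" "B \<noteq> {}"
  shows "\<exists>C. \<forall>\<phi>. \<phi> \<in> borel_measurable borel \<longrightarrow>
    (\<integral>\<^sup>+x. \<phi> (\<Sum>b\<in>B. (x \<bullet> b)\<^sup>2) * ennreal (pos_powr (\<kappa> - 1) (1 - (norm (x::'a))\<^sup>2)) \<partial>lborel)
      = C * (\<integral>\<^sup>+u. \<phi> u * ennreal (beta_weight (real (card B) / 2) (\<kappa> + real (DIM('a) - card B) / 2) u) \<partial>lborel)"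
proof -
  have fin: "finite B" by (rule finite_subset[OF B(1) finite_Basis])
  let ?d = "real (card B) / 2" and ?q = "\<kappa> - 1 + real (card (Basis - B)) / 2"
  let ?P = "\<lambda>J. \<Pi>\<^sub>M i\<in>J. (lborel :: real measure)"
  have d: "?d > 0" using B fin by (simp add: card_gt_0_iff)
  have q: "\<kappa> + real (DIM('a) - card B) / 2 - 1 = ?q"
    using B fin by (simp add: card_Diff_subset)
  obtain C1 where "(\<kappa> - 1 \<ge> 0 \<longrightarrow> C1 < \<infinity>) \<and>
      (\<forall>s. (\<integral>\<^sup>+x. ennreal (pos_powr (\<kappa> - 1) (s - (\<Sum>i\<in>Basis - B. (x i)\<^sup>2))) \<partial>?P (Basis - B)) = C1 * ennreal (pos_powr ?q s))"
    using nn_integral_PiM_pos_powr[OF finite_Diff[OF finite_Basis]] by (rule exE)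
  then have C1: "(\<integral>\<^sup>+x. ennreal (pos_powr (\<kappa> - 1) (s - (\<Sum>i\<in>Basis - B. (x i)\<^sup>2))) \<partial>?P (Basis - B)) = C1 * ennreal (pos_powr ?q s)" for s
    by (rule conjunct2[THEN spec])
  obtain C2 where C2: "distr (?P B) borel (\<lambda>x. \<Sum>i\<in>B. (x i)\<^sup>2) = density lborel (\<lambda>u. C2 * ennreal (?d * pos_powr (?d - 1) u))"
    using distr_PiM_sum_squares[OF fin B(2)] by (rule exE)
  show ?thesis
  proof (intro exI[of _ "C1 * C2 * ennreal ?d"] allI impI)
    fix \<phi> :: "real \<Rightarrow> ennreal" assume [measurable]: "\<phi> \<in> borel_measurable borel"
    let ?s = "\<lambda>J x. \<Sum>i\<in>J. (x i)\<^sup>2 :: real"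
    have coord: "(\<Sum>b\<in>Basis. x b *\<^sub>R b) \<bullet> c = x c" if "c \<in> Basis" for x and c :: 'a
      using that by (simp add: inner_sum_left inner_Basis if_distrib sum.delta cong: if_cong)
    have "(\<integral>\<^sup>+x. \<phi> (\<Sum>b\<in>B. (x \<bullet> b)\<^sup>2) * ennreal (pos_powr (\<kappa> - 1) (1 - (norm (x::'a))\<^sup>2)) \<partial>lborel)
        = (\<integral>\<^sup>+x. \<phi> (?s B x) * ennreal (pos_powr (\<kappa> - 1) (1 - ?s Basis x)) \<partial>?P Basis)"
    proof (subst lborel_eq, subst nn_integral_distr)
      have "(\<Sum>b\<in>B. ((\<Sum>b\<in>Basis. x b *\<^sub>R b) \<bullet> b)\<^sup>2) = ?s B x" for x
        using B by (intro sum.cong) (auto simp: coord)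
      moreover have "(norm (\<Sum>b\<in>Basis. x b *\<^sub>R b :: 'a))\<^sup>2 = ?s Basis x" for x
        unfolding power2_norm_eq_inner by (subst euclidean_inner) (simp add: coord power2_eq_square)
      ultimately show "(\<integral>\<^sup>+x. \<phi> (\<Sum>b\<in>B. ((\<Sum>b\<in>Basis. x b *\<^sub>R b) \<bullet> b)\<^sup>2) * ennreal (pos_powr (\<kappa> - 1) (1 - (norm (\<Sum>b\<in>Basis. x b *\<^sub>R b :: 'a))\<^sup>2)) \<partial>?P Basis)
          = (\<integral>\<^sup>+x. \<phi> (?s B x) * ennreal (pos_powr (\<kappa> - 1) (1 - ?s Basis x)) \<partial>?P Basis)"
        by simp
    qed auto
    also have "\<dots> = (\<integral>\<^sup>+x. \<phi> (?s B x) * ennreal (pos_powr (\<kappa> - 1) (1 - ?s Basis x)) \<partial>?P (B \<union> (Basis - B)))"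
      using B by (simp add: Un_absorb1)
    also have "\<dots> = (\<integral>\<^sup>+x. (\<integral>\<^sup>+y. \<phi> (?s B (merge B (Basis - B) (x, y))) * ennreal (pos_powr (\<kappa> - 1) (1 - ?s Basis (merge B (Basis - B) (x, y)))) \<partial>?P (Basis - B)) \<partial>?P B)"
    proof (rule lborel_product.product_nn_integral_fold)
      have *: "B \<union> (Basis - B) = Basis" using B by auto
      have "(\<lambda>x. ?s B x) \<in> borel_measurable (?P Basis)"
        using B by (intro borel_measurable_sum borel_measurable_power measurable_component_singleton) auto
      then show "(\<lambda>x. \<phi> (?s B x) * ennreal (pos_powr (\<kappa> - 1) (1 - ?s Basis x))) \<in> borel_measurable (?P (B \<union> (Basis - B)))"
        unfolding * by measurable
    qed (use fin in auto)
    also have "\<dots> = (\<integral>\<^sup>+x. \<phi> (?s B x) * (C1 * ennreal (pos_powr ?q (1 - ?s B x))) \<partial>?P B)"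
    proof (rule nn_integral_cong)
      fix x :: "'a \<Rightarrow> real"
      have 1: "?s B (merge B (Basis - B) (x, y)) = ?s B x" for y by (intro sum.cong) (auto simp: merge_def)
      have "?s Basis (merge B (Basis - B) (x, y)) = ?s B x + ?s (Basis - B) y" for y
      proof -
        have "?s Basis (merge B (Basis - B) (x, y)) = ?s B (merge B (Basis - B) (x, y)) + ?s (Basis - B) (merge B (Basis - B) (x, y))"
          by (subst sum.subset_diff[OF B(1) finite_Basis]) (rule add.commute)
        also have "?s (Basis - B) (merge B (Basis - B) (x, y)) = ?s (Basis - B) y"
          by (intro sum.cong) (auto simp: merge_def)
        finally show ?thesis by (simp add: 1)
      qed
      then have 2: "1 - ?s Basis (merge B (Basis - B) (x, y)) = (1 - ?s B x) - ?s (Basis - B) y" for y by simp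
      show "(\<integral>\<^sup>+y. \<phi> (?s B (merge B (Basis - B) (x, y))) * ennreal (pos_powr (\<kappa> - 1) (1 - ?s Basis (merge B (Basis - B) (x, y)))) \<partial>?P (Basis - B))
          = \<phi> (?s B x) * (C1 * ennreal (pos_powr ?q (1 - ?s B x)))"
        unfolding 1 2 by (subst nn_integral_cmult) (auto simp: C1)
    qed
    also have "\<dots> = (\<integral>\<^sup>+u. \<phi> u * (C1 * ennreal (pos_powr ?q (1 - u))) \<partial>distr (?P B) borel (?s B))"
      by (subst nn_integral_distr) auto
    also have "\<dots> = (\<integral>\<^sup>+u. C2 * ennreal (?d * pos_powr (?d - 1) u) * (\<phi> u * (C1 * ennreal (pos_powr ?q (1 - u)))) \<partial>lborel)"
      unfolding C2 by (rule nn_integral_density) auto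
    also have "\<dots> = (\<integral>\<^sup>+u. (C1 * C2 * ennreal ?d) * (\<phi> u * ennreal (beta_weight ?d (\<kappa> + real (DIM('a) - card B) / 2) u)) \<partial>lborel)"
    proof (rule nn_integral_cong_AE)
      show "AE u in lborel. C2 * ennreal (?d * pos_powr (?d - 1) u) * (\<phi> u * (C1 * ennreal (pos_powr ?q (1 - u))))
          = (C1 * C2 * ennreal ?d) * (\<phi> u * ennreal (beta_weight ?d (\<kappa> + real (DIM('a) - card B) / 2) u))"
        using AE_lborel_singleton[of 0] AE_lborel_singleton[of 1]
      proof eventually_elim
        case (elim u)
        have "pos_powr (?d - 1) u * pos_powr ?q (1 - u) = beta_weight ?d (\<kappa> + real (DIM('a) - card B) / 2) u"
          unfolding beta_weight_def q using elim by (auto simp: pos_powr_def split: split_indicator)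
        then have "ennreal (beta_weight ?d (\<kappa> + real (DIM('a) - card B) / 2) u) = ennreal (pos_powr (?d - 1) u) * ennreal (pos_powr ?q (1 - u))"
          by (simp flip: ennreal_mult)
        moreover have "ennreal (?d * pos_powr (?d - 1) u) = ennreal ?d * ennreal (pos_powr (?d - 1) u)"
          by (rule ennreal_mult) auto
        ultimately show ?case by (simp only: mult_ac)
      qed
    qed
    also have "\<dots> = (C1 * C2 * ennreal ?d) * (\<integral>\<^sup>+u. \<phi> u * ennreal (beta_weight ?d (\<kappa> + real (DIM('a) - card B) / 2) u) \<partial>lborel)"
      by (rule nn_integral_cmult) auto
    finally show "(\<integral>\<^sup>+x. \<phi> (\<Sum>b\<in>B. (x \<bullet> b)\<^sup>2) * ennreal (pos_powr (\<kappa> - 1) (1 - (norm (x::'a))\<^sup>2)) \<partial>lborel)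
      = (C1 * C2 * ennreal ?d) * (\<integral>\<^sup>+u. \<phi> u * ennreal (beta_weight ?d (\<kappa> + real (DIM('a) - card B) / 2) u) \<partial>lborel)" .
  qed
qed

section \<open>A row applied to a unit vector as an orthogonal projection\<close>

text \<open>Polarisation of norm (a * z) = norm a * norm z.\<close>

lemma inner_mult_right_div_algebra:
  fixes a b z :: "'k::{real_normed_div_algebra,euclidean_space}"
  shows "(a * z) \<bullet> (b * z) = (norm z)\<^sup>2 * (a \<bullet> b)"
proof -
  have "norm (a * z + b * z) = norm (a + b) * norm z"
    by (simp add: distrib_right[symmetric] norm_mult)
  then show ?thesis
    by (simp add: dot_norm norm_mult power_mult_distrib field_simps)
qed

text \<open>In the real, complex and quaternionic case this is conjugation.\<close>

definition star :: "'k::{real_normed_div_algebra,euclidean_space} \<Rightarrow> 'k" where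
  "star z = (norm z)\<^sup>2 *\<^sub>R inverse z"

lemma norm_star [simp]: "norm (star z) = norm z"
  by (cases "z = 0") (simp_all add: star_def norm_inverse power2_eq_square)

text \<open>Write u as (u * inverse z) * z and cancel the common right factor z by
  \<open>inner_mult_right_div_algebra\<close>; so \<open>star z\<close> stands for the adjoint of
  right multiplication.\<close>

lemma inner_mult_star:
  fixes u b z :: "'k::{real_normed_div_algebra,euclidean_space}"
  shows "(u * star z) \<bullet> b = u \<bullet> (b * z)"
proof (cases "z = 0")
  case False
  have "u \<bullet> (b * z) = ((u * inverse z) * z) \<bullet> (b * z)" using False by (simp add: mult.assoc)
  also have "\<dots> = (norm z)\<^sup>2 * ((u * inverse z) \<bullet> b)" by (rule inner_mult_right_div_algebra)
  finally show ?thesis by (simp add: star_def)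
qed (simp add: star_def)

definition row_apply :: "('k::{real_normed_div_algebra,euclidean_space})^'n \<Rightarrow> 'k^'n \<Rightarrow> 'k" where
  "row_apply x y = (\<Sum>j\<in>UNIV. x $ j * y $ j)"

lemma measurable_row_apply [measurable]: "(\<lambda>x. row_apply x y) \<in> borel_measurable borel"
  unfolding row_apply_def by (intro borel_measurable_continuous_onI continuous_intros)

definition row_adjoint :: "('k::{real_normed_div_algebra,euclidean_space})^'n \<Rightarrow> 'k \<Rightarrow> 'k^'n" where
  "row_adjoint y u = (\<chi> j. u * star (y $ j))"

lemma inner_row_adjoint: "x \<bullet> row_adjoint y u = row_apply x y \<bullet> u"
proof -
  have "x $ j \<bullet> (u * star (y $ j)) = (x $ j * y $ j) \<bullet> u" for j
    by (metis inner_commute inner_mult_star)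
  then show ?thesis by (simp add: inner_vec_def row_adjoint_def row_apply_def inner_sum_left)
qed

lemma inner_row_adjoint_row_adjoint: "row_adjoint y u \<bullet> row_adjoint y v = (norm y)\<^sup>2 * (u \<bullet> v)"
proof -
  have "row_adjoint y u \<bullet> row_adjoint y v = (\<Sum>j\<in>UNIV. (norm (y $ j))\<^sup>2 * (u \<bullet> v))"
    by (simp add: inner_vec_def row_adjoint_def inner_mult_right_div_algebra)
  also have "\<dots> = (norm y)\<^sup>2 * (u \<bullet> v)"
    by (simp add: power2_norm_eq_inner inner_vec_def sum_distrib_right)
  finally show ?thesis .
qed

text \<open>For a unit vector \<open>y\<close> the map \<open>row_adjoint y\<close> embeds
  \<open>'k\<close> isometrically. The images of its basis are orthonormal, and the inner products
  of \<open>x\<close> with them are the real components of \<open>row_apply x y\<close>; an isometry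
  moves them to standard basis vectors.\<close>

lemma norm_row_apply_isometry:
  fixes y :: "('k::{real_normed_div_algebra,euclidean_space})^'n"
  assumes y: "norm y = 1"
  obtains B f where "B \<subseteq> Basis" "card B = DIM('k)" "linear f" "\<forall>x::'k^'n. norm (f x :: 'k^'n) = norm x"
    "\<forall>x. (norm (row_apply x y))\<^sup>2 = (\<Sum>b\<in>B. (f x \<bullet> b)\<^sup>2)"
proof -
  let ?E = "row_adjoint y ` (Basis :: 'k set)"
  have ip: "row_adjoint y u \<bullet> row_adjoint y v = u \<bullet> v" for u v
    using inner_row_adjoint_row_adjoint[of y u v] y by simp
  have nrm: "norm (row_adjoint y u) = norm u" for u by (simp add: norm_eq_sqrt_inner ip)
  have inj: "inj_on (row_adjoint y) (Basis :: 'k set)"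
  proof (rule inj_onI, rule ccontr)
    fix u v :: 'k assume uv: "u \<in> Basis" "v \<in> Basis" "row_adjoint y u = row_adjoint y v" "u \<noteq> v"
    have "row_adjoint y u \<bullet> row_adjoint y v = 0" "row_adjoint y v \<bullet> row_adjoint y v = 1"
      using uv(1,2,4) by (simp_all only: ip inner_Basis) simp_all
    then show False using uv(3) by simp
  qed
  have "pairwise orthogonal ?E"
    by (rule pairwise_imageI) (auto simp: orthogonal_def ip inner_Basis)
  moreover have "norm e = 1" if "e \<in> ?E" for e using that by (auto simp: nrm)
  ultimately obtain B f where Bf: "B \<subseteq> Basis" "card B = card ?E" "linear f" "\<forall>x::'k^'n. norm (f x :: 'k^'n) = norm x"
    "\<forall>x. (\<Sum>e\<in>?E. (x \<bullet> e)\<^sup>2) = (\<Sum>b\<in>B. (f x \<bullet> b)\<^sup>2)"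
    by (rule orthonormal_extension_isometry) (assumption | rule that)+
  show ?thesis
  proof (rule that[OF Bf(1) _ Bf(3,4)])
    show "card B = DIM('k)" using Bf(2) card_image[OF inj] by simp
    show "\<forall>x. (norm (row_apply x y))\<^sup>2 = (\<Sum>b\<in>B. (f x \<bullet> b)\<^sup>2)"
    proof
      fix x :: "'k^'n"
      have "(norm (row_apply x y))\<^sup>2 = (\<Sum>b\<in>Basis. (row_apply x y \<bullet> b)\<^sup>2)"
        unfolding power2_norm_eq_inner by (subst euclidean_inner) (simp add: power2_eq_square)
      also have "\<dots> = (\<Sum>e\<in>?E. (x \<bullet> e)\<^sup>2)"
        by (simp add: sum.reindex[OF inj] inner_row_adjoint)
      finally show "(norm (row_apply x y))\<^sup>2 = (\<Sum>b\<in>B. (f x \<bullet> b)\<^sup>2)" by (simp add: Bf(5))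
    qed
  qed
qed

lemma emeasure_beta_law:
  assumes "a > 0" "c > 0" and [measurable]: "A \<in> sets borel"
  shows "emeasure (beta_law a c) A = ennreal (inverse (Beta a c)) * (\<integral>\<^sup>+u. indicator A u * ennreal (beta_weight a c u) \<partial>lborel)"
proof -
  have "ennreal (beta_weight a c u / Beta a c) = ennreal (inverse (Beta a c)) * ennreal (beta_weight a c u)" for u
    unfolding divide_inverse mult.commute[of "beta_weight a c u"]
    using Beta_real_pos[OF assms(1,2)] by (intro ennreal_mult) auto
  then have "emeasure (beta_law a c) A = (\<integral>\<^sup>+u. ennreal (inverse (Beta a c)) * (indicator A u * ennreal (beta_weight a c u)) \<partial>lborel)"
    unfolding beta_law_def by (subst emeasure_density) (auto simp: mult_ac)
  also have "\<dots> = ennreal (inverse (Beta a c)) * (\<integral>\<^sup>+u. indicator A u * ennreal (beta_weight a c u) \<partial>lborel)"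
    by (rule nn_integral_cmult) measurable
  finally show ?thesis .
qed

text \<open>The density depends on |x| only and Lebesgue measure is invariant under the isometry
  \<open>f\<close>, so a sum of \<beta> squared coordinates may replace |x y|^2. The second
  parameter arises as \<beta>\<nu>/2 + (\<beta>N - \<beta>)/2, and the constant follows from both
  sides having mass 1.\<close>

lemma distr_norm_row_apply:
  fixes y :: "('k::{real_normed_div_algebra,euclidean_space})^'n" and X :: "'w \<Rightarrow> 'k^'n"
  assumes y: "norm y = 1" and \<beta>: "\<beta> = DIM('k)" and \<nu>: "\<nu> > 0"
    and "prob_space M" and X: "distributed M lborel X (\<lambda>x. ennreal (beta_I_density \<beta> \<nu> x))"
  shows "distr M borel (\<lambda>\<omega>. (norm (row_apply (X \<omega>) y))\<^sup>2)
    = beta_law (real \<beta> / 2) (real \<beta> * (real CARD('n) + \<nu> - 1) / 2)"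
proof -
  interpret prob_space M by fact
  let ?a = "real \<beta> / 2" and ?c = "real \<beta> * (real CARD('n) + \<nu> - 1) / 2"
  define \<kappa> where "\<kappa> = real \<beta> * \<nu> / 2"
  have [measurable]: "X \<in> borel_measurable M" using distributed_measurable[OF X] by simp
  have \<beta>0: "\<beta> > 0" using \<beta> by simp
  have N: "real CARD('n) \<ge> 1" by (simp add: Suc_leI)
  have ac: "?a > 0" "?c > 0"   proof -
    have "real CARD('n) + \<nu> - 1 > 0" using N \<nu> by linarith
    then have "real \<beta> * (real CARD('n) + \<nu> - 1) > 0" using \<beta>0 by (intro mult_pos_pos) auto
    then show "?a > 0" "?c > 0" using \<beta>0 by auto
  qed
  obtain B f where Bf: "B \<subseteq> Basis" "card B = DIM('k)" "linear f" "\<forall>x::'k^'n. norm (f x :: 'k^'n) = norm x"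
    "\<forall>x. (norm (row_apply x y))\<^sup>2 = (\<Sum>b\<in>B. (f x \<bullet> b)\<^sup>2)"
    by (rule norm_row_apply_isometry[OF y]) (rule that)
  have [measurable]: "f \<in> borel_measurable borel"
    by (intro borel_measurable_continuous_onI linear_continuous_on linear_conv_bounded_linear[THEN iffD1] Bf)
  have "B \<noteq> {}" using Bf(2) by force
  have "\<exists>C. \<forall>\<phi>. \<phi> \<in> borel_measurable borel \<longrightarrow>
      (\<integral>\<^sup>+x. \<phi> (\<Sum>b\<in>B. (x \<bullet> b)\<^sup>2) * ennreal (pos_powr (\<kappa> - 1) (1 - (norm (x::'k^'n))\<^sup>2)) \<partial>lborel)
      = C * (\<integral>\<^sup>+u. \<phi> u * ennreal (beta_weight (real (card B) / 2) (\<kappa> + real (DIM('k^'n) - card B) / 2) u) \<partial>lborel)"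
    by (rule nn_integral_radial_projection[OF Bf(1) \<open>B \<noteq> {}\<close>])
  then obtain C where C: "\<forall>\<phi>. \<phi> \<in> borel_measurable borel \<longrightarrow>
      (\<integral>\<^sup>+x. \<phi> (\<Sum>b\<in>B. (x \<bullet> b)\<^sup>2) * ennreal (pos_powr (\<kappa> - 1) (1 - (norm (x::'k^'n))\<^sup>2)) \<partial>lborel)
      = C * (\<integral>\<^sup>+u. \<phi> u * ennreal (beta_weight (real (card B) / 2) (\<kappa> + real (DIM('k^'n) - card B) / 2) u) \<partial>lborel)"
    by (rule exE)
  have par: "real (card B) / 2 = ?a" "\<kappa> + real (DIM('k^'n) - card B) / 2 = ?c"
  proof -
    show "real (card B) / 2 = ?a" using Bf(2) \<beta> by simp
    have "real (DIM('k^'n) - card B) = real CARD('n) * real \<beta> - real \<beta>"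
      using Bf(2) \<beta> by (simp add: of_nat_diff Suc_leI)
    then show "\<kappa> + real (DIM('k^'n) - card B) / 2 = ?c" by (simp add: \<kappa>_def field_simps)
  qed
  define c0 where "c0 = pi powr - (real \<beta> * real CARD('n) / 2) * rising (real \<beta> * \<nu> / 2) (real \<beta> * real CARD('n) / 2)"
  have dens: "ennreal (beta_I_density \<beta> \<nu> x) = ennreal c0 * ennreal (pos_powr (\<kappa> - 1) (1 - (norm x)\<^sup>2))" for x :: "'k^'n"
  proof -
    have "1 - (norm x)\<^sup>2 > 0 \<longleftrightarrow> norm x < 1"
      using abs_square_less_1[of "norm x"] by auto
    then have "beta_I_density \<beta> \<nu> x = c0 * pos_powr (\<kappa> - 1) (1 - (norm x)\<^sup>2)"
      by (auto simp: beta_I_density_def c0_def pos_powr_def \<kappa>_def indicator_def)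
    then show ?thesis by (simp add: ennreal_mult'')
  qed
  let ?D = "distr M borel (\<lambda>\<omega>. (norm (row_apply (X \<omega>) y))\<^sup>2)"
  have em: "emeasure ?D A = ennreal c0 * C * (\<integral>\<^sup>+u. indicator A u * ennreal (beta_weight ?a ?c u) \<partial>lborel)"
    if [measurable]: "A \<in> sets borel" for A
  proof -
    let ?h = "\<lambda>x. indicator A (\<Sum>b\<in>B. (x \<bullet> b)\<^sup>2) * ennreal (pos_powr (\<kappa> - 1) (1 - (norm (x::'k^'n))\<^sup>2))"
    have "emeasure ?D A = (\<integral>\<^sup>+u. indicator A u \<partial>?D)" by simp
    also have "\<dots> = (\<integral>\<^sup>+\<omega>. indicator A ((norm (row_apply (X \<omega>) y))\<^sup>2) \<partial>M)"
      by (rule nn_integral_distr) measurable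
    also have "\<dots> = (\<integral>\<^sup>+x. ennreal (beta_I_density \<beta> \<nu> x) * indicator A ((norm (row_apply x y))\<^sup>2) \<partial>lborel)"
      by (rule distributed_nn_integral[OF X, symmetric]) measurable
    also have "\<dots> = (\<integral>\<^sup>+x. ennreal c0 * ?h (f x) \<partial>lborel)"
      by (simp add: dens Bf(4)[rule_format] Bf(5)[rule_format] mult_ac)
    also have "\<dots> = ennreal c0 * (\<integral>\<^sup>+x. ?h (f x) \<partial>lborel)"
      by (rule nn_integral_cmult) measurable
    also have "(\<integral>\<^sup>+x. ?h (f x) \<partial>lborel) = (\<integral>\<^sup>+x. ?h x \<partial>distr lborel borel f)"
      by (rule nn_integral_distr[symmetric]) measurable
    also have "distr lborel borel f = lborel"
      by (rule lborel_distr_linear_isometry[OF Bf(3) Bf(4)[rule_format]])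
    also have "(\<integral>\<^sup>+x. ?h x \<partial>lborel) = C * (\<integral>\<^sup>+u. indicator A u * ennreal (beta_weight ?a ?c u) \<partial>lborel)"
      using C[rule_format, of "indicator A"] unfolding par by simp
    finally show ?thesis by (simp add: mult.assoc)
  qed
  have "prob_space ?D" by (rule prob_space_distr) measurable
  then have "emeasure ?D UNIV = 1" using prob_space.emeasure_space_1[of ?D] by simp
  then have K: "ennreal c0 * C * ennreal (Beta ?a ?c) = 1"
    using em[of UNIV] nn_integral_beta_weight[OF ac] by simp
  note Bpos = Beta_real_pos[OF ac]
  have K': "ennreal c0 * C = ennreal (inverse (Beta ?a ?c))"
  proof -
    have inv: "ennreal (Beta ?a ?c) * ennreal (inverse (Beta ?a ?c)) = 1"
      using Bpos by (simp flip: ennreal_mult)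
    have "ennreal c0 * C = ennreal c0 * C * (ennreal (Beta ?a ?c) * ennreal (inverse (Beta ?a ?c)))"
      unfolding inv by simp
    also have "\<dots> = ennreal c0 * C * ennreal (Beta ?a ?c) * ennreal (inverse (Beta ?a ?c))"
      by (rule mult.assoc[symmetric])
    also have "\<dots> = ennreal (inverse (Beta ?a ?c))" unfolding K by simp
    finally show ?thesis .
  qed
  show ?thesis
  proof (rule measure_eqI)
    fix A assume "A \<in> sets ?D"
    then have [measurable]: "A \<in> sets borel" by simp
    show "emeasure ?D A = emeasure (beta_law ?a ?c) A"
      unfolding em[OF \<open>A \<in> sets borel\<close>] K' emeasure_beta_law[OF ac \<open>A \<in> sets borel\<close>] ..
  qed simp
qed

section \<open>Sums of independent beta variables\<close>

lemma abs_exp_minus_1_le: "\<bar>exp x - 1\<bar> \<le> \<bar>x\<bar> * exp \<bar>x\<bar>" for x :: real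
proof (cases "x \<ge> 0")
  case True
  have "1 - x \<le> exp (- x)" using exp_ge_add_one_self[of "- x"] by simp
  then have "exp x * (1 - x) \<le> exp x * exp (- x)" by (intro mult_left_mono) auto
  then have "exp x * (1 - x) \<le> 1" by (simp add: exp_minus)
  then show ?thesis using True by (simp add: algebra_simps)
next
  case False
  have "1 - exp x \<le> - x" using exp_ge_add_one_self[of x] by linarith
  also have "\<dots> \<le> - x * exp (- x)" using False by (simp add: mult_le_cancel_left1)
  finally show ?thesis using False by (simp add: abs_if)
qed

context
  fixes Q :: "real measure" and h :: real
  assumes Q: "prob_space Q" and sets_Q [measurable_cong]: "sets Q = sets borel"
    and pos: "AE s in Q. 0 < s" and h: "h > 0"
    and int: "integrable Q (\<lambda>s. s powr h)" "integrable Q (\<lambda>s. s powr - h)"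
begin

interpretation Q: prob_space Q by (rule Q)

lemma integrable_ln_of_powr: "integrable Q ln"
proof (rule Bochner_Integration.integrable_bound)
  show "integrable Q (\<lambda>s. s powr h / h + s powr - h / h)"
    using int by (intro Bochner_Integration.integrable_add integrable_divide_zero)
  show "AE s in Q. norm (ln s) \<le> norm (s powr h / h + s powr - h / h)"
    using pos
  proof eventually_elim
    case (elim s)
    then show ?case using abs_ln_le_powr[of s h] h by simp
  qed
qed measurable

lemma integrable_powr_of_powr:
  assumes "\<bar>t\<bar> \<le> h"
  shows "integrable Q (\<lambda>s. s powr t)"
proof (rule Bochner_Integration.integrable_bound)
  show "integrable Q (\<lambda>s. s powr h + s powr - h)"
    using int by (rule Bochner_Integration.integrable_add)
  show "AE s in Q. norm (s powr t) \<le> norm (s powr h + s powr - h)"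
    using pos
  proof eventually_elim
    case (elim s)
    have "s powr t \<le> s powr h + s powr - h"
    proof (cases "s \<ge> 1")
      case True
      then have "s powr t \<le> s powr h" using assms by (intro powr_mono) auto
      then show ?thesis by (simp add: add_increasing2)
    next
      case False
      then have "s powr t \<le> s powr - h" using assms elim by (intro powr_mono') auto
      then show ?thesis by (simp add: add_increasing)
    qed
    then show ?case by simp
  qed
qed measurable

text \<open>The derivative of \<open>t \<mapsto> E s\<^sup>t\<close> at \<open>0\<close> is \<open>E ln s\<close>; this makes the exponential moment bound strict.\<close>

lemma powr_moment_less_exp:
  fixes \<sigma> \<delta> :: real
  assumes \<sigma>: "\<bar>\<sigma>\<bar> = 1" and \<delta>: "\<delta> > 0"
  obtains t where "0 < t" "t \<le> h" "(\<integral>s. s powr (\<sigma> * t) \<partial>Q) < exp (t * (\<sigma> * (\<integral>s. ln s \<partial>Q) + \<delta>))"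
proof -
  define L where "L = (\<integral>s. ln s \<partial>Q)"
  \<comment> \<open>Staying below h/2 leaves room: with u = |ln s| the difference quotient is at
    most u e^(tu), the factor u costs another e^(hu/2), and s^h + s^-h still dominates for all
    k.\<close>
  define t where "t = (\<lambda>k. h / 2 / (real k + 1))"
  have t: "t k > 0" "t k \<le> h / 2" for k using h by (auto simp: t_def field_simps)
  have t0: "t \<longlonglongrightarrow> 0" unfolding t_def by real_asymp
  have "(\<lambda>k. \<integral>s. (s powr (\<sigma> * t k) - 1) / t k \<partial>Q) \<longlonglongrightarrow> (\<integral>s. \<sigma> * ln s \<partial>Q)"
  proof (rule integral_dominated_convergence[where w = "\<lambda>s. 2 / h * (s powr h + s powr - h)"])
    show "integrable Q (\<lambda>s. 2 / h * (s powr h + s powr - h))"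
      using int by (intro integrable_mult_right Bochner_Integration.integrable_add)
    show "AE s in Q. (\<lambda>k. (s powr (\<sigma> * t k) - 1) / t k) \<longlonglongrightarrow> \<sigma> * ln s"
      using pos
    proof eventually_elim
      case (elim s)
      have "((\<lambda>x. exp (\<sigma> * ln s * x)) has_real_derivative \<sigma> * ln s) (at 0)"
        by (auto intro!: derivative_eq_intros)
      then have "((\<lambda>x. (exp (\<sigma> * ln s * x) - 1) / x) \<longlongrightarrow> \<sigma> * ln s) (at 0)"
        by (simp add: has_field_derivative_iff)
      moreover have "filterlim t (at 0) sequentially"
        by (intro filterlim_atI t0 always_eventually allI less_imp_neq[OF t(1), symmetric])
      ultimately have "(\<lambda>k. (exp (\<sigma> * ln s * t k) - 1) / t k) \<longlonglongrightarrow> \<sigma> * ln s"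
        by (rule filterlim_compose)
      then show ?case using elim by (simp add: powr_def mult.assoc mult.commute[of _ "ln s"])
    qed
    show "AE s in Q. norm ((s powr (\<sigma> * t k) - 1) / t k) \<le> 2 / h * (s powr h + s powr - h)" for k
      using pos
    proof eventually_elim
      case (elim s)
      define u where "u = \<bar>ln s\<bar>"
      have "\<bar>s powr (\<sigma> * t k) - 1\<bar> \<le> \<bar>\<sigma> * t k * ln s\<bar> * exp \<bar>\<sigma> * t k * ln s\<bar>"
        using elim abs_exp_minus_1_le[of "\<sigma> * t k * ln s"] by (simp add: powr_def)
      also have "\<bar>\<sigma> * t k * ln s\<bar> = t k * u" using \<sigma> t(1)[of k] by (simp add: abs_mult u_def)
      finally have "\<bar>s powr (\<sigma> * t k) - 1\<bar> / t k \<le> u * exp (t k * u)"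
        using t(1)[of k] by (simp add: field_simps)
      also have "\<dots> \<le> (2 / h * exp (h / 2 * u)) * exp (h / 2 * u)"
      proof (rule mult_mono)
        have "h / 2 * u \<le> exp (h / 2 * u)" using exp_ge_add_one_self[of "h / 2 * u"] by linarith
        then show "u \<le> 2 / h * exp (h / 2 * u)" using h by (simp add: field_simps)
        show "exp (t k * u) \<le> exp (h / 2 * u)" unfolding exp_le_cancel_iff using t(2)[of k] by (intro mult_right_mono) (auto simp: u_def)
      qed (use h in \<open>auto simp: u_def\<close>)
      also have "\<dots> = 2 / h * exp (h * u)" by (simp flip: exp_add)
      also have "\<dots> \<le> 2 / h * (s powr h + s powr - h)"
      proof (rule mult_left_mono)
        have "exp (h * u) = s powr h \<or> exp (h * u) = s powr - h"
          using elim by (auto simp: u_def powr_def abs_if)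
        then show "exp (h * u) \<le> s powr h + s powr - h" by auto
      qed (use h in auto)
      finally show ?case using t(1)[of k] by simp
    qed
  qed measurable
  then have "(\<lambda>k. \<integral>s. (s powr (\<sigma> * t k) - 1) / t k \<partial>Q) \<longlonglongrightarrow> \<sigma> * L" by (simp add: L_def)
  then have "\<forall>\<^sub>F k in sequentially. (\<integral>s. (s powr (\<sigma> * t k) - 1) / t k \<partial>Q) < \<sigma> * L + \<delta>"
    using \<delta> by (intro order_tendstoD(2)) auto
  then obtain k where k: "(\<integral>s. (s powr (\<sigma> * t k) - 1) / t k \<partial>Q) < \<sigma> * L + \<delta>"
    using eventually_happens'[OF sequentially_bot] by blast
  have "\<bar>\<sigma> * t k\<bar> \<le> h" using \<sigma> t[of k] by (simp add: abs_mult)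
  then have "(\<integral>s. (s powr (\<sigma> * t k) - 1) / t k \<partial>Q) = ((\<integral>s. s powr (\<sigma> * t k) \<partial>Q) - 1) / t k"
    using integrable_powr_of_powr by (simp add: Q.prob_space)
  with k t(1)[of k] have "(\<integral>s. s powr (\<sigma> * t k) \<partial>Q) < 1 + t k * (\<sigma> * L + \<delta>)"
    by (simp add: field_simps)
  also have "\<dots> \<le> exp (t k * (\<sigma> * L + \<delta>))" by (rule exp_ge_add_one_self)
  finally show ?thesis using t[of k] h by (intro that[of "t k"]) (auto simp: L_def)
qed

end

section \<open>Law of a sum of independent beta variables\<close>

definition sum_law :: "real \<Rightarrow> ('n::finite \<Rightarrow> real) \<Rightarrow> real measure" where
  "sum_law a c = distr (\<Pi>\<^sub>M l\<in>UNIV. beta_law a (c l)) borel (\<lambda>x. \<Sum>l\<in>UNIV. x l)"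

lemma sets_sum_law [simp, measurable_cong]: "sets (sum_law a c) = sets borel"
  by (simp add: sum_law_def)

context
  fixes a :: real and c :: "'n::finite \<Rightarrow> real"
  assumes a: "a > 0" and c: "\<And>l. c l > 0"
begin

interpretation beta: prob_space "beta_law a (c l)" for l by (rule prob_space_beta_law[OF a c])
interpretation P: product_prob_space "\<lambda>l. beta_law a (c l)" UNIV ..

lemma measurable_sum_PiM: "(\<lambda>x. \<Sum>l\<in>UNIV. x l) \<in> borel_measurable (\<Pi>\<^sub>M l\<in>UNIV. beta_law a (c l))"
  by (intro borel_measurable_sum) (simp add: measurable_cong_sets[OF refl sets_beta_law[symmetric]])

lemma prob_space_sum_law: "prob_space (sum_law a c)"
  unfolding sum_law_def by (rule P.prob_space_distr[OF measurable_sum_PiM])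

lemma AE_PiM_beta_law: "AE x in (\<Pi>\<^sub>M l\<in>UNIV. beta_law a (c l)). \<forall>l. 0 < x l \<and> x l < 1"
proof -
  have "AE x in (\<Pi>\<^sub>M l\<in>UNIV. beta_law a (c l)). 0 < x l \<and> x l < 1" for l
    by (rule AE_PiM_component[where P = "\<lambda>y. 0 < y \<and> y < 1", OF beta.prob_space_axioms UNIV_I AE_beta_law])
  then show ?thesis by (simp add: AE_all_countable)
qed

lemma AE_sum_law: "AE s in sum_law a c. 0 < s \<and> s < real CARD('n)"
  unfolding sum_law_def
proof (subst AE_distr_iff[OF measurable_sum_PiM])
  show "AE x in (\<Pi>\<^sub>M l\<in>UNIV. beta_law a (c l)). 0 < (\<Sum>l\<in>UNIV. x l) \<and> (\<Sum>l\<in>UNIV. x l) < real CARD('n)"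
    using AE_PiM_beta_law
  proof eventually_elim
    case (elim x)
    have "(\<Sum>l\<in>UNIV. x l) < (\<Sum>l\<in>(UNIV::'n set). 1)" using elim by (intro sum_strict_mono) auto
    then show ?case using elim by (auto intro!: sum_pos)
  qed
qed auto

lemma integral_cis_sum_law:
  "(\<integral>s. cis (k * s) \<partial>sum_law a c) = (\<Prod>l\<in>UNIV. \<integral>x. cis (k * x) \<partial>beta_law a (c l))"
proof -
  have m: "(\<lambda>s. cis (k * s)) \<in> borel_measurable borel"
    by (intro borel_measurable_continuous_onI continuous_intros)
  have "(\<integral>s. cis (k * s) \<partial>sum_law a c) = (\<integral>x. cis (k * (\<Sum>l\<in>UNIV. x l)) \<partial>(\<Pi>\<^sub>M l\<in>UNIV. beta_law a (c l)))"
    unfolding sum_law_def by (rule integral_distr[OF measurable_sum_PiM m])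
  also have "\<dots> = (\<integral>x. (\<Prod>l\<in>UNIV. cis (k * x l)) \<partial>(\<Pi>\<^sub>M l\<in>UNIV. beta_law a (c l)))"
    by (simp add: cis_conv_exp sum_distrib_left exp_sum)
  also have "\<dots> = (\<Prod>l\<in>UNIV. \<integral>x. cis (k * x) \<partial>beta_law a (c l))"
  proof (rule P.product_integral_prod)
    show "integrable (beta_law a (c l)) (\<lambda>x. cis (k * x))" for l
      using m by (intro beta.integrable_const_bound[where B = 1]) (auto simp: measurable_cong_sets[OF sets_beta_law refl])
  qed auto
  finally show ?thesis .
qed

text \<open>The positive power is bounded because the sum stays below N. For the negative one the
  sum is bounded below by a single summand, whose inverse moment of order a/2 is finite.\<close>

lemma integrable_powr_sum_law: "integrable (sum_law a c) (\<lambda>s. s powr (a / 2))"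
  "integrable (sum_law a c) (\<lambda>s. s powr - (a / 2))"
proof -
  interpret Q: prob_space "sum_law a c" by (rule prob_space_sum_law)
  show "integrable (sum_law a c) (\<lambda>s. s powr (a / 2))"
  proof (rule Q.integrable_const_bound[where B = "real CARD('n) powr (a / 2)"])
    show "AE s in sum_law a c. norm (s powr (a / 2)) \<le> real CARD('n) powr (a / 2)"
      using AE_sum_law by eventually_elim (use a in \<open>auto intro!: powr_mono2\<close>)
  qed measurable
  fix l :: 'n
  have "integrable (beta_law a (c l)) (\<lambda>x. x powr - (a / 2))"
    using has_bochner_integral_beta_law_powr[of a "c l" "- (a/2)" 0] a c[of l]
    by (subst integrable_cong_AE[where g = "\<lambda>x. x powr - (a / 2) * (1 - x) powr 0"])
       (use AE_beta_law[of a "c l"] in \<open>auto simp: has_bochner_integral_iff elim: eventually_mono\<close>)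
  then have "integrable (distr (\<Pi>\<^sub>M l\<in>UNIV. beta_law a (c l)) (beta_law a (c l)) (\<lambda>x. x l)) (\<lambda>x. x powr - (a / 2))"
    by (simp add: P.PiM_component)
  then have i: "integrable (\<Pi>\<^sub>M l\<in>UNIV. beta_law a (c l)) (\<lambda>x. x l powr - (a / 2))"
    by (subst (asm) integrable_distr_eq) auto
  have "integrable (\<Pi>\<^sub>M l\<in>UNIV. beta_law a (c l)) (\<lambda>x. (\<Sum>l\<in>UNIV. x l) powr - (a / 2))"
  proof (rule Bochner_Integration.integrable_bound[OF i])
    show "AE x in \<Pi>\<^sub>M l\<in>UNIV. beta_law a (c l). norm ((\<Sum>l\<in>UNIV. x l) powr - (a / 2)) \<le> norm (x l powr - (a / 2))"
      using AE_PiM_beta_law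
    proof eventually_elim
      case (elim x)
      have "x l \<le> (\<Sum>l\<in>UNIV. x l)" using elim by (intro member_le_sum) (auto intro: less_imp_le)
      then have "(\<Sum>l\<in>UNIV. x l) powr - (a / 2) \<le> x l powr - (a / 2)"
        using elim a by (intro powr_mono2') auto
      then show ?case by simp
    qed
    show "(\<lambda>x. (\<Sum>l\<in>UNIV. x l) powr - (a / 2)) \<in> borel_measurable (\<Pi>\<^sub>M l\<in>UNIV. beta_law a (c l))"
      using measurable_sum_PiM by measurable
  qed
  then show "integrable (sum_law a c) (\<lambda>s. s powr - (a / 2))"
    unfolding sum_law_def by (subst integrable_distr_eq[OF measurable_sum_PiM]) auto
qed

text \<open>The other factors of the product have modulus at most 1, so one row alone supplies the
  decay.\<close>

lemma norm_integral_cis_sum_law_le: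
  "norm (\<integral>s. cis (k * s) \<partial>sum_law a c) \<le> norm (\<integral>x. cis (k * x) \<partial>beta_law a (c l))"
proof -
  have le1: "norm (\<integral>x. cis (k * x) \<partial>beta_law a (c l)) \<le> 1" for l
    using integral_norm_bound[of "beta_law a (c l)" "\<lambda>x. cis (k * x)"] beta.prob_space[of l] by simp
  have "norm (\<integral>s. cis (k * s) \<partial>sum_law a c) = (\<Prod>l\<in>UNIV. norm (\<integral>x. cis (k * x) \<partial>beta_law a (c l)))"
    by (simp add: integral_cis_sum_law prod_norm)
  also have "\<dots> = norm (\<integral>x. cis (k * x) \<partial>beta_law a (c l)) * (\<Prod>l\<in>UNIV - {l}. norm (\<integral>x. cis (k * x) \<partial>beta_law a (c l)))"
    by (rule prod.remove) auto
  also have "\<dots> \<le> norm (\<integral>x. cis (k * x) \<partial>beta_law a (c l)) * 1"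
    using le1 by (intro mult_left_mono prod_le_1) auto
  finally show ?thesis by simp
qed

end

section \<open>Growth of matrix products\<close>

lemma matrix_vector_mult_scaleR:
  fixes A :: "('k::{real_normed_div_algebra,euclidean_space})^'n^'m"
  shows "A *v (c *\<^sub>R y) = c *\<^sub>R (A *v y)"
  by (simp add: matrix_vector_mult_def vec_eq_iff scaleR_sum_right)

lemma matrix_vector_mult_row_apply:
  "(A *v y) $ l = row_apply (A $ l) y"
  by (simp add: matrix_vector_mult_def row_apply_def)

lemma norm_matrix_vector_mult_squared:
  fixes A :: "('k::{real_normed_div_algebra,euclidean_space})^'n^'m"
  shows "(norm (A *v y))\<^sup>2 = (\<Sum>l\<in>UNIV. (norm (row_apply (A $ l) y))\<^sup>2)"
  unfolding power2_norm_eq_inner by (simp add: inner_vec_def matrix_vector_mult_row_apply)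

lemma measurable_matrix_vector_mult [measurable]:
  fixes f :: "'w \<Rightarrow> ('k::{real_normed_div_algebra,euclidean_space})^'n^'m"
  assumes [measurable]: "f \<in> borel_measurable M" "g \<in> borel_measurable M"
  shows "(\<lambda>\<omega>. f \<omega> *v g \<omega>) \<in> borel_measurable M"
proof -
  have "(\<lambda>p. fst p *v snd p :: 'k^'m) \<in> borel_measurable (borel :: (('k^'n^'m) \<times> ('k^'n)) measure)"
    unfolding matrix_vector_mult_def by (intro borel_measurable_continuous_onI continuous_intros)
  then have "(\<lambda>p. fst p *v snd p :: 'k^'m) \<in> borel_measurable ((borel :: ('k^'n^'m) measure) \<Otimes>\<^sub>M (borel :: ('k^'n) measure))"
    by (simp add: borel_prod)
  from measurable_compose[OF measurable_Pair[OF assms] this] show ?thesis by simp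
qed

lemma measurable_matrix_matrix_mult [measurable]:
  fixes f :: "'w \<Rightarrow> ('k::{real_normed_div_algebra,euclidean_space})^'n^'m" and g :: "'w \<Rightarrow> 'k^'p^'n"
  assumes [measurable]: "f \<in> borel_measurable M" "g \<in> borel_measurable M"
  shows "(\<lambda>\<omega>. f \<omega> ** g \<omega>) \<in> borel_measurable M"
proof -
  have "(\<lambda>p. fst p ** snd p :: 'k^'p^'m) \<in> borel_measurable (borel :: (('k^'n^'m) \<times> ('k^'p^'n)) measure)"
    unfolding matrix_matrix_mult_def by (intro borel_measurable_continuous_onI continuous_intros)
  then have "(\<lambda>p. fst p ** snd p :: 'k^'p^'m) \<in> borel_measurable ((borel :: ('k^'n^'m) measure) \<Otimes>\<^sub>M (borel :: ('k^'p^'n) measure))"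
    by (simp add: borel_prod)
  from measurable_compose[OF measurable_Pair[OF assms] this] show ?thesis by simp
qed

lemma measurable_matrix_product:
  assumes "\<And>i. i \<in> {1..m} \<Longrightarrow> (\<lambda>\<omega>. A \<omega> i) \<in> borel_measurable M"
  shows "(\<lambda>\<omega>. matrix_product (A \<omega>) m :: ('k::{real_normed_div_algebra,euclidean_space})^'n^'n) \<in> borel_measurable M"
  using assms by (induction m) (auto intro!: measurable_matrix_matrix_mult)

lemma matrix_product_cong:
  "(\<And>i. i \<in> {1..m} \<Longrightarrow> A i = B i) \<Longrightarrow> matrix_product A m = matrix_product B m"
  by (induction m) auto

text \<open>\<open>A *v y\<close> is the sum of the columns of \<open>A\<close>, each multiplied
  from the right by an entry of \<open>y\<close>. This reduces the growth of all vectors to that of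
  finitely many.\<close>

lemma norm_matrix_vector_mult_le_axis:
  fixes A :: "('k::{real_normed_div_algebra,euclidean_space})^'n^'m"
  shows "norm (A *v y) \<le> (\<Sum>j\<in>UNIV. norm (A *v axis j 1) * norm (y $ j))"
proof -
  have nv: "norm (\<chi> i. v $ i * z) = norm v * norm z" for v :: "'k^'m" and z
    by (simp add: norm_vec_def L2_set_def norm_mult power_mult_distrib sum_distrib_right[symmetric] real_sqrt_mult)
  have "A *v y = (\<Sum>j\<in>UNIV. \<chi> i. (A *v axis j 1) $ i * y $ j)"
    by (simp add: vec_eq_iff matrix_vector_mult_def axis_def if_distrib if_distribR sum.delta cong: if_cong)
  then have "norm (A *v y) \<le> (\<Sum>j\<in>UNIV. norm (\<chi> i. (A *v axis j 1) $ i * y $ j))"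
    by (simp only: norm_sum)
  then show ?thesis by (simp only: nv)
qed

text \<open>Since the law of \<open>(norm (X i \<omega> *v u))\<^sup>2\<close> is the same for all unit vectors \<open>u\<close>, the squared norms of
  \<open>P\<^sub>m y\<close> form a multiplicative random walk, whatever the direction of \<open>y\<close>.\<close>

locale isotropic_matrix_walk =
  fixes M :: "'w measure"
    and X :: "nat \<Rightarrow> 'w \<Rightarrow> ('k::{real_normed_div_algebra,euclidean_space})^'n^'n"
    and Q :: "real measure" and h :: real
  assumes prob_M: "prob_space M"
    and indep: "prob_space.indep_vars M (\<lambda>_. borel) X {1..}"
    and prob_Q: "prob_space Q" and sets_Q [measurable_cong]: "sets Q = sets borel"
    and pos_Q: "AE s in Q. 0 < s" and h: "h > 0"
    and int_Q: "integrable Q (\<lambda>s. s powr h)" "integrable Q (\<lambda>s. s powr - h)"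
    and law: "\<And>i u. i \<ge> 1 \<Longrightarrow> norm u = 1 \<Longrightarrow> distr M borel (\<lambda>\<omega>. (norm (X i \<omega> *v u))\<^sup>2) = Q"
begin

sublocale prob_space M by (rule prob_M)
interpretation Q: prob_space Q by (rule prob_Q)

abbreviation "P m \<omega> \<equiv> matrix_product (\<lambda>i. X i \<omega>) m"

lemma measurable_X [measurable]: "i \<ge> 1 \<Longrightarrow> X i \<in> borel_measurable M"
  using indep by (auto simp: indep_vars_def)

lemma measurable_P [measurable]: "(\<lambda>\<omega>. P m \<omega>) \<in> borel_measurable M"
  by (rule measurable_matrix_product) simp

lemma nn_integral_step:
  assumes [measurable]: "g \<in> borel_measurable borel" and i: "i \<ge> 1"
  shows "(\<integral>\<^sup>+\<omega>. g ((norm (X i \<omega> *v y))\<^sup>2) \<partial>M) = (\<integral>\<^sup>+s. g (s * (norm y)\<^sup>2) \<partial>Q)"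
proof (cases "y = 0")
  case True
  have "X i \<omega> *v 0 = 0" for \<omega> by (simp add: matrix_vector_mult_def vec_eq_iff)
  then show ?thesis using True by (simp add: emeasure_space_1 Q.emeasure_space_1)
next
  case False
  define u where "u = sgn y"
  have u: "norm u = 1" "y = norm y *\<^sub>R u" using False by (simp_all add: u_def norm_sgn sgn_div_norm)
  have [measurable]: "X i \<in> borel_measurable M" by (rule measurable_X[OF i])
  have "norm (X i \<omega> *v y) = norm y * norm (X i \<omega> *v u)" for \<omega>
    by (subst u(2)) (simp add: matrix_vector_mult_scaleR)
  then have "(\<integral>\<^sup>+\<omega>. g ((norm (X i \<omega> *v y))\<^sup>2) \<partial>M) = (\<integral>\<^sup>+\<omega>. g ((norm (X i \<omega> *v u))\<^sup>2 * (norm y)\<^sup>2) \<partial>M)"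
    by (simp add: power_mult_distrib mult.commute)
  also have "\<dots> = (\<integral>\<^sup>+s. g (s * (norm y)\<^sup>2) \<partial>distr M borel (\<lambda>\<omega>. (norm (X i \<omega> *v u))\<^sup>2))"
    by (rule nn_integral_distr[symmetric]) measurable
  finally show ?thesis by (simp add: law[OF i u(1)])
qed

text \<open>\<open>P m\<close> is a function of X 1, ..., X m, hence independent of
  \<open>X (Suc m)\<close>. With the vector \<open>P m \<omega> *v y\<close> frozen, the next
  squared norm is its own squared norm times a variable of law \<open>Q\<close>, in whatever
  direction it points.\<close>

lemma nn_integral_walk:
  assumes [measurable]: "g \<in> borel_measurable borel"
  shows "(\<integral>\<^sup>+\<omega>. g ((norm (P (Suc m) \<omega> *v y))\<^sup>2) \<partial>M) = (\<integral>\<^sup>+\<omega>. (\<integral>\<^sup>+s. g (s * (norm (P m \<omega> *v y))\<^sup>2) \<partial>Q) \<partial>M)"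
proof -
  let ?A = "\<lambda>\<omega>. \<lambda>i\<in>{1..m}. X i \<omega>" and ?B = "\<lambda>\<omega>. \<lambda>i\<in>{Suc m}. X i \<omega>"
  have "indep_var (PiM {1..m} (\<lambda>_. borel)) ?A (PiM {Suc m} (\<lambda>_. borel)) ?B"
    by (rule indep_var_restrict[OF indep]) auto
  then have "indep_var borel ((\<lambda>f. matrix_product f m) \<circ> ?A) borel ((\<lambda>f. f (Suc m)) \<circ> ?B)"
    by (rule indep_var_compose) (auto intro!: measurable_matrix_product)
  moreover have "(\<lambda>f. matrix_product f m) \<circ> ?A = P m"
    by (auto simp: fun_eq_iff intro!: matrix_product_cong)
  moreover have "(\<lambda>f. f (Suc m)) \<circ> ?B = X (Suc m)" by auto
  ultimately have "indep_var borel (P m) borel (X (Suc m))" by simp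
  then have D: "distr M borel (P m) \<Otimes>\<^sub>M distr M borel (X (Suc m)) = distr M (borel \<Otimes>\<^sub>M borel) (\<lambda>\<omega>. (P m \<omega>, X (Suc m) \<omega>))"
    by (simp add: indep_var_distribution_eq)
  have [measurable]: "X (Suc m) \<in> borel_measurable M" by (rule measurable_X) simp
  interpret X: prob_space "distr M borel (X (Suc m))" by (rule prob_space_distr) measurable
  let ?G = "\<lambda>p. g ((norm (snd p *v (fst p *v y)))\<^sup>2)"
  have "(\<integral>\<^sup>+\<omega>. g ((norm (P (Suc m) \<omega> *v y))\<^sup>2) \<partial>M) = (\<integral>\<^sup>+\<omega>. ?G (P m \<omega>, X (Suc m) \<omega>) \<partial>M)"
    by (simp add: matrix_vector_mul_assoc)
  also have "\<dots> = (\<integral>\<^sup>+p. ?G p \<partial>distr M (borel \<Otimes>\<^sub>M borel) (\<lambda>\<omega>. (P m \<omega>, X (Suc m) \<omega>)))"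
    by (rule nn_integral_distr[symmetric]) measurable
  also have "\<dots> = (\<integral>\<^sup>+p. ?G p \<partial>(distr M borel (P m) \<Otimes>\<^sub>M distr M borel (X (Suc m))))"
    by (simp only: D)
  also have "\<dots> = (\<integral>\<^sup>+A. (\<integral>\<^sup>+B. ?G (A, B) \<partial>distr M borel (X (Suc m))) \<partial>distr M borel (P m))"
    by (rule X.nn_integral_fst[symmetric]) measurable
  also have "\<dots> = (\<integral>\<^sup>+A. (\<integral>\<^sup>+s. g (s * (norm (A *v y))\<^sup>2) \<partial>Q) \<partial>distr M borel (P m))"
  proof (rule nn_integral_cong)
    fix A :: "'k^'n^'n"
    have "(\<integral>\<^sup>+B. ?G (A, B) \<partial>distr M borel (X (Suc m))) = (\<integral>\<^sup>+\<omega>. ?G (A, X (Suc m) \<omega>) \<partial>M)"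
      by (rule nn_integral_distr) measurable
    also have "\<dots> = (\<integral>\<^sup>+s. g (s * (norm (A *v y))\<^sup>2) \<partial>Q)"
      using nn_integral_step[of g "Suc m" "A *v y"] by simp
    finally show "(\<integral>\<^sup>+B. ?G (A, B) \<partial>distr M borel (X (Suc m))) = (\<integral>\<^sup>+s. g (s * (norm (A *v y))\<^sup>2) \<partial>Q)" .
  qed
  also have "\<dots> = (\<integral>\<^sup>+\<omega>. (\<integral>\<^sup>+s. g (s * (norm (P m \<omega> *v y))\<^sup>2) \<partial>Q) \<partial>M)"
    by (rule nn_integral_distr) measurable
  finally show ?thesis .
qed

text \<open>\<open>nn_integral_walk\<close> for the indicator of {0}: the factor of law
  \<open>Q\<close> is almost surely positive. This separates genuine logarithms from the default
  \<open>ln 0 = 0\<close>.\<close>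

lemma AE_walk_nonzero:
  assumes "y \<noteq> 0"
  shows "AE \<omega> in M. P m \<omega> *v y \<noteq> 0"
proof (induction m)
  case 0
  then show ?case using assms by (simp add: matrix_vector_mul_lid)
next
  case (Suc m)
  let ?g = "indicator {0::real} :: real \<Rightarrow> ennreal"
  have "(\<integral>\<^sup>+\<omega>. ?g ((norm (P (Suc m) \<omega> *v y))\<^sup>2) \<partial>M) = (\<integral>\<^sup>+\<omega>. (\<integral>\<^sup>+s. ?g (s * (norm (P m \<omega> *v y))\<^sup>2) \<partial>Q) \<partial>M)"
    by (rule nn_integral_walk) measurable
  also have "\<dots> = (\<integral>\<^sup>+\<omega>. 0 \<partial>M)"
  proof (rule nn_integral_cong_AE, use Suc in eventually_elim)
    case (elim \<omega>)
    have "(\<integral>\<^sup>+s. ?g (s * (norm (P m \<omega> *v y))\<^sup>2) \<partial>Q) = (\<integral>\<^sup>+s. 0 \<partial>Q)"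
      by (rule nn_integral_cong_AE, use pos_Q in eventually_elim) (use elim in \<open>auto simp: indicator_def\<close>)
    then show ?case by simp
  qed
  finally have "(\<integral>\<^sup>+\<omega>. ?g ((norm (P (Suc m) \<omega> *v y))\<^sup>2) \<partial>M) = 0" by simp
  then have "AE \<omega> in M. ?g ((norm (P (Suc m) \<omega> *v y))\<^sup>2) = 0"
    by (subst (asm) nn_integral_0_iff_AE) auto
  then show ?case by eventually_elim (auto simp: indicator_def split: if_splits)
qed

text \<open>Powers are multiplicative, so each step contributes the same moment of \<open>Q\<close>.
  The convention \<open>0 powr t = 0\<close> keeps this valid for vanishing vectors, also when t is
  negative.\<close>

lemma nn_integral_walk_powr:
  "(\<integral>\<^sup>+\<omega>. ennreal ((norm (P m \<omega> *v y))\<^sup>2 powr t) \<partial>M) = ennreal ((norm y)\<^sup>2 powr t) * (\<integral>\<^sup>+s. ennreal (s powr t) \<partial>Q) ^ m"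
proof (induction m)
  case 0
  then show ?case by (simp add: matrix_vector_mul_lid emeasure_space_1)
next
  case (Suc m)
  have "(\<integral>\<^sup>+\<omega>. ennreal ((norm (P (Suc m) \<omega> *v y))\<^sup>2 powr t) \<partial>M) = (\<integral>\<^sup>+\<omega>. (\<integral>\<^sup>+s. ennreal ((s * (norm (P m \<omega> *v y))\<^sup>2) powr t) \<partial>Q) \<partial>M)"
    by (rule nn_integral_walk) measurable
  also have "\<dots> = (\<integral>\<^sup>+\<omega>. ennreal ((norm (P m \<omega> *v y))\<^sup>2 powr t) * (\<integral>\<^sup>+s. ennreal (s powr t) \<partial>Q) \<partial>M)"
  proof (rule nn_integral_cong)
    fix \<omega>
    have "(\<integral>\<^sup>+s. ennreal ((s * (norm (P m \<omega> *v y))\<^sup>2) powr t) \<partial>Q) = (\<integral>\<^sup>+s. ennreal ((norm (P m \<omega> *v y))\<^sup>2 powr t) * ennreal (s powr t) \<partial>Q)"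
      by (simp add: powr_mult ennreal_mult mult.commute)
    also have "\<dots> = ennreal ((norm (P m \<omega> *v y))\<^sup>2 powr t) * (\<integral>\<^sup>+s. ennreal (s powr t) \<partial>Q)"
      by (rule nn_integral_cmult) measurable
    finally show "(\<integral>\<^sup>+s. ennreal ((s * (norm (P m \<omega> *v y))\<^sup>2) powr t) \<partial>Q) = ennreal ((norm (P m \<omega> *v y))\<^sup>2 powr t) * (\<integral>\<^sup>+s. ennreal (s powr t) \<partial>Q)" .
  qed
  also have "\<dots> = (\<integral>\<^sup>+\<omega>. ennreal ((norm (P m \<omega> *v y))\<^sup>2 powr t) \<partial>M) * (\<integral>\<^sup>+s. ennreal (s powr t) \<partial>Q)"
    by (rule nn_integral_multc) measurable
  finally show ?case by (simp add: Suc mult_ac)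
qed

text \<open>Chernoff's argument: Markov's inequality for the power \<sigma>t bounds the probability
  of the m-th bad event by a multiple of (\<rho>/q)^m with \<rho> < q, and Borel--Cantelli applies.
  The sign \<sigma> covers upper and lower bounds together.\<close>

lemma AE_walk_log_bound:
  assumes y: "y \<noteq> 0" and \<sigma>: "\<bar>\<sigma>\<bar> = 1" and \<delta>: "\<delta> > 0"
  shows "AE \<omega> in M. \<forall>\<^sub>F m in sequentially. \<sigma> * ln ((norm (P m \<omega> *v y))\<^sup>2) < real m * (\<sigma> * (\<integral>s. ln s \<partial>Q) + \<delta>)"
proof -
  define L where "L = (\<integral>s. ln s \<partial>Q)"
  obtain t where t: "0 < t" "t \<le> h" "(\<integral>s. s powr (\<sigma> * t) \<partial>Q) < exp (t * (\<sigma> * L + \<delta>))"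
    unfolding L_def using powr_moment_less_exp[OF prob_Q sets_Q pos_Q h int_Q \<sigma> \<delta>] .
  define \<rho> where "\<rho> = (\<integral>s. s powr (\<sigma> * t) \<partial>Q)"
  define q where "q = exp (t * (\<sigma> * L + \<delta>))"
  have "\<bar>\<sigma> * t\<bar> \<le> h" using \<sigma> t by (simp add: abs_mult)
  then have "integrable Q (\<lambda>s. s powr (\<sigma> * t))"
    by (rule integrable_powr_of_powr[OF prob_Q sets_Q pos_Q h int_Q])
  then have \<rho>: "(\<integral>\<^sup>+s. ennreal (s powr (\<sigma> * t)) \<partial>Q) = ennreal \<rho>" "\<rho> \<ge> 0"
    unfolding \<rho>_def by (auto intro!: nn_integral_eq_integral)
  have q: "q > 0" "\<rho> < q" using t by (auto simp: q_def \<rho>_def)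
  define N where "N = (\<lambda>m \<omega>. (norm (P m \<omega> *v y))\<^sup>2)"
  have [measurable]: "N m \<in> borel_measurable M" for m unfolding N_def by measurable
  define K where "K = (norm y)\<^sup>2 powr (\<sigma> * t)"
  define A where "A = (\<lambda>m. {\<omega> \<in> space M. q ^ m \<le> N m \<omega> powr (\<sigma> * t)})"
  have [measurable]: "A m \<in> sets M" for m unfolding A_def by measurable
  have mA: "measure M (A m) \<le> K * (\<rho> / q) ^ m" for m
  proof -
    have "ennreal (q ^ m) * emeasure M (A m) = (\<integral>\<^sup>+\<omega>. ennreal (q ^ m) * indicator (A m) \<omega> \<partial>M)"
      by (rule nn_integral_cmult_indicator[symmetric]) measurable
    also have "\<dots> \<le> (\<integral>\<^sup>+\<omega>. ennreal (N m \<omega> powr (\<sigma> * t)) \<partial>M)"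
      by (intro nn_integral_mono) (auto simp: A_def intro!: ennreal_leI split: split_indicator)
    also have "\<dots> = ennreal K * ennreal \<rho> ^ m"
      unfolding N_def K_def nn_integral_walk_powr \<rho> ..
    also have "\<dots> = ennreal (K * \<rho> ^ m)"
      using \<rho> by (simp add: K_def ennreal_mult ennreal_power)
    finally have "ennreal (q ^ m * measure M (A m)) \<le> ennreal (K * \<rho> ^ m)"
      using q by (simp add: emeasure_eq_measure ennreal_mult)
    then have "q ^ m * measure M (A m) \<le> K * \<rho> ^ m"
      using \<rho> by (subst (asm) ennreal_le_iff) (auto simp: K_def)
    then show ?thesis using q by (simp add: power_divide field_simps)
  qed
  have "summable (\<lambda>m. measure M (A m))"
  proof (rule summable_comparison_test'[of _ 0])
    show "summable (\<lambda>m. K * (\<rho> / q) ^ m)"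
      using q \<rho> by (intro summable_mult summable_geometric) auto
    show "norm (measure M (A m)) \<le> K * (\<rho> / q) ^ m" for m using mA by simp
  qed
  then have "AE \<omega> in M. \<forall>\<^sub>F m in sequentially. \<omega> \<in> space M - A m"
    by (intro borel_cantelli_AE1) (auto simp: emeasure_eq_measure)
  moreover have "AE \<omega> in M. \<forall>m. P m \<omega> *v y \<noteq> 0"
    using AE_walk_nonzero[OF y] by (simp add: AE_all_countable)
  ultimately show ?thesis
  proof eventually_elim
    case (elim \<omega>)
    from elim(1) show ?case
    proof eventually_elim
      case (elim m)
      have N0: "N m \<omega> > 0" using \<open>\<forall>m. P m \<omega> *v y \<noteq> 0\<close> by (simp add: N_def)
      have "N m \<omega> powr (\<sigma> * t) < q ^ m" using elim by (auto simp: A_def)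
      then have "exp (\<sigma> * t * ln (N m \<omega>)) < exp (real m * (t * (\<sigma> * L + \<delta>)))"
        using N0 by (simp add: powr_def q_def exp_of_nat_mult)
      then have "t * (\<sigma> * ln (N m \<omega>)) < t * (real m * (\<sigma> * L + \<delta>))"
        by (simp add: mult_ac)
      then have "\<sigma> * ln (N m \<omega>) < real m * (\<sigma> * L + \<delta>)"
        using t(1) by (simp only: mult_less_cancel_left_pos)
      then show ?case by (simp only: N_def L_def)
    qed
  qed
qed

text \<open>Both signs of \<open>AE_walk_log_bound\<close> with \<delta> = 1/(k+1), over countably
  many k, so that the null sets can be united. The logarithm of the squared norm accounts for the
  factor 1/2.\<close>

lemma AE_growth_tendsto:
  assumes y: "y \<noteq> 0"
  shows "AE \<omega> in M. (\<forall>m. P m \<omega> *v y \<noteq> 0) \<and> (\<lambda>m. ln (norm (P m \<omega> *v y)) / real m) \<longlonglongrightarrow> (\<integral>s. ln s \<partial>Q) / 2"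
proof -
  define L where "L = (\<integral>s. ln s \<partial>Q)"
  have "AE \<omega> in M. \<forall>k. \<forall>\<^sub>F m in sequentially. 1 * ln ((norm (P m \<omega> *v y))\<^sup>2) < real m * (1 * L + 1 / real (Suc k))"
    unfolding L_def by (simp only: AE_all_countable) (intro allI AE_walk_log_bound y; simp)
  moreover have "AE \<omega> in M. \<forall>k. \<forall>\<^sub>F m in sequentially. (-1) * ln ((norm (P m \<omega> *v y))\<^sup>2) < real m * ((-1) * L + 1 / real (Suc k))"
    unfolding L_def by (simp only: AE_all_countable) (intro allI AE_walk_log_bound y; simp)
  moreover have "AE \<omega> in M. \<forall>m. P m \<omega> *v y \<noteq> 0"
    using AE_walk_nonzero[OF y] by (simp add: AE_all_countable)
  ultimately show ?thesis
  proof eventually_elim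
    case (elim \<omega>)
    define N where "N = (\<lambda>m. norm (P m \<omega> *v y))"
    have N: "ln ((N m)\<^sup>2) = 2 * ln (N m)" for m using elim(3) by (simp add: N_def ln_realpow)
    have "(\<lambda>m. ln (N m) / real m) \<longlonglongrightarrow> L / 2"
    proof (rule tendstoI)
      fix e :: real assume "e > 0"
      then obtain k where k: "1 / real (Suc k) < e" using nat_approx_posE by blast
      from elim(1)[rule_format, of k] elim(2)[rule_format, of k] eventually_gt_at_top[of 0]
      show "\<forall>\<^sub>F m in sequentially. dist (ln (N m) / real m) (L / 2) < e"
      proof eventually_elim
        case (elim m)
        define c where "c = 1 / real (Suc k)"
        have "2 * ln (N m) < real m * (L + c)" "- (2 * ln (N m)) < real m * (- L + c)"
          using elim(1,2) N[of m] unfolding N_def c_def by (simp_all del: of_nat_Suc)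
        then have "ln (N m) / real m < (L + c) / 2" "- (ln (N m) / real m) < (- L + c) / 2"
          using \<open>0 < m\<close> by (simp_all add: field_simps)
        moreover have "c / 2 < e" using k[folded c_def] \<open>e > 0\<close> by linarith
        ultimately show ?case unfolding dist_real_def abs_less_iff add_divide_distrib by linarith
      qed
    qed
    then show ?case using elim(3) by (simp add: N_def L_def)
  qed
qed

lemma growth_rate_eq:
  "A m *v y \<noteq> 0 \<Longrightarrow> ereal (1 / real m) * eln (norm (A m *v y)) = ereal (ln (norm (A m *v y)) / real m)"
  by (simp add: eln_def)

text \<open>On the almost sure event where all basis vectors grow at rate \<mu>, the column bound
  gives limsup at most \<mu> for every nonzero \<open>y\<close> simultaneously, and a single basis
  vector attains \<mu> as a limit. Both suprema are therefore \<mu>.\<close>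

theorem largest_lyapunov_exponent:
  "is_largest_lyapunov_exponent M X ((\<integral>s. ln s \<partial>Q) / 2)"
proof -
  define \<mu> where "\<mu> = (\<integral>s. ln s \<partial>Q) / 2"
  have "AE \<omega> in M. \<forall>j. (\<forall>m. P m \<omega> *v axis j 1 \<noteq> 0) \<and> (\<lambda>m. ln (norm (P m \<omega> *v axis j 1)) / real m) \<longlonglongrightarrow> \<mu>"
    unfolding \<mu>_def AE_all_countable by (intro allI AE_growth_tendsto) (simp add: axis_eq_0_iff)
  then show ?thesis
    unfolding is_largest_lyapunov_exponent_def \<mu>_def[symmetric]
  proof eventually_elim
    case (elim \<omega>)
    note good = elim
    let ?g = "growth_rate (\<lambda>i. X i \<omega>)"
    have up: "limsup (?g y) \<le> ereal \<mu>" if y: "y \<noteq> 0" for y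
    proof (rule ereal_le_epsilon2)
      fix e :: real assume e: "e > 0"
      define S where "S = (\<Sum>j\<in>UNIV. norm (y $ j))"
      have S: "S > 0"
      proof -
        obtain j where "y $ j \<noteq> 0" using y by (auto simp: vec_eq_iff)
        then show ?thesis unfolding S_def by (intro sum_pos2[of _ j]) auto
      qed
      have "\<forall>\<^sub>F m in sequentially. \<forall>j. ln (norm (P m \<omega> *v axis j 1)) / real m < \<mu> + e / 2"
        using elim e by (intro eventually_all_finite order_tendstoD(2)[of _ \<mu>]) auto
      moreover have "(\<lambda>m. ln S / real m) \<longlonglongrightarrow> 0" by real_asymp
      then have "\<forall>\<^sub>F m in sequentially. ln S / real m < e / 2" using e by (intro order_tendstoD(2)) auto
      ultimately have "\<forall>\<^sub>F m in sequentially. ?g y m \<le> ereal (\<mu> + e)"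
        using eventually_gt_at_top[of 0]
      proof eventually_elim
        case (elim m)
        note m = elim
        show ?case
        proof (cases "P m \<omega> *v y = 0")
          \<comment> \<open>Here \<open>eln 0\<close> is minus infinity and 1/m is positive, so the
            growth rate is minus infinity; at m = 0 the factor would be 0.\<close>
          case True
          then show ?thesis using \<open>0 < m\<close> by (simp add: growth_rate_def eln_def)
        next
          case False
          have ax: "norm (P m \<omega> *v axis j 1) \<le> exp (real m * (\<mu> + e / 2))" for j
          proof -
            have "ln (norm (P m \<omega> *v axis j 1)) \<le> real m * (\<mu> + e / 2)"
              using m(1)[rule_format, of j] \<open>0 < m\<close> by (simp add: field_simps)
            then have "exp (ln (norm (P m \<omega> *v axis j 1))) \<le> exp (real m * (\<mu> + e / 2))" by simp
            then show ?thesis using good by simp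
          qed
          have "norm (P m \<omega> *v y) \<le> (\<Sum>j\<in>UNIV. norm (P m \<omega> *v axis j 1) * norm (y $ j))"
            by (rule norm_matrix_vector_mult_le_axis)
          also have "\<dots> \<le> (\<Sum>j\<in>UNIV. exp (real m * (\<mu> + e / 2)) * norm (y $ j))"
            by (intro sum_mono mult_right_mono ax) auto
          also have "\<dots> = exp (real m * (\<mu> + e / 2)) * S" by (simp add: S_def sum_distrib_left)
          finally have "ln (norm (P m \<omega> *v y)) \<le> ln (exp (real m * (\<mu> + e / 2)) * S)"
            using False S by (subst ln_le_cancel_iff) auto
          also have "\<dots> = real m * (\<mu> + e / 2) + ln S" using S by (simp add: ln_mult)
          finally have "ln (norm (P m \<omega> *v y)) / real m \<le> \<mu> + e / 2 + ln S / real m"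
            using \<open>0 < m\<close> by (simp add: field_simps)
          also have "\<dots> \<le> \<mu> + e" using m(2) by linarith
          finally show ?thesis using False by (simp add: growth_rate_def growth_rate_eq)
        qed
      qed
      then have "limsup (?g y) \<le> ereal (\<mu> + e)" by (rule Limsup_bounded)
      then show "limsup (?g y) \<le> ereal \<mu> + ereal e" by simp
    qed
    define y0 :: "'k^'n" where "y0 = axis undefined 1"
    have y0: "y0 \<noteq> 0" by (simp add: y0_def axis_eq_0_iff)
    have "(\<lambda>m. ereal (ln (norm (P m \<omega> *v y0)) / real m)) \<longlonglongrightarrow> ereal \<mu>"
      using elim by (auto simp: y0_def)
    moreover have "?g y0 = (\<lambda>m. ereal (ln (norm (P m \<omega> *v y0)) / real m))"
      using elim by (simp add: fun_eq_iff growth_rate_def growth_rate_eq y0_def)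
    ultimately have lim: "?g y0 \<longlonglongrightarrow> ereal \<mu>" by (simp only:)
    show ?case
    proof (intro conjI antisym)
      show "Sup {L. \<exists>y. y \<noteq> 0 \<and> ?g y \<longlonglongrightarrow> L} \<le> ereal \<mu>"
      proof (rule Sup_least, elim CollectE exE conjE)
        fix L y assume "y \<noteq> 0" "?g y \<longlonglongrightarrow> L"
        then show "L \<le> ereal \<mu>" using up[of y] lim_imp_Limsup[of sequentially "?g y" L] by simp
      qed
      show "ereal \<mu> \<le> Sup {L. \<exists>y. y \<noteq> 0 \<and> ?g y \<longlonglongrightarrow> L}"
        using y0 lim by (intro Sup_upper) auto
      show "(SUP y\<in>{y. y \<noteq> 0}. limsup (?g y)) \<le> ereal \<mu>"
        using up by (intro SUP_least) auto
      have "ereal \<mu> = limsup (?g y0)" using lim_imp_Limsup[OF _ lim] by simp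
      also have "\<dots> \<le> (SUP y\<in>{y. y \<noteq> 0}. limsup (?g y))" using y0 by (intro SUP_upper) auto
      finally show "ereal \<mu> \<le> (SUP y\<in>{y. y \<noteq> 0}. limsup (?g y))" .
    qed
  qed
qed

end

section \<open>The Lyapunov exponent\<close>

text \<open>Independence passes from the rows to their squared norms |x_l u|^2, so the joint law is
  a product of beta laws and the squared norm of the image is their sum.\<close>

lemma distr_norm_beta_I_rows:
  fixes Y :: "'w \<Rightarrow> ('k::{real_normed_div_algebra,euclidean_space})^'n^'n"
  assumes "prob_space M" and \<beta>: "\<beta> = DIM('k)" and \<nu>: "\<And>l. \<nu> l > 0"
    and Y: "beta_I_rows M \<beta> \<nu> Y" and u: "norm u = 1"
  shows "distr M borel (\<lambda>\<omega>. (norm (Y \<omega> *v u))\<^sup>2) = sum_law (real \<beta> / 2) (alpha \<beta> \<nu>)"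
proof -
  interpret prob_space M by fact
  let ?Z = "\<lambda>l \<omega>. (norm (row_apply (Y \<omega> $ l) u))\<^sup>2"
  have Y1: "indep_vars (\<lambda>_. borel) (\<lambda>l \<omega>. Y \<omega> $ l) UNIV"
    and Y2: "distributed M lborel (\<lambda>\<omega>. Y \<omega> $ l) (\<lambda>x. ennreal (beta_I_density \<beta> (\<nu> l) x))" for l
    using Y by (simp_all add: beta_I_rows_def)
  have [measurable]: "(\<lambda>\<omega>. Y \<omega> $ l) \<in> borel_measurable M" for l
    using distributed_measurable[OF Y2[of l]] by simp
  have "indep_vars (\<lambda>_. borel) ?Z UNIV"
    by (rule indep_vars_compose2[OF Y1, where Y = "\<lambda>_ x. (norm (row_apply x u))\<^sup>2"]) measurable
  then have D: "distr M (\<Pi>\<^sub>M l\<in>UNIV. borel) (\<lambda>\<omega>. \<lambda>l\<in>UNIV. ?Z l \<omega>) = (\<Pi>\<^sub>M l\<in>UNIV. distr M borel (?Z l))"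
    by (subst (asm) indep_vars_iff_distr_eq_PiM') auto
  also have "\<dots> = (\<Pi>\<^sub>M l\<in>UNIV. beta_law (real \<beta> / 2) (alpha \<beta> \<nu> l))"
    unfolding alpha_def by (intro PiM_cong refl distr_norm_row_apply u \<beta> \<nu> prob_space_axioms Y2)
  finally have D: "distr M (\<Pi>\<^sub>M l\<in>UNIV. borel) (\<lambda>\<omega>. \<lambda>l\<in>UNIV. ?Z l \<omega>) = (\<Pi>\<^sub>M l\<in>UNIV. beta_law (real \<beta> / 2) (alpha \<beta> \<nu> l))" .
  have "sum_law (real \<beta> / 2) (alpha \<beta> \<nu>) = distr (distr M (\<Pi>\<^sub>M l\<in>UNIV. borel) (\<lambda>\<omega>. \<lambda>l\<in>UNIV. ?Z l \<omega>)) borel (\<lambda>x. \<Sum>l\<in>UNIV. x l)"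
    unfolding sum_law_def D ..
  also have "\<dots> = distr M borel ((\<lambda>x. \<Sum>l\<in>UNIV. x l) \<circ> (\<lambda>\<omega>. \<lambda>l\<in>UNIV. ?Z l \<omega>))"
    by (rule distr_distr) measurable
  also have "(\<lambda>x. \<Sum>l\<in>UNIV. x l) \<circ> (\<lambda>\<omega>. \<lambda>l\<in>UNIV. ?Z l \<omega>) = (\<lambda>\<omega>. (norm (Y \<omega> *v u))\<^sup>2)"
    by (simp add: fun_eq_iff norm_matrix_vector_mult_squared)
  finally show ?thesis ..
qed

text \<open>Each hypergeometric factor is the characteristic function of a beta law at -2\<pi>n/b;
  their product belongs to the sum of independent variables.\<close>

lemma fourier_coeff_eq:
  fixes \<nu> :: "'n::finite \<Rightarrow> real"
  assumes \<beta>: "\<beta> > 0" and \<alpha>: "\<And>l. alpha \<beta> \<nu> l > 0"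
  defines "b \<equiv> real \<beta> * real CARD('n)"
  shows "fourier_coeff \<beta> \<nu> n = of_real (1 / b) * (\<integral>s. cis (- (2 * pi / b * real_of_int n * s)) \<partial>sum_law (real \<beta> / 2) (alpha \<beta> \<nu>))"
proof -
  define k where "k = - (2 * pi / b * real_of_int n)"
  have a: "real \<beta> / 2 > 0" using \<beta> by simp
  have "- (2 * of_real pi * \<i> * of_int n / (of_nat \<beta> * of_nat CARD('n))) = \<i> * of_real k"
    by (simp add: k_def b_def mult_ac)
  moreover have "hyp1F1 (real \<beta> / 2) (real \<beta> / 2 + alpha \<beta> \<nu> l) (\<i> * of_real k) = (\<integral>x. cis (k * x) \<partial>beta_law (real \<beta> / 2) (alpha \<beta> \<nu> l))" for l
    unfolding beta_law_exp[OF a \<alpha>, symmetric] by (simp add: cis_conv_exp mult_ac)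
  ultimately have "fourier_coeff \<beta> \<nu> n = of_real (1 / b) * (\<Prod>l\<in>UNIV. \<integral>x. cis (k * x) \<partial>beta_law (real \<beta> / 2) (alpha \<beta> \<nu> l))"
    unfolding fourier_coeff_def b_def by simp
  also have "(\<Prod>l\<in>UNIV. \<integral>x. cis (k * x) \<partial>beta_law (real \<beta> / 2) (alpha \<beta> \<nu> l)) = (\<integral>s. cis (k * s) \<partial>sum_law (real \<beta> / 2) (alpha \<beta> \<nu>))"
    by (rule integral_cis_sum_law[OF a \<alpha>, symmetric])
  finally show ?thesis by (simp add: k_def)
qed

lemma fourier_coeff_decay:
  fixes \<nu> :: "'n::finite \<Rightarrow> real"
  assumes \<beta>: "\<beta> > 0" and \<alpha>: "\<And>l. alpha \<beta> \<nu> l > 0"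
  obtains C \<epsilon> where "0 < \<epsilon>" "\<epsilon> \<le> 1" "\<forall>n::nat. n > 0 \<longrightarrow> norm (fourier_coeff \<beta> \<nu> (int n)) \<le> C * real n powr (- \<epsilon>)"
proof -
  define b where "b = real \<beta> * real CARD('n)"
  have b: "b > 0" using \<beta> by (simp add: b_def)
  have a: "real \<beta> / 2 > 0" using \<beta> by simp
  \<comment> \<open>Any row will do, since one factor already decays.\<close>
  fix l :: 'n
  obtain C \<epsilon> where C: "0 < \<epsilon>" "\<epsilon> \<le> 1" "C \<ge> 0"
    "\<And>\<omega>. \<omega> > 0 \<Longrightarrow> norm (\<integral>x. cis (- (\<omega> * x)) \<partial>beta_law (real \<beta> / 2) (alpha \<beta> \<nu> l)) \<le> C * \<omega> powr (- \<epsilon>)"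
    using beta_law_cis_decay[OF a \<alpha>[of l]] by metis
  show ?thesis
  proof (rule that[OF C(1,2)], intro allI impI)
    fix n :: nat assume n: "n > 0"
    define k where "k = 2 * pi / b * real n"
    have k: "k > 0" using n b by (simp add: k_def)
    have "norm (fourier_coeff \<beta> \<nu> (int n)) = (1 / b) * norm (\<integral>s. cis ((- k) * s) \<partial>sum_law (real \<beta> / 2) (alpha \<beta> \<nu>))"
      unfolding fourier_coeff_eq[OF \<beta> \<alpha>] b_def[symmetric] using b by (simp add: norm_mult norm_divide k_def)
    also have "\<dots> \<le> (1 / b) * (C * k powr (- \<epsilon>))"
      using C(4)[OF k] b by (intro mult_left_mono order_trans[OF norm_integral_cis_sum_law_le[OF a \<alpha>, where k = "- k" and l = l]]) auto
    also have "k powr (- \<epsilon>) = (2 * pi / b) powr (- \<epsilon>) * real n powr (- \<epsilon>)"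
      unfolding k_def by (rule powr_mult)
    finally show "norm (fourier_coeff \<beta> \<nu> (int n)) \<le> (1 / b * C * (2 * pi / b) powr (- \<epsilon>)) * real n powr (- \<epsilon>)"
      by (simp add: mult_ac)
  qed
qed

text \<open>\<open>summable_on\<close> over the integers means absolute convergence, which covers
  every order of summation of the two-sided series and excludes the default value 0 of a divergent
  infinite sum.\<close>

theorem proposition10:
  fixes M :: "'w measure"
    and X :: "nat \<Rightarrow> 'w \<Rightarrow> ('k::{real_normed_div_algebra,euclidean_space})^'n^'n"
    and \<beta> :: nat
    and \<nu> :: "'n::finite \<Rightarrow> real"
  assumes "\<beta> = DIM('k)" and "\<beta> \<in> {1, 2, 4}"
    and "\<And>l. \<nu> l > 0"
    and "prob_space M"
    and "prob_space.indep_vars M (\<lambda>_. borel) X {1..}"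
    and "\<And>i. i \<ge> 1 \<Longrightarrow> beta_I_rows M \<beta> \<nu> (X i)"
  shows "\<exists>\<mu>\<^sub>1. is_largest_lyapunov_exponent M X \<mu>\<^sub>1 \<and>
    (\<lambda>n::int. fourier_coeff \<beta> \<nu> n * log_fourier_integral (real \<beta> * real CARD('n)) n)
      summable_on UNIV \<and>
    complex_of_real \<mu>\<^sub>1 = 1 / 2 *
      (\<Sum>\<^sub>\<infinity>n::int. fourier_coeff \<beta> \<nu> n * log_fourier_integral (real \<beta> * real CARD('n)) n)"
proof -
  define b where "b = real \<beta> * real CARD('n)"
  define Q where "Q = sum_law (real \<beta> / 2) (alpha \<beta> \<nu>)"
  have \<beta>: "\<beta> > 0" using assms(1) by simp
  have a: "real \<beta> / 2 > 0" using \<beta> by simp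
  have N: "real CARD('n) \<ge> 1" by (simp add: Suc_leI)
  have \<alpha>: "alpha \<beta> \<nu> l > 0" for l
  proof -
    have "real CARD('n) + \<nu> l - 1 > 0" using N assms(3)[of l] by linarith
    then have "real \<beta> * (real CARD('n) + \<nu> l - 1) > 0" using \<beta> by (intro mult_pos_pos) auto
    then show ?thesis by (simp add: alpha_def)
  qed
  have b: "b > 0" using \<beta> by (simp add: b_def)
  have Q: "prob_space Q" "sets Q = sets borel"
    unfolding Q_def by (rule prob_space_sum_law[OF a \<alpha>]) simp
  have AE_Q: "AE s in Q. 0 < s \<and> s < real CARD('n)"
    unfolding Q_def by (rule AE_sum_law[OF a \<alpha>])
  have pos_Q: "AE s in Q. 0 < s" using AE_Q by eventually_elim simp
  have AE_Q': "AE s in Q. 0 < s \<and> s < b"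
    using AE_Q
  proof eventually_elim
    case (elim s)
    \<comment> \<open>The sum of N variables below 1 stays within one period because \<beta> is at
      least 1.\<close>
    have "1 * real CARD('n) \<le> b" unfolding b_def using \<beta> by (intro mult_right_mono) auto
    then show ?case using elim by simp
  qed
  \<comment> \<open>The moment order is a/2 with a = \<beta>/2, as in
    \<open>integrable_powr_sum_law\<close>.\<close>
  have h: "real \<beta> / 2 / 2 > 0" using \<beta> by simp
  have int_Q: "integrable Q (\<lambda>s. s powr (real \<beta> / 2 / 2))" "integrable Q (\<lambda>s. s powr - (real \<beta> / 2 / 2))"
    unfolding Q_def by (rule integrable_powr_sum_law[OF a \<alpha>])+
  have int_ln: "integrable Q ln"
    by (rule integrable_ln_of_powr[OF Q pos_Q h int_Q])
  interpret isotropic_matrix_walk M X Q "real \<beta> / 2 / 2"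
  proof (rule isotropic_matrix_walk.intro[OF assms(4,5) Q pos_Q h int_Q])
    show "distr M borel (\<lambda>\<omega>. (norm (X i \<omega> *v u))\<^sup>2) = Q" if "i \<ge> 1" "norm u = 1" for i u
      unfolding Q_def by (rule distr_norm_beta_I_rows[OF assms(4,1,3) assms(6)[OF that(1)] that(2)])
  qed
  obtain C \<epsilon> where C: "0 < \<epsilon>" "\<epsilon> \<le> 1" "\<forall>n::nat. n > 0 \<longrightarrow> norm (fourier_coeff \<beta> \<nu> (int n)) \<le> C * real n powr (- \<epsilon>)"
    by (rule fourier_coeff_decay[OF \<beta> \<alpha>]) (rule that)
  have "((\<lambda>n. fourier_coeff \<beta> \<nu> n * log_fourier_integral b n) has_sum of_real (\<integral>s. ln s \<partial>Q)) UNIV"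
    by (rule expectation_ln_has_sum[OF Q b AE_Q' int_ln fourier_coeff_eq[OF \<beta> \<alpha>, folded b_def Q_def] C(3)[rule_format] C(1,2)])
  note sum = has_sum_imp_summable[OF this] infsumI[OF this]
  show ?thesis
    unfolding b_def[symmetric] sum(2)
    by (intro exI[of _ "(\<integral>s. ln s \<partial>Q) / 2"] conjI largest_lyapunov_exponent sum(1)) simp
qed

end
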